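(* Let $\Gamma$ be a compact metric graph, let $U$, $\mathcal{D}_{\mathcal{A}}$, $\mathcal{H}_{\mathcal{A}}$ be as defined in the context, and let $\Sigma\subset U$ be the set of all $\mathcal{A}\in U$ for which the operator $\mathcal{H}_{\mathcal{A}}-i\,\mathbb{I}:\mathcal{D}_{\mathcal{A}}\to L^2(\Gamma)$ is not continuously invertible. Then the resolvent $(\mathcal{H}_{\mathcal{A}}-i\,\mathbb{I})^{-1}$, defined for $\mathcal{A}\in U\setminus\Sigma$, is an analytic function of $\mathcal{A}$, and its values are compact operators in $L^2(\Gamma)$.
   Context: A compact metric graph $\Gamma$ has a finite vertex set $\mathcal{V}$ and a finite edge set $\mathcal{E}$; each edge $e$ is a segment of finite length $L_e>0$ with a coordinate $x_e$. $L^2(\Gamma)=\bigoplus_{e}L^2(e)$ and $\widetilde{H}^2(\Gamma)=\bigoplus_{e\in\mathcal{E}}H^2(e)$ (no conditions at vertices). For a vertex $v$ of degree $d_v$ and $f\in\widetilde{H}^2(\Gamma)$, $F(v)\in\mathbb{C}^{d_v}$ is the column vector of values of $f$ at $v$ along the $d_v$ edge-ends incident to $v$, and $F'(v)\in\mathbb{C}^{d_v}$ is the column vector of the derivatives of $f$ at $v$ along these edges, taken away from the vertex and into the edges. Put $q=\sum_{v}d_v^2$. A collection $\mathcal{A}=\{(A_v\ B_v)\}_{v\in\mathcal{V}}$ of complex $d_v\times 2d_v$ matrices is identified with a point of $\mathbb{C}^{2q}$. $U\subset\mathbb{C}^{2q}$ is the (open) set of all $\mathcal{A}$ such that $(A_v\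 B_v)$ has maximal rank $d_v$ for every $v\in\mathcal{V}$. For $\mathcal{A}\in U$, $$\mathcal{D}_{\mathcal{A}}:=\{f\in\widetilde{H}^2(\Gamma)\mid A_vF(v)+B_vF'(v)=0\text{ for all }v\in\mathcal{V}\},$$ with the norm of $\widetilde{H}^2(\Gamma)$, and $\mathcal{H}_{\mathcal{A}}$ is the operator $-d^2/dx^2$ (acting on each edge) with domain $\mathcal{D}_{\mathcal{A}}$. $\mathbb{I}$ denotes the identity operator in $L^2(\Gamma)$. *)

theory Defs
  imports
    "HOL-Analysis.Analysis"
    "Jordan_Normal_Form.DL_Rank"
    "Graph_Theory.Digraph"
begin

section \<open>Metric graphs\<close>

text \<open>
  Loops and parallel edges are allowed.  The orientation of an arc only fixes the direction of its
  coordinate: \<open>x = 0\<close> at the tail and \<open>x = edge_length e\<close> at the head.  The edge-end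
  \<open>(e, False)\<close> is the tail end of \<open>e\<close>, and \<open>(e, True)\<close> its head end, so that a loop contributes
  two edge-ends to its vertex.  The list \<open>ends_at v\<close> is the (arbitrary) ordering of the edge-ends at
  \<open>v\<close> which is needed in order to write \<open>F(v)\<close> and \<open>F'(v)\<close> as column vectors.
\<close>

record ('v, 'e) metric_graph =
  graph_of :: "('v, 'e) pre_digraph"
  edge_length :: "'e \<Rightarrow> real"
  ends_at :: "'v \<Rightarrow> ('e \<times> bool) list"

abbreviation vertices :: "('v, 'e) metric_graph \<Rightarrow> 'v set" where
  "vertices \<Gamma> \<equiv> verts (graph_of \<Gamma>)"

abbreviation edges :: "('v, 'e) metric_graph \<Rightarrow> 'e set" where
  "edges \<Gamma> \<equiv> arcs (graph_of \<Gamma>)"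

definition edge_ends :: "('v, 'e) metric_graph \<Rightarrow> 'v \<Rightarrow> ('e \<times> bool) set" where
  "edge_ends \<Gamma> v =
     {(e, b). e \<in> edges \<Gamma> \<and> (if b then head (graph_of \<Gamma>) e else tail (graph_of \<Gamma>) e) = v}"

definition deg :: "('v, 'e) metric_graph \<Rightarrow> 'v \<Rightarrow> nat" where
  "deg \<Gamma> v = card (edge_ends \<Gamma> v)"

definition compact_metric_graph :: "('v, 'e) metric_graph \<Rightarrow> bool" where
  "compact_metric_graph \<Gamma> \<longleftrightarrow>
     fin_digraph (graph_of \<Gamma>) \<and>
     (\<forall>e \<in> edges \<Gamma>. edge_length \<Gamma> e > 0) \<and>
     (\<forall>v \<in> vertices \<Gamma>. distinct (ends_at \<Gamma> v) \<and> set (ends_at \<Gamma> v) = edge_ends \<Gamma> v)"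

section \<open>Function spaces on an edge\<close>

text \<open>
  Elements of \<open>L\<^sup>2\<close> and \<open>H\<^sup>2\<close> are handled through representatives: functions that agree almost
  everywhere on \<open>[0, L]\<close> represent the same element, and values outside \<open>[0, L]\<close> are irrelevant.
\<close>

definition L2_interval :: "real \<Rightarrow> (real \<Rightarrow> complex) set" where
  "L2_interval L =
     {f. f \<in> borel_measurable (lebesgue_on {0..L}) \<and>
         integrable (lebesgue_on {0..L}) (\<lambda>x. (cmod (f x))\<^sup>2)}"

text \<open>Test functions are of class \<open>C\<^sup>1\<close> with compact support in the open interval \<open>(0, L)\<close>.\<close>

definition is_weak_derivative :: "real \<Rightarrow> (real \<Rightarrow> complex) \<Rightarrow> (real \<Rightarrow> complex) \<Rightarrow> bool" where
  "is_weak_derivative L f g \<longleftrightarrow>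
     (\<forall>\<phi> \<phi>' :: real \<Rightarrow> real.
        (\<forall>x. (\<phi> has_real_derivative \<phi>' x) (at x)) \<and> continuous_on UNIV \<phi>' \<and>
        (\<exists>a b. 0 < a \<and> b < L \<and> (\<forall>x. x \<notin> {a..b} \<longrightarrow> \<phi> x = 0)) \<longrightarrow>
        (LINT x|lebesgue_on {0..L}. f x * of_real (\<phi>' x)) =
          - (LINT x|lebesgue_on {0..L}. g x * of_real (\<phi> x)))"

definition H1_interval :: "real \<Rightarrow> (real \<Rightarrow> complex) set" where
  "H1_interval L = {f \<in> L2_interval L. \<exists>g \<in> L2_interval L. is_weak_derivative L f g}"

text \<open>The weak derivative; for \<open>f \<in> H\<^sup>1(0, L)\<close> it is unique up to null sets.\<close>

definition weak_deriv :: "real \<Rightarrow> (real \<Rightarrow> complex) \<Rightarrow> real \<Rightarrow> complex" where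
  "weak_deriv L f = (SOME g. g \<in> L2_interval L \<and> is_weak_derivative L f g)"

definition H2_interval :: "real \<Rightarrow> (real \<Rightarrow> complex) set" where
  "H2_interval L = {f \<in> H1_interval L. weak_deriv L f \<in> H1_interval L}"

text \<open>
  Pointwise values of an element of \<open>H\<^sup>1(0, L)\<close> are those of its continuous representative, which
  is uniquely determined on \<open>[0, L]\<close>.
\<close>

definition cont_rep :: "real \<Rightarrow> (real \<Rightarrow> complex) \<Rightarrow> real \<Rightarrow> complex" where
  "cont_rep L f =
     (SOME h. continuous_on {0..L} h \<and> (AE x in lebesgue_on {0..L}. h x = f x))"

section \<open>Function spaces on a metric graph\<close>

definition L2 :: "('v, 'e) metric_graph \<Rightarrow> ('e \<Rightarrow> real \<Rightarrow> complex) set" where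
  "L2 \<Gamma> = {f. \<forall>e \<in> edges \<Gamma>. f e \<in> L2_interval (edge_length \<Gamma> e)}"

definition L2_eq ::
  "('v, 'e) metric_graph \<Rightarrow> ('e \<Rightarrow> real \<Rightarrow> complex) \<Rightarrow> ('e \<Rightarrow> real \<Rightarrow> complex) \<Rightarrow> bool" where
  "L2_eq \<Gamma> f g \<longleftrightarrow>
     (\<forall>e \<in> edges \<Gamma>. AE x in lebesgue_on {0..edge_length \<Gamma> e}. f e x = g e x)"

definition L2_norm :: "('v, 'e) metric_graph \<Rightarrow> ('e \<Rightarrow> real \<Rightarrow> complex) \<Rightarrow> real" where
  "L2_norm \<Gamma> f =
     sqrt (\<Sum>e \<in> edges \<Gamma>. LINT x|lebesgue_on {0..edge_length \<Gamma> e}. (cmod (f e x))\<^sup>2)"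

definition H2 :: "('v, 'e) metric_graph \<Rightarrow> ('e \<Rightarrow> real \<Rightarrow> complex) set" where
  "H2 \<Gamma> = {f. \<forall>e \<in> edges \<Gamma>. f e \<in> H2_interval (edge_length \<Gamma> e)}"

definition edge_deriv ::
  "('v, 'e) metric_graph \<Rightarrow> ('e \<Rightarrow> real \<Rightarrow> complex) \<Rightarrow> 'e \<Rightarrow> real \<Rightarrow> complex" where
  "edge_deriv \<Gamma> f = (\<lambda>e. weak_deriv (edge_length \<Gamma> e) (f e))"

definition H2_norm :: "('v, 'e) metric_graph \<Rightarrow> ('e \<Rightarrow> real \<Rightarrow> complex) \<Rightarrow> real" where
  "H2_norm \<Gamma> f =
     sqrt ((L2_norm \<Gamma> f)\<^sup>2 + (L2_norm \<Gamma> (edge_deriv \<Gamma> f))\<^sup>2 +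
           (L2_norm \<Gamma> (edge_deriv \<Gamma> (edge_deriv \<Gamma> f)))\<^sup>2)"

section \<open>Vertex conditions\<close>

definition end_value ::
  "('v, 'e) metric_graph \<Rightarrow> ('e \<Rightarrow> real \<Rightarrow> complex) \<Rightarrow> 'e \<times> bool \<Rightarrow> complex" where
  "end_value \<Gamma> f = (\<lambda>(e, b).
     cont_rep (edge_length \<Gamma> e) (f e) (if b then edge_length \<Gamma> e else 0))"

definition vertex_values ::
  "('v, 'e) metric_graph \<Rightarrow> ('e \<Rightarrow> real \<Rightarrow> complex) \<Rightarrow> 'v \<Rightarrow> complex Matrix.vec" where
  "vertex_values \<Gamma> f v = Matrix.vec (deg \<Gamma> v) (\<lambda>k. end_value \<Gamma> f (ends_at \<Gamma> v ! k))"

text \<open>At the head end of an edge the derivative into the edge is minus the \<open>x\<close>-derivative.\<close>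

definition vertex_derivs ::
  "('v, 'e) metric_graph \<Rightarrow> ('e \<Rightarrow> real \<Rightarrow> complex) \<Rightarrow> 'v \<Rightarrow> complex Matrix.vec" where
  "vertex_derivs \<Gamma> f v = Matrix.vec (deg \<Gamma> v) (\<lambda>k.
     (if snd (ends_at \<Gamma> v ! k) then - 1 else 1) *
       end_value \<Gamma> (edge_deriv \<Gamma> f) (ends_at \<Gamma> v ! k))"

text \<open>
  A point of the parameter space \<open>\<complex>\<^bsup>2q\<^esup>\<close> is a family, indexed by the vertices, of matrices
  \<open>\<A> v = (A\<^sub>v B\<^sub>v)\<close> of size \<open>d\<^sub>v \<times> 2 d\<^sub>v\<close>.
\<close>

definition param_space :: "('v, 'e) metric_graph \<Rightarrow> ('v \<Rightarrow> complex Matrix.mat) set" where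
  "param_space \<Gamma> = (\<Pi>\<^sub>E v \<in> vertices \<Gamma>. carrier_mat (deg \<Gamma> v) (2 * deg \<Gamma> v))"

definition param_add ::
  "('v, 'e) metric_graph \<Rightarrow> ('v \<Rightarrow> complex Matrix.mat) \<Rightarrow> ('v \<Rightarrow> complex Matrix.mat) \<Rightarrow>
     'v \<Rightarrow> complex Matrix.mat" where
  "param_add \<Gamma> \<A> H = (\<lambda>v \<in> vertices \<Gamma>. \<A> v + H v)"

definition left_block :: "nat \<Rightarrow> complex Matrix.mat \<Rightarrow> complex Matrix.mat" where
  "left_block d M = Matrix.mat d d (\<lambda>(i, j). M $$ (i, j))"

definition right_block :: "nat \<Rightarrow> complex Matrix.mat \<Rightarrow> complex Matrix.mat" where
  "right_block d M = Matrix.mat d d (\<lambda>(i, j). M $$ (i, d + j))"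

definition U :: "('v, 'e) metric_graph \<Rightarrow> ('v \<Rightarrow> complex Matrix.mat) set" where
  "U \<Gamma> = {\<A> \<in> param_space \<Gamma>. \<forall>v \<in> vertices \<Gamma>. vec_space.rank (deg \<Gamma> v) (\<A> v) = deg \<Gamma> v}"

section \<open>The operator and its resolvent\<close>

definition op_domain ::
  "('v, 'e) metric_graph \<Rightarrow> ('v \<Rightarrow> complex Matrix.mat) \<Rightarrow> ('e \<Rightarrow> real \<Rightarrow> complex) set" where
  "op_domain \<Gamma> \<A> = {f \<in> H2 \<Gamma>. \<forall>v \<in> vertices \<Gamma>.
     left_block (deg \<Gamma> v) (\<A> v) *\<^sub>v vertex_values \<Gamma> f v +
     right_block (deg \<Gamma> v) (\<A> v) *\<^sub>v vertex_derivs \<Gamma> f v = 0\<^sub>v (deg \<Gamma> v)}"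

text \<open>The operator \<open>\<H>\<^sub>\<A> - z\<close> is the restriction of this map to \<open>op_domain \<Gamma> \<A>\<close>.\<close>

definition shifted_op ::
  "('v, 'e) metric_graph \<Rightarrow> complex \<Rightarrow> ('e \<Rightarrow> real \<Rightarrow> complex) \<Rightarrow> 'e \<Rightarrow> real \<Rightarrow> complex" where
  "shifted_op \<Gamma> z f = (\<lambda>e x. - edge_deriv \<Gamma> (edge_deriv \<Gamma> f) e x - z * f e x)"

definition continuously_invertible ::
  "('v, 'e) metric_graph \<Rightarrow> complex \<Rightarrow> ('v \<Rightarrow> complex Matrix.mat) \<Rightarrow> bool" where
  "continuously_invertible \<Gamma> z \<A> \<longleftrightarrow>
     (\<exists>S. (\<forall>g \<in> L2 \<Gamma>. S g \<in> op_domain \<Gamma> \<A> \<and> L2_eq \<Gamma> (shifted_op \<Gamma> z (S g)) g) \<and>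
          (\<forall>f \<in> op_domain \<Gamma> \<A>. L2_eq \<Gamma> (S (shifted_op \<Gamma> z f)) f) \<and>
          (\<forall>g \<in> L2 \<Gamma>. \<forall>\<epsilon>>0. \<exists>\<delta>>0. \<forall>g' \<in> L2 \<Gamma>.
             L2_norm \<Gamma> (\<lambda>e x. g' e x - g e x) < \<delta> \<longrightarrow>
             H2_norm \<Gamma> (\<lambda>e x. S g' e x - S g e x) < \<epsilon>))"

definition singular_set :: "('v, 'e) metric_graph \<Rightarrow> ('v \<Rightarrow> complex Matrix.mat) set" where
  "singular_set \<Gamma> = {\<A> \<in> U \<Gamma>. \<not> continuously_invertible \<Gamma> \<i> \<A>}"

definition resolvent ::
  "('v, 'e) metric_graph \<Rightarrow> complex \<Rightarrow> ('v \<Rightarrow> complex Matrix.mat) \<Rightarrow>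
     ('e \<Rightarrow> real \<Rightarrow> complex) \<Rightarrow> 'e \<Rightarrow> real \<Rightarrow> complex" where
  "resolvent \<Gamma> z \<A> g = (SOME f. f \<in> op_domain \<Gamma> \<A> \<and> L2_eq \<Gamma> (shifted_op \<Gamma> z f) g)"

section \<open>Bounded and compact operators, analytic operator families\<close>

definition bounded_operator ::
  "('v, 'e) metric_graph \<Rightarrow> (('e \<Rightarrow> real \<Rightarrow> complex) \<Rightarrow> 'e \<Rightarrow> real \<Rightarrow> complex) \<Rightarrow> bool" where
  "bounded_operator \<Gamma> T \<longleftrightarrow>
     (\<forall>g \<in> L2 \<Gamma>. T g \<in> L2 \<Gamma>) \<and>
     (\<forall>a b. \<forall>f \<in> L2 \<Gamma>. \<forall>g \<in> L2 \<Gamma>.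
        L2_eq \<Gamma> (T (\<lambda>e x. a * f e x + b * g e x)) (\<lambda>e x. a * T f e x + b * T g e x)) \<and>
     (\<exists>K. \<forall>g \<in> L2 \<Gamma>. L2_norm \<Gamma> (T g) \<le> K * L2_norm \<Gamma> g)"

definition compact_operator ::
  "('v, 'e) metric_graph \<Rightarrow> (('e \<Rightarrow> real \<Rightarrow> complex) \<Rightarrow> 'e \<Rightarrow> real \<Rightarrow> complex) \<Rightarrow> bool" where
  "compact_operator \<Gamma> T \<longleftrightarrow>
     bounded_operator \<Gamma> T \<and>
     (\<forall>g :: nat \<Rightarrow> 'e \<Rightarrow> real \<Rightarrow> complex.
        (\<forall>n. g n \<in> L2 \<Gamma>) \<and> (\<exists>K. \<forall>n. L2_norm \<Gamma> (g n) \<le> K) \<longrightarrow>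
        (\<exists>h \<in> L2 \<Gamma>. \<exists>s. strict_mono s \<and>
           (\<lambda>n. L2_norm \<Gamma> (\<lambda>e x. T (g (s n)) e x - h e x)) \<longlonglongrightarrow> 0))"

definition operator_norm ::
  "('v, 'e) metric_graph \<Rightarrow> (('e \<Rightarrow> real \<Rightarrow> complex) \<Rightarrow> 'e \<Rightarrow> real \<Rightarrow> complex) \<Rightarrow> real" where
  "operator_norm \<Gamma> T = (SUP g \<in> {g \<in> L2 \<Gamma>. L2_norm \<Gamma> g \<le> 1}. L2_norm \<Gamma> (T g))"

definition coords :: "('v, 'e) metric_graph \<Rightarrow> ('v \<times> nat \<times> nat) set" where
  "coords \<Gamma> = {(v, i, j). v \<in> vertices \<Gamma> \<and> i < deg \<Gamma> v \<and> j < 2 * deg \<Gamma> v}"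

definition multi_indices :: "('v, 'e) metric_graph \<Rightarrow> ('v \<times> nat \<times> nat \<Rightarrow> nat) set" where
  "multi_indices \<Gamma> = (coords \<Gamma> \<rightarrow>\<^sub>E UNIV)"

definition monomial ::
  "('v, 'e) metric_graph \<Rightarrow> ('v \<Rightarrow> complex Matrix.mat) \<Rightarrow> ('v \<times> nat \<times> nat \<Rightarrow> nat) \<Rightarrow> complex" where
  "monomial \<Gamma> H \<alpha> = (\<Prod>(v, i, j) \<in> coords \<Gamma>. (H v $$ (i, j)) ^ \<alpha> (v, i, j))"

text \<open>
  A family of bounded operators in \<open>L\<^sup>2(\<Gamma>)\<close> is analytic on \<open>W\<close> if near each point \<open>\<A>\<close> of \<open>W\<close>, on a
  polydisc \<open>\<A> + H\<close> contained in \<open>W\<close> (so that \<open>W\<close> is in particular open), it is the sum of a power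
  series in the coordinates of \<open>H\<close> with bounded operators as coefficients.  The series converges in
  the operator norm as an unordered sum over all multi-indices.
\<close>

definition analytic_operator_family ::
  "('v, 'e) metric_graph \<Rightarrow> ('v \<Rightarrow> complex Matrix.mat) set \<Rightarrow>
     (('v \<Rightarrow> complex Matrix.mat) \<Rightarrow> ('e \<Rightarrow> real \<Rightarrow> complex) \<Rightarrow> 'e \<Rightarrow> real \<Rightarrow> complex) \<Rightarrow> bool" where
  "analytic_operator_family \<Gamma> W R \<longleftrightarrow>
     W \<subseteq> param_space \<Gamma> \<and>
     (\<forall>\<A> \<in> W. bounded_operator \<Gamma> (R \<A>)) \<and>
     (\<forall>\<A> \<in> W. \<exists>r>0. \<exists>C. (\<forall>\<alpha> \<in> multi_indices \<Gamma>. bounded_operator \<Gamma> (C \<alpha>)) \<and>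
        (\<forall>H \<in> param_space \<Gamma>. (\<forall>(v, i, j) \<in> coords \<Gamma>. cmod (H v $$ (i, j)) < r) \<longrightarrow>
           param_add \<Gamma> \<A> H \<in> W \<and>
           ((\<lambda>F. operator_norm \<Gamma> (\<lambda>g e x.
                R (param_add \<Gamma> \<A> H) g e x - (\<Sum>\<alpha>\<in>F. monomial \<Gamma> H \<alpha> * C \<alpha> g e x)))
              \<longlongrightarrow> 0) (finite_subsets_at_top (multi_indices \<Gamma>))))"

end

theory Submission
  imports Defs "HOL-Complex_Analysis.Great_Picard"
begin

text \<open>
  Let \<open>\<kappa>\<^sup>2 = -\<i>\<close>.  The solutions of \<open>-f'' - \<i> f = 0\<close> are spanned by the exponentials
  \<open>exp (\<plusminus>\<kappa> x)\<close> on the single edges, and there are as many of these as there are scalar vertex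
  conditions.  So \<open>\<H>\<^sub>\<A> - \<i>\<close> is injective iff the square matrix \<open>M(\<A>)\<close>, which contains the vertex
  conditions of the exponentials, is nonsingular; in that case every \<open>(A\<^sub>v B\<^sub>v)\<close> automatically has
  maximal rank.  If \<open>\<A>\<close> is regular, the solution for \<open>\<A> + H\<close> is \<open>R(\<A>) g\<close> plus a combination of
  exponentials, whose coefficients solve a linear system with matrix \<open>M(\<A> + H)\<close>.  By Cramer's rule,
  \<open>R(\<A> + H) = \<Sum>\<^sub>m q\<^sub>m(H) T\<^sub>m\<close> with finitely many fixed bounded operators \<open>T\<^sub>m\<close> and scalar functions
  \<open>q\<^sub>m\<close>, which are polynomials in \<open>H\<close> divided by \<open>det M(\<A> + H)\<close> and hence power series near \<open>H = 0\<close>.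
  Compactness holds because functions that are bounded in \<open>H\<^sup>2\<close> are bounded and Lipschitz, uniformly, on
  every edge, so that the Arzela-Ascoli theorem applies.
\<close>

section \<open>Sobolev functions on an interval\<close>

text \<open>The domain \<open>op_domain\<close> moves with \<A>, so the operators for \<A> and \<A>
  + H do not act on one space, and no Neumann series in H can be written down directly. What helps
  is that the differential expression itself does not change: resolvents at two regular parameters
  differ by a homogeneous solution only, an element of a space of finite dimension. Solvability for
  a given right-hand side is never built from scratch. It is part of regularity at one parameter and
  is transported to others by such corrections. The definitions shape the rest. Derivatives and
  resolvents are choices, determined only up to null sets, and test functions are merely C^1, so the
  fundamental theorem of calculus for weak derivatives has to come before any trace. Continuous
  invertibility provides a bare map, continuous at each point, without linearity or a norm bound;
  both have to be extracted from it. Finally, the matrix is square because every edge has two ends,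
  each at exactly one vertex, so the degrees add up to twice the number of edges.\<close>

abbreviation leb :: "real \<Rightarrow> real measure" where
  "leb L \<equiv> lebesgue_on {0..L}"

lemma finite_measure_interval: "finite_measure (leb L)"
  by (rule finite_measure_lebesgue_on) simp

text \<open>Integrability of f comes from |f| <= 1 + |f|^2, as constants are integrable on a bounded
  interval.\<close>

lemma L2_intervalD:
  assumes "f \<in> L2_interval L"
  shows "f \<in> borel_measurable (leb L)"
    and "integrable (leb L) (\<lambda>x. (cmod (f x))\<^sup>2)"
    and "integrable (leb L) f"
proof -
  interpret finite_measure "leb L" by (rule finite_measure_interval)
  show m: "f \<in> borel_measurable (leb L)"
    and i: "integrable (leb L) (\<lambda>x. (cmod (f x))\<^sup>2)"
    using assms by (auto simp: L2_interval_def)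
  have "integrable (leb L) (\<lambda>x. 1 + (cmod (f x))\<^sup>2)"
    using i by simp
  then show "integrable (leb L) f"
  proof (rule Bochner_Integration.integrable_bound[OF _ m], intro AE_I2)
    fix x
    have "2 * cmod (f x) \<le> 1 + (cmod (f x))\<^sup>2"
      using zero_le_power2[of "cmod (f x) - 1"] by (simp add: power2_diff)
    then have "cmod (f x) \<le> 1 + (cmod (f x))\<^sup>2"
      using norm_ge_zero[of "f x"] by linarith
    then show "norm (f x) \<le> norm (1 + (cmod (f x))\<^sup>2)" by simp
  qed
qed

lemma norm_add_squared_le:
  fixes a b :: "'a::real_normed_vector"
  shows "(norm (a + b))\<^sup>2 \<le> 2 * (norm a)\<^sup>2 + 2 * (norm b)\<^sup>2"
proof -
  have "(norm (a + b))\<^sup>2 \<le> (norm a + norm b)\<^sup>2"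
    by (intro power_mono norm_triangle_ineq norm_ge_zero)
  also have "\<dots> \<le> 2 * (norm a)\<^sup>2 + 2 * (norm b)\<^sup>2"
    using zero_le_power2[of "norm a - norm b"] by (simp add: power2_diff power2_sum)
  finally show ?thesis .
qed

lemma L2_interval_linear:
  assumes "f \<in> L2_interval L" "g \<in> L2_interval L"
  shows "(\<lambda>x. a * f x + b * g x) \<in> L2_interval L"
proof -
  note f = L2_intervalD[OF assms(1)] and g = L2_intervalD[OF assms(2)]
  have m: "(\<lambda>x. a * f x + b * g x) \<in> borel_measurable (leb L)"
    using f(1) g(1) by measurable
  have "integrable (leb L) (\<lambda>x. 2 * (cmod a)\<^sup>2 * (cmod (f x))\<^sup>2 + 2 * (cmod b)\<^sup>2 * (cmod (g x))\<^sup>2)"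
    using f(2) g(2) by simp
  then have "integrable (leb L) (\<lambda>x. (cmod (a * f x + b * g x))\<^sup>2)"
  proof (rule Bochner_Integration.integrable_bound)
    show "(\<lambda>x. (cmod (a * f x + b * g x))\<^sup>2) \<in> borel_measurable (leb L)"
      using m by measurable
    show "AE x in leb L. norm ((cmod (a * f x + b * g x))\<^sup>2)
        \<le> norm (2 * (cmod a)\<^sup>2 * (cmod (f x))\<^sup>2 + 2 * (cmod b)\<^sup>2 * (cmod (g x))\<^sup>2)"
    proof (intro AE_I2)
      fix x
      show "norm ((cmod (a * f x + b * g x))\<^sup>2)
        \<le> norm (2 * (cmod a)\<^sup>2 * (cmod (f x))\<^sup>2 + 2 * (cmod b)\<^sup>2 * (cmod (g x))\<^sup>2)"
        using norm_add_squared_le[of "a * f x" "b * g x"]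
        by (simp add: norm_mult power_mult_distrib mult.assoc)
    qed
  qed
  with m show ?thesis by (simp add: L2_interval_def)
qed

lemma L2_interval_continuous:
  assumes "continuous_on {0..L} f"
  shows "f \<in> L2_interval L"
proof -
  have "f \<in> borel_measurable (leb L)"
    using assms by (intro continuous_imp_measurable_on_sets_lebesgue) auto
  moreover have "integrable (lebesgue_on (cbox 0 L)) (\<lambda>x. (cmod (f x))\<^sup>2)"
    using assms by (intro continuous_imp_integrable continuous_intros) (simp add: cbox_interval)
  ultimately show ?thesis by (simp add: L2_interval_def cbox_interval)
qed

lemma integrable_interval_integrable_on:
  fixes w :: "real \<Rightarrow> complex"
  assumes "integrable (leb L) w"
  shows "w integrable_on {0..L}"
  using assms by (intro integrable_on_lebesgue_on) auto

lemma integrable_mult_bounded_continuous: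
  fixes w :: "real \<Rightarrow> complex" and \<phi> :: "real \<Rightarrow> real"
  assumes w: "integrable (leb L) w" and \<phi>: "continuous_on UNIV \<phi>"
  shows "integrable (leb L) (\<lambda>x. w x * of_real (\<phi> x))"
proof -
  have "compact (\<phi> ` {0..L})"
    using \<phi> by (intro compact_continuous_image continuous_on_subset[OF \<phi>]) auto
  then obtain B where B: "\<And>x. x \<in> {0..L} \<Longrightarrow> \<bar>\<phi> x\<bar> \<le> B"
    using compact_imp_bounded bounded_iff by (metis image_eqI real_norm_def)
  have "\<phi> \<in> borel_measurable (leb L)"
    using \<phi> by (intro continuous_imp_measurable_on_sets_lebesgue) (auto intro: continuous_on_subset)
  then have m: "(\<lambda>x. w x * of_real (\<phi> x)) \<in> borel_measurable (leb L)"
    using borel_measurable_integrable[OF w] by measurable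
  have "integrable (leb L) (\<lambda>x. of_real B * w x)"
    using w by simp
  then show ?thesis
  proof (rule Bochner_Integration.integrable_bound[OF _ m])
    show "AE x in leb L. norm (w x * of_real (\<phi> x)) \<le> norm (of_real B * w x)"
    proof (intro AE_I2)
      fix x assume "x \<in> space (leb L)"
      then have "\<bar>\<phi> x\<bar> \<le> \<bar>B\<bar>" using B[of x] by (auto simp: space_restrict_space)
      then show "norm (w x * of_real (\<phi> x)) \<le> norm (of_real B * w x)"
        using mult_right_mono[of "\<bar>\<phi> x\<bar>" "\<bar>B\<bar>" "norm (w x)"] by (simp add: norm_mult mult.commute)
    qed
  qed
qed

text \<open>Lebesgue's differentiation theorem with averages to the right. The library theorem
  concerns functions integrable on every box, so f is extended by zero; at a point of the open
  interval the extension is invisible for small s.\<close>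

lemma lebesgue_point:
  fixes f :: "real \<Rightarrow> complex"
  assumes "f integrable_on {0..L}"
  obtains N where "negligible N"
    and "\<And>x. x \<in> {0<..<L} - N \<Longrightarrow> ((\<lambda>s. integral {x..x+s} f / of_real s) \<longlongrightarrow> f x) (at_right 0)"
proof -
  define F where "F x = (if x \<in> {0..L} then f x else 0)" for x
  have "F integrable_on UNIV"
    unfolding F_def using assms integrable_restrict_UNIV by blast
  then have "F integrable_on cbox a b" for a b
    using integrable_on_subcbox by blast
  from integrable_ccontinuous_explicit[of F, OF this] obtain N where N: "negligible N"
    "\<And>x e. \<lbrakk>x \<notin> N; 0 < e\<rbrakk> \<Longrightarrow> \<exists>d>0. \<forall>h. 0 < h \<and> h < d \<longrightarrow>
        norm (integral (cbox x (x + h *\<^sub>R One)) F /\<^sub>R h ^ DIM(real) - F x) < e"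
    by blast
  show thesis
  proof (rule that[OF N(1)])
    fix x assume x: "x \<in> {0<..<L} - N"
    show "((\<lambda>s. integral {x..x+s} f / of_real s) \<longlongrightarrow> f x) (at_right 0)"
    proof (rule tendstoI)
      fix e :: real assume "e > 0"
      with N(2)[of x e] x obtain d where d: "d > 0" "\<And>h. 0 < h \<Longrightarrow> h < d \<Longrightarrow>
          norm (integral {x..x + h} F /\<^sub>R h - F x) < e"
        by auto
      have "dist (integral {x..x+s} f / of_real s) (f x) < e" if s: "0 < s" "s < min d (L - x)" for s
      proof -
        have "integral {x..x+s} F = integral {x..x+s} f"
          using s x by (intro integral_cong) (auto simp: F_def)
        with d(2)[of s] s x show ?thesis
          by (simp add: F_def dist_norm divide_inverse scaleR_conv_of_real mult.commute)
      qed
      moreover have "min d (L - x) > 0" using d x by auto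
      ultimately show "\<forall>\<^sub>F s in at_right 0. dist (integral {x..x+s} f / of_real s) (f x) < e"
        by (intro eventually_at_rightI[of 0 "min d (L - x)"]) auto
    qed
  qed
qed

lemma AE_interval_negligible:
  fixes L :: real
  assumes "negligible N" and "\<And>x. x \<in> {0<..<L} - N \<Longrightarrow> P x"
  shows "AE x in leb L. P x"
proof -
  \<comment> \<open>The endpoints join the null set, so that P has to be known in the open interval
    only.\<close>
  have "negligible (N \<union> {0, L})"
    using assms(1) by simp
  then have "N \<union> {0, L} \<in> null_sets lebesgue"
    using negligible_iff_null_sets by blast
  then have "AE x in lebesgue. x \<notin> N \<union> {0, L}"
    by (rule AE_not_in)
  then have "AE x in lebesgue. x \<in> {0..L} \<longrightarrow> P x"
  proof eventually_elim
    case (elim x)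
    then have "x \<in> {0..L} \<Longrightarrow> x \<in> {0<..<L} - N"
      by auto
    then show ?case using assms(2) by blast
  qed
  then show ?thesis
    by (subst AE_restrict_space_iff) auto
qed

text \<open>Two continuous functions that differ at x differ on a relative neighbourhood of x. This
  contains a nonempty open interval, which cannot lie in a null set.\<close>

lemma AE_interval_continuous_eq:
  fixes f g :: "real \<Rightarrow> complex"
  assumes f: "continuous_on {0..L} f" and g: "continuous_on {0..L} g" and L: "L > 0"
    and ae: "AE x in leb L. f x = g x" and x: "x \<in> {0..L}"
  shows "f x = g x"
proof (rule ccontr)
  assume ne: "f x \<noteq> g x"
  have "AE y in lebesgue. y \<in> {0..L} \<longrightarrow> f y = g y"
    using ae by (subst (asm) AE_restrict_space_iff) auto
  then obtain N where "\<And>y. y \<in> space lebesgue - N \<Longrightarrow> y \<in> {0..L} \<longrightarrow> f y = g y" and N: "N \<in> null_sets lebesgue"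
    by (rule AE_E3) (rule that)
  then have eq: "y \<in> N" if "y \<in> {0..L}" "f y \<noteq> g y" for y
    using that by fastforce
  have "continuous_on {0..L} (\<lambda>y. f y - g y)"
    using f g by (intro continuous_intros)
  then obtain d where d: "d > 0" "\<And>y. y \<in> {0..L} \<Longrightarrow> dist y x < d \<Longrightarrow> dist (f y - g y) (f x - g x) < norm (f x - g x)"
    using x ne unfolding continuous_on_iff by (metis zero_less_norm_iff right_minus_eq)
  \<comment> \<open>Cutting off at 0 and L keeps the interval open and nonempty even if x is an
    endpoint, since L > 0.\<close>
  let ?J = "{max 0 (x - d)<..<min L (x + d)}"
  have "?J \<subseteq> N"
  proof
    fix y assume "y \<in> ?J"
    then have y: "y \<in> {0..L}" "dist y x < d" by (auto simp: dist_real_def abs_less_iff)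
    then have "f y \<noteq> g y" using d(2)[OF y] by (auto simp: dist_norm norm_minus_commute)
    with y(1) show "y \<in> N" by (rule eq)
  qed
  then have "negligible ?J"
    using N negligible_iff_null_sets negligible_subset by blast
  moreover have "?J \<noteq> {}" using d(1) x L by (auto simp: not_less)
  ultimately show False using open_not_negligible[of ?J] by simp
qed

section \<open>Recovering functions from integrals, smoothed ramps, and primitives of weak
  derivatives\<close>

lemma integral_zero_imp_AE_zero:
  fixes w :: "real \<Rightarrow> complex"
  assumes w: "w integrable_on {0..L}" and z: "\<And>x. x \<in> {0..L} \<Longrightarrow> integral {0..x} w = 0"
  shows "AE x in leb L. w x = 0"
proof -
  obtain N where N: "negligible N"
    and lim: "\<And>x. x \<in> {0<..<L} - N \<Longrightarrow> ((\<lambda>s. integral {x..x+s} w / of_real s) \<longlongrightarrow> w x) (at_right 0)"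
    using lebesgue_point[OF w] by metis
  show ?thesis
  proof (rule AE_interval_negligible[OF N])
    fix x assume x: "x \<in> {0<..<L} - N"
    \<comment> \<open>The averages whose limit is w x are differences of two vanishing
      integrals.\<close>
    have "integral {x..x+s} w / of_real s = 0" if "0 < s" "s < L - x" for s
    proof -
      have "integral {0..x} w + integral {x..x+s} w = integral {0..x+s} w"
        using x that by (intro Henstock_Kurzweil_Integration.integral_combine integrable_subinterval_real[OF w]) auto
      then show ?thesis using z[of x] z[of "x + s"] x that by simp
    qed
    then have "\<forall>\<^sub>F s in at_right 0. integral {x..x+s} w / of_real s = 0"
      using x by (intro eventually_at_rightI[of 0 "L - x"]) auto
    then have "((\<lambda>s. integral {x..x+s} w / of_real s) \<longlongrightarrow> 0) (at_right 0)"
      by (rule tendsto_eventually)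
    with lim[OF x] show "w x = 0"
      by (rule tendsto_unique[rotated]) simp
  qed
qed

text \<open>A C^1 version of the positive part of y: zero for y <= 0, y^2 / (2 e) on [0, e], and y -
  e / 2 beyond. Piecewise linear trapezoids are not admissible test functions, and these ramps are
  the blocks from which smooth substitutes are assembled.\<close>

definition ramp :: "real \<Rightarrow> real \<Rightarrow> real" where
  "ramp e y = ((max 0 y)\<^sup>2 - (max 0 (y - e))\<^sup>2) / (2 * e)"

text \<open>Besides being the derivative of \<open>ramp e\<close>, it is 1 / e times the difference
  of two positive parts shifted by e. Both readings are used, the second one at a fixed
  width.\<close>

definition ramp' :: "real \<Rightarrow> real \<Rightarrow> real" where
  "ramp' e y = (max 0 y - max 0 (y - e)) / e"

lemma has_real_derivative_max_squared:
  "((\<lambda>y::real. (max 0 y)\<^sup>2) has_real_derivative 2 * max 0 y) (at y)"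
proof -
  consider "y < 0" | "y = 0" | "y > 0" by linarith
  then show ?thesis
  proof cases
    case 1
    have "((\<lambda>y::real. 0) has_real_derivative 2 * max 0 y) (at y)" using 1 by simp
    then show ?thesis
      by (rule DERIV_cong_ev[THEN iffD1, rotated -1])
         (use 1 in \<open>auto intro: eventually_mono[OF eventually_nhds_in_open[of "{..<0}"]]\<close>)
  next
    case 2
    \<comment> \<open>At the kink the difference quotient is dominated by |h|.\<close>
    have "((\<lambda>h::real. (max 0 h)\<^sup>2 / h) \<longlongrightarrow> 0) (at 0)"
    proof (rule tendsto_0_le[where K = 1])
      show "((\<lambda>h::real. h) \<longlongrightarrow> 0) (at 0)" by simp
      have "\<bar>(max 0 h)\<^sup>2 / h\<bar> \<le> \<bar>h\<bar>" for h :: real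
        by (cases "h > 0") (auto simp: max_def power2_eq_square)
      then show "\<forall>\<^sub>F h in at 0. norm ((max 0 h)\<^sup>2 / h) \<le> norm (h::real) * 1"
        by (intro always_eventually allI) (simp only: real_norm_def mult_1_right)
    qed
    then show ?thesis using 2 by (simp add: DERIV_def)
  next
    case 3
    have "((\<lambda>y::real. y\<^sup>2) has_real_derivative 2 * max 0 y) (at y)"
      using 3 by (auto intro!: derivative_eq_intros)
    then show ?thesis
      by (rule DERIV_cong_ev[THEN iffD1, rotated -1])
         (use 3 in \<open>auto intro: eventually_mono[OF eventually_nhds_in_open[of "{0<..}"]]\<close>)
  qed
qed

lemma ramp_has_derivative:
  assumes "e > 0"
  shows "((\<lambda>x. ramp e (x - y)) has_real_derivative ramp' e (x - y)) (at x)"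
proof -
  have 1: "((\<lambda>x. (max 0 (x - z))\<^sup>2) has_real_derivative 2 * max 0 (x - z)) (at x)" for z x :: real
    using DERIV_chain'[of "\<lambda>x. x - z" 1 x UNIV, OF _ has_real_derivative_max_squared]
    by (simp add: DERIV_diff[where E = 0, simplified])
  have "((\<lambda>x. ((max 0 (x - y))\<^sup>2 - (max 0 (x - (y + e)))\<^sup>2) / (2 * e)) has_real_derivative
      (2 * max 0 (x - y) - 2 * max 0 (x - (y + e))) / (2 * e)) (at x)"
    by (intro DERIV_cdivide DERIV_diff 1)
  moreover have "(2 * A - 2 * B) / (2 * e) = (A - B) / e" for A B :: real
    using assms by (simp add: field_simps)
  ultimately show ?thesis
    by (simp only: ramp_def ramp'_def diff_diff_eq)
qed

lemma ramp_continuous: "e > 0 \<Longrightarrow> continuous_on UNIV (\<lambda>x. ramp e (x - y))"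
  unfolding ramp_def by (intro continuous_intros) auto

lemma ramp'_continuous: "e > 0 \<Longrightarrow> continuous_on UNIV (\<lambda>x. ramp' e (x - y))"
  unfolding ramp'_def by (intro continuous_intros) auto

lemma ramp'_bounds: "e > 0 \<Longrightarrow> \<bar>ramp' e y\<bar> \<le> 1"
  by (auto simp: ramp'_def max_def field_simps)

lemma ramp_bounds:
  assumes "e > 0"
  shows "\<bar>ramp e y - max 0 y\<bar> \<le> e"
proof -
  consider "y \<le> 0" | "0 < y" "y \<le> e" | "e < y" by linarith
  then show ?thesis
  proof cases
    case 1
    then show ?thesis using assms by (simp add: ramp_def)
  next
    case 2
    then have r: "ramp e y = y * (y / (2 * e))" by (simp add: ramp_def power2_eq_square)
    have "0 \<le> y / (2 * e)" "y / (2 * e) \<le> 1" using 2 by auto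
    then have "0 \<le> y * (y / (2 * e))" "y * (y / (2 * e)) \<le> y * 1"
      using 2 by (intro mult_nonneg_nonneg mult_left_mono; simp)+
    then show ?thesis unfolding r using 2 by linarith
  next
    case 3
    then have "ramp e y = y - e / 2"
      using assms by (simp add: ramp_def power2_eq_square field_simps)
    then show ?thesis using 3 assms by simp
  qed
qed

lemma ramp_far: "e > 0 \<Longrightarrow> y \<ge> e \<Longrightarrow> ramp e y = y - e / 2"
  by (simp add: ramp_def power2_eq_square field_simps)

lemma ramp_neg: "e > 0 \<Longrightarrow> y \<le> 0 \<Longrightarrow> ramp e y = 0"
  by (simp add: ramp_def)

lemma integral_mult_tendsto:
  fixes w :: "real \<Rightarrow> complex" and \<phi> :: "nat \<Rightarrow> real \<Rightarrow> real"
  assumes w: "integrable (leb L) w" and \<phi>: "\<And>n. continuous_on UNIV (\<phi> n)"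
    and B: "\<And>n x. x \<in> {0..L} \<Longrightarrow> \<bar>\<phi> n x\<bar> \<le> B" and lim: "\<And>x. (\<lambda>n. \<phi> n x) \<longlonglongrightarrow> \<psi> x"
  shows "integrable (leb L) (\<lambda>x. w x * of_real (\<psi> x))"
    "(\<lambda>n. LINT x|leb L. w x * of_real (\<phi> n x)) \<longlonglongrightarrow> (LINT x|leb L. w x * of_real (\<psi> x))"
proof -
  have m: "(\<lambda>x. w x * of_real (\<phi> n x)) \<in> borel_measurable (leb L)" for n
    by (intro borel_measurable_integrable integrable_mult_bounded_continuous w \<phi>)
  have l: "(\<lambda>n. w x * of_real (\<phi> n x)) \<longlonglongrightarrow> w x * of_real (\<psi> x)" for x
    by (intro tendsto_mult tendsto_const tendsto_of_real lim)
  have m': "(\<lambda>x. w x * of_real (\<psi> x)) \<in> borel_measurable (leb L)"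
    by (rule borel_measurable_LIMSEQ_metric[OF m l])
  have i: "integrable (leb L) (\<lambda>x. norm (w x) * B)"
    using w by simp
  have b: "AE x in leb L. norm (w x * of_real (\<phi> n x)) \<le> norm (w x) * B" for n
    using B by (intro AE_I2) (simp add: norm_mult mult_left_mono space_restrict_space)
  have l': "AE x in leb L. (\<lambda>n. w x * of_real (\<phi> n x)) \<longlonglongrightarrow> w x * of_real (\<psi> x)"
    using l by simp
  show "integrable (leb L) (\<lambda>x. w x * of_real (\<psi> x))"
    by (rule integrable_dominated_convergence[OF m' m i l' b])
  show "(\<lambda>n. LINT x|leb L. w x * of_real (\<phi> n x)) \<longlonglongrightarrow> (LINT x|leb L. w x * of_real (\<psi> x))"
    by (rule integral_dominated_convergence[OF m' m i l' b])
qed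

text \<open>As the width shrinks, \<open>ramp'\<close> tends boundedly to the indicator of x > y, so
  dominated convergence applies.\<close>

lemma ramp'_integral_tendsto:
  fixes w :: "real \<Rightarrow> complex"
  assumes w: "integrable (leb L) w" and e: "\<And>n. e n > 0" "e \<longlonglongrightarrow> 0" and y: "0 \<le> y" "y \<le> L"
  shows "(\<lambda>n. LINT x|leb L. w x * of_real (ramp' (e n) (x - y))) \<longlonglongrightarrow> integral {y..L} w"
proof -
  have "(\<lambda>n. ramp' (e n) (x - y)) \<longlonglongrightarrow> (if x > y then 1 else 0)" for x
  proof (cases "x > y")
    case True
    then have "\<forall>\<^sub>F n in sequentially. e n < x - y"
      using e(2) by (intro order_tendstoD) auto
    then have "\<forall>\<^sub>F n in sequentially. ramp' (e n) (x - y) = 1"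
      by eventually_elim (use True e(1) in \<open>auto simp: ramp'_def less_imp_neq[symmetric]\<close>)
    then show ?thesis using True by (simp add: tendsto_eventually)
  next
    case False
    then have "ramp' (e n) (x - y) = 0" for n
      using e(1)[of n] by (simp add: ramp'_def)
    then show ?thesis using False by simp
  qed
  note T = integral_mult_tendsto[OF w ramp'_continuous[OF e(1)] ramp'_bounds[OF e(1)] this]
  have "(LINT x|leb L. w x * of_real (if x > y then 1 else 0)) = integral {0..L} (\<lambda>x. w x * of_real (if x > y then 1 else 0))"
    by (rule lebesgue_integral_eq_integral[OF T(1)]) simp
  \<comment> \<open>The indicators of x > y and of x >= y differ at the single point y.\<close>
  also have "\<dots> = integral {0..L} (\<lambda>x. if x \<in> {y..L} then w x else 0)"
    by (rule integral_spike[where S = "{y}"]) auto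
  also have "\<dots> = integral ({y..L} \<inter> {0..L}) w"
    by (rule Henstock_Kurzweil_Integration.integral_restrict_Int)
  also have "{y..L} \<inter> {0..L} = {y..L}"
    using y by auto
  finally show ?thesis using T(2) by simp
qed

lemma ramp_integral_tendsto:
  fixes w :: "real \<Rightarrow> complex"
  assumes w: "integrable (leb L) w" and e: "\<And>n. e n > 0" "e \<longlonglongrightarrow> 0"
  shows "(\<lambda>n. LINT x|leb L. w x * of_real (ramp (e n) (x - y)))
    \<longlonglongrightarrow> (LINT x|leb L. w x * of_real (max 0 (x - y)))"
proof -
  have "convergent e" using e(2) by (auto simp: convergent_def)
  then have "Bseq e" by (rule convergent_imp_Bseq)
  then obtain B where B: "\<And>n. norm (e n) \<le> B" by (auto simp: Bseq_def)
  \<comment> \<open>Ramps are unbounded on the line; a common majorant exists on [0, L] because the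
    convergent sequence e is bounded.\<close>
  have "\<bar>ramp (e n) (x - y)\<bar> \<le> L + \<bar>y\<bar> + B" if "x \<in> {0..L}" for n x
    using ramp_bounds[OF e(1), of n "x - y"] B[of n] e(1)[of n] that by (auto simp: abs_le_iff)
  moreover have "(\<lambda>n. ramp (e n) (x - y)) \<longlonglongrightarrow> max 0 (x - y)" for x
  proof -
    have "(\<lambda>n. ramp (e n) (x - y) - max 0 (x - y)) \<longlonglongrightarrow> 0"
      by (rule tendsto_0_le[OF e(2), where K = 1])
         (use ramp_bounds[OF e(1)] e(1) in \<open>auto simp: less_imp_le\<close>)
    then show ?thesis by (rule LIM_zero_cancel)
  qed
  ultimately show ?thesis
    by (rule integral_mult_tendsto(2)[OF w ramp_continuous[OF e(1)]])
qed

text \<open>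
  The combination \<open>ramp e (x - a) - ramp e (x - a - s) - ramp e (x - c) + ramp e (x - c - s)\<close> is an
  admissible test function, close to a trapezoid that is \<open>s\<close> on most of \<open>[a, c]\<close>.
  Letting first \<open>e\<close> and then \<open>s\<close> tend to \<open>0\<close> yields \<open>f c - f a = integral {a..c} w\<close> at Lebesgue points.
\<close>

lemma weak_derivative_second_difference:
  fixes f w :: "real \<Rightarrow> complex"
  assumes f: "integrable (leb L) f" and w: "integrable (leb L) w"
    and wd: "is_weak_derivative L f w"
    and ac: "0 < a" "a < c" "c + s < L" "0 < s"
  shows "integral {a..L} f - integral {a+s..L} f - (integral {c..L} f - integral {c+s..L} f) =
    - of_real s * ((LINT x|leb L. w x * of_real (ramp' s (x - a))) -
         (LINT x|leb L. w x * of_real (ramp' s (x - c))))"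
proof -
  let ?M = "leb L"
  \<comment> \<open>At most half the distance from c + s to L, so that the supports, contained in
    [a, c + s + e n], stay inside the open interval.\<close>
  define e where "e n = (L - (c + s)) / 2 / real (Suc n)" for n
  have e0: "e n > 0" for n using ac by (simp add: e_def)
  have eL: "c + s + e n < L" for n
  proof -
    have "e n \<le> (L - (c + s)) / 2 / 1"
      unfolding e_def using ac by (intro divide_left_mono) auto
    then show ?thesis using ac by (simp add: field_simps)
  qed
  have elim: "e \<longlonglongrightarrow> 0"
    unfolding e_def by (intro tendsto_divide_0[OF tendsto_const] filterlim_at_top_imp_at_infinity
        filterlim_compose[OF filterlim_real_sequentially filterlim_Suc])
  define A where "A g n y = (LINT x|?M. g x * of_real (ramp' (e n) (x - y)))" for g :: "real \<Rightarrow> complex" and n y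
  define B where "B g n y = (LINT x|?M. g x * of_real (ramp (e n) (x - y)))" for g :: "real \<Rightarrow> complex" and n y
  define V where "V y = (LINT x|?M. w x * of_real (max 0 (x - y)))" for y
  have iA: "integrable ?M (\<lambda>x. f x * of_real (ramp' (e n) (x - y)))" for n y
    by (intro integrable_mult_bounded_continuous f ramp'_continuous e0)
  have iB: "integrable ?M (\<lambda>x. w x * of_real (ramp (e n) (x - y)))" for n y
    by (intro integrable_mult_bounded_continuous w ramp_continuous e0)
  have iV: "integrable ?M (\<lambda>x. w x * of_real (max 0 (x - y)))" for y
    by (intro integrable_mult_bounded_continuous w continuous_intros)
  have id: "A f n a - A f n (a + s) - (A f n c - A f n (c + s)) =
      - (B w n a - B w n (a + s) - (B w n c - B w n (c + s)))" for n
  proof -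
    define \<phi> where "\<phi> x = ramp (e n) (x - a) - ramp (e n) (x - (a + s)) - (ramp (e n) (x - c) - ramp (e n) (x - (c + s)))" for x
    define \<phi>' where "\<phi>' x = ramp' (e n) (x - a) - ramp' (e n) (x - (a + s)) - (ramp' (e n) (x - c) - ramp' (e n) (x - (c + s)))" for x
    have "(\<phi> has_real_derivative \<phi>' x) (at x)" for x
      unfolding \<phi>_def \<phi>'_def by (intro DERIV_diff ramp_has_derivative e0)
    moreover have "continuous_on UNIV \<phi>'"
      unfolding \<phi>'_def by (intro continuous_on_diff ramp'_continuous e0)
    moreover have "\<phi> x = 0" if "x \<notin> {a..c + s + e n}" for x
    proof (cases "x < a")
      case True
      then show ?thesis using ac e0[of n] by (simp add: \<phi>_def ramp_neg)
    next
      case False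
      \<comment> \<open>Here all four ramps are affine with slope 1: the offsets e / 2 cancel, and
        both differences equal s.\<close>
      with that have "x > c + s + e n" by auto
      then show ?thesis using ac e0[of n] by (simp add: \<phi>_def ramp_far)
    qed
    ultimately have "(LINT x|?M. f x * of_real (\<phi>' x)) = - (LINT x|?M. w x * of_real (\<phi> x))"
      using wd ac eL[of n] unfolding is_weak_derivative_def by blast
    moreover have "(LINT x|?M. f x * of_real (\<phi>' x)) = A f n a - A f n (a + s) - (A f n c - A f n (c + s))"
      unfolding A_def \<phi>'_def using iA by (simp add: right_diff_distrib)
    moreover have "(LINT x|?M. w x * of_real (\<phi> x)) = B w n a - B w n (a + s) - (B w n c - B w n (c + s))"
      unfolding B_def \<phi>_def using iB by (simp add: right_diff_distrib)
    ultimately show ?thesis by simp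
  qed
  have "(\<lambda>n. A f n a - A f n (a + s) - (A f n c - A f n (c + s))) \<longlonglongrightarrow>
      integral {a..L} f - integral {a+s..L} f - (integral {c..L} f - integral {c+s..L} f)"
    unfolding A_def using ac by (intro tendsto_diff ramp'_integral_tendsto f e0 elim) auto
  moreover have "(\<lambda>n. - (B w n a - B w n (a + s) - (B w n c - B w n (c + s)))) \<longlonglongrightarrow>
      - (V a - V (a + s) - (V c - V (c + s)))"
    unfolding B_def V_def by (intro tendsto_minus tendsto_diff ramp_integral_tendsto w e0 elim)
  ultimately have "integral {a..L} f - integral {a+s..L} f - (integral {c..L} f - integral {c+s..L} f) =
      - (V a - V (a + s) - (V c - V (c + s)))"
    unfolding id by (rule LIMSEQ_unique)
  \<comment> \<open>A difference of positive parts shifted by s is s times \<open>ramp' s\<close>,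
    so the factor s splits off and can later be divided out.\<close>
  moreover have "V y - V (y + s) = of_real s * (LINT x|?M. w x * of_real (ramp' s (x - y)))" for y
  proof -
    have "V y - V (y + s) = (LINT x|?M. w x * of_real (max 0 (x - y)) - w x * of_real (max 0 (x - (y + s))))"
      unfolding V_def by (rule Bochner_Integration.integral_diff[symmetric]) (rule iV)+
    also have "\<dots> = (LINT x|?M. of_real s * (w x * of_real (ramp' s (x - y))))"
    proof (rule Bochner_Integration.integral_cong[OF refl])
      fix x
      have "max 0 (x - y) - max 0 (x - (y + s)) = s * ramp' s (x - y)"
        using ac by (simp add: ramp'_def diff_diff_eq)
      then have "complex_of_real (max 0 (x - y)) - of_real (max 0 (x - (y + s))) = of_real s * of_real (ramp' s (x - y))"
        by (metis of_real_diff of_real_mult)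
      then show "w x * of_real (max 0 (x - y)) - w x * of_real (max 0 (x - (y + s))) = of_real s * (w x * of_real (ramp' s (x - y)))"
        by (metis mult.left_commute right_diff_distrib)
    qed
    finally show ?thesis by simp
  qed
  ultimately show ?thesis by (simp add: algebra_simps)
qed

text \<open>Dividing the second difference identity by s and letting s tend to 0 shows that f x plus
  the integral of w over [x, L] has the same value at all Lebesgue points x of f. Hence f is a
  primitive of w almost everywhere.\<close>

lemma weak_derivative_imp_primitive:
  assumes f: "f \<in> L2_interval L" and w: "w \<in> L2_interval L" and wd: "is_weak_derivative L f w"
  obtains k where "AE x in leb L. k + integral {0..x} w = f x"
proof -
  let ?M = "leb L"
  note fi = L2_intervalD(3)[OF f] and wi = L2_intervalD(3)[OF w]
  note fI = integrable_interval_integrable_on[OF fi] and wI = integrable_interval_integrable_on[OF wi]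
  obtain N where N: "negligible N"
    and lim: "\<And>x. x \<in> {0<..<L} - N \<Longrightarrow> ((\<lambda>s. integral {x..x+s} f / of_real s) \<longlongrightarrow> f x) (at_right 0)"
    using lebesgue_point[OF fI] by metis
  have comb: "integral {x..L} g - integral {x+s..L} g = integral {x..x+s} g"
    if "g integrable_on {0..L}" "0 < x" "0 < s" "x + s < L" for g :: "real \<Rightarrow> complex" and x s
  proof -
    have "integral {x..x+s} g + integral {x+s..L} g = integral {x..L} g"
      using that by (intro Henstock_Kurzweil_Integration.integral_combine integrable_subinterval_real[OF that(1)]) auto
    then show ?thesis by (simp add: algebra_simps)
  qed
  have lt: "f a - f c = - (integral {a..L} w - integral {c..L} w)"
    if a: "a \<in> {0<..<L} - N" and c: "c \<in> {0<..<L} - N" and "a < c" for a c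
  proof -
    \<comment> \<open>Steps of at most half the distance from c to L keep c + s n below L.\<close>
    define s where "s n = (L - c) / 2 / real (Suc n)" for n
    have s0: "s n > 0" for n using c by (simp add: s_def)
    have sL: "c + s n < L" for n
    proof -
      have "s n \<le> (L - c) / 2 / 1"
        unfolding s_def using c by (intro divide_left_mono) auto
      then show ?thesis using c by (simp add: field_simps)
    qed
    have slim: "s \<longlonglongrightarrow> 0"
      unfolding s_def by (intro tendsto_divide_0[OF tendsto_const] filterlim_at_top_imp_at_infinity
          filterlim_compose[OF filterlim_real_sequentially filterlim_Suc])
    have sr: "filterlim s (at_right 0) sequentially"
      using slim s0 by (simp add: filterlim_at less_imp_neq[THEN not_sym] less_imp_le)
    have eq: "integral {a..a + s n} f / of_real (s n) - integral {c..c + s n} f / of_real (s n) =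
      - ((LINT x|?M. w x * of_real (ramp' (s n) (x - a))) - (LINT x|?M. w x * of_real (ramp' (s n) (x - c))))" for n
    proof -
      have "integral {a..a + s n} f - integral {c..c + s n} f =
          - of_real (s n) * ((LINT x|?M. w x * of_real (ramp' (s n) (x - a))) - (LINT x|?M. w x * of_real (ramp' (s n) (x - c))))"
        using weak_derivative_second_difference[OF fi wi wd _ that(3) sL[of n] s0[of n]] a c that(3) s0[of n] sL[of n]
        by (simp add: comb[OF fI])
      then show ?thesis
        using s0[of n] by (simp add: diff_divide_distrib[symmetric] field_simps)
    qed
    have "(\<lambda>n. integral {a..a + s n} f / of_real (s n) - integral {c..c + s n} f / of_real (s n)) \<longlonglongrightarrow> f a - f c"
      using filterlim_compose[OF lim[OF a] sr] filterlim_compose[OF lim[OF c] sr] by (rule tendsto_diff)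
    moreover have "(\<lambda>n. - ((LINT x|?M. w x * of_real (ramp' (s n) (x - a))) - (LINT x|?M. w x * of_real (ramp' (s n) (x - c)))))
       \<longlonglongrightarrow> - (integral {a..L} w - integral {c..L} w)"
      using a c by (intro tendsto_minus tendsto_diff ramp'_integral_tendsto wi s0 slim) auto
    ultimately show ?thesis unfolding eq by (rule LIMSEQ_unique)
  qed
  have all: "f a + integral {a..L} w = f c + integral {c..L} w"
    if a: "a \<in> {0<..<L} - N" and c: "c \<in> {0<..<L} - N" for a c
    using lt[OF a c] lt[OF c a] by (cases a c rule: linorder_cases) (auto simp: algebra_simps)
  have split: "integral {0..x} w + integral {x..L} w = integral {0..L} w" if "x \<in> {0<..<L}" for x
    using that by (intro Henstock_Kurzweil_Integration.integral_combine wI) auto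
  \<comment> \<open>If no Lebesgue point exists, as for L <= 0, every k will do.\<close>
  have "\<exists>k. \<forall>x\<in>{0<..<L} - N. k + integral {0..x} w = f x"
  proof (cases "{0<..<L} - N = {}")
    case False
    then obtain a where a: "a \<in> {0<..<L} - N" by blast
    show ?thesis
    proof (intro exI ballI)
      fix x assume x: "x \<in> {0<..<L} - N"
      have "f a + integral {a..L} w - integral {0..L} w + integral {0..x} w =
          (f x + integral {x..L} w) - (integral {0..x} w + integral {x..L} w) + integral {0..x} w"
        using all[OF a x] split[of x] x by simp
      also have "\<dots> = f x" by simp
      finally show "(f a + integral {a..L} w - integral {0..L} w) + integral {0..x} w = f x" by simp
    qed
  qed auto
  then obtain k where "\<And>x. x \<in> {0<..<L} - N \<Longrightarrow> k + integral {0..x} w = f x" by blast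
  then show thesis
    by (intro that AE_interval_negligible[OF N])
qed

section \<open>Calculus of weak derivatives and continuous representatives\<close>

lemma is_weak_derivative_cong_AE:
  assumes "f \<in> L2_interval L" "f' \<in> L2_interval L" "w \<in> L2_interval L" "w' \<in> L2_interval L"
    and f: "AE x in leb L. f x = f' x" and w: "AE x in leb L. w x = w' x"
    and wd: "is_weak_derivative L f w"
  shows "is_weak_derivative L f' w'"
  unfolding is_weak_derivative_def
proof (intro allI impI, elim conjE)
  fix \<phi> \<phi>' :: "real \<Rightarrow> real"
  assume d: "\<forall>x. (\<phi> has_real_derivative \<phi>' x) (at x)" and c: "continuous_on UNIV \<phi>'"
    and s: "\<exists>a b. 0 < a \<and> b < L \<and> (\<forall>x. x \<notin> {a..b} \<longrightarrow> \<phi> x = 0)"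
  have c': "continuous_on UNIV \<phi>"
    using d by (meson DERIV_isCont continuous_at_imp_continuous_on)
  have m: "(\<lambda>x. g x * of_real (\<psi> x)) \<in> borel_measurable (leb L)"
    if "g \<in> L2_interval L" "continuous_on UNIV \<psi>" for g and \<psi> :: "real \<Rightarrow> real"
    by (intro borel_measurable_integrable integrable_mult_bounded_continuous L2_intervalD(3) that)
  have "(LINT x|leb L. f' x * of_real (\<phi>' x)) = (LINT x|leb L. f x * of_real (\<phi>' x))"
    by (intro integral_cong_AE m assms c) (use f in \<open>eventually_elim, simp\<close>)
  also have "\<dots> = - (LINT x|leb L. w x * of_real (\<phi> x))"
    using wd d c s unfolding is_weak_derivative_def by blast
  also have "(LINT x|leb L. w x * of_real (\<phi> x)) = (LINT x|leb L. w' x * of_real (\<phi> x))"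
    by (intro integral_cong_AE m assms c') (use w in \<open>eventually_elim, simp\<close>)
  finally show "(LINT x|leb L. f' x * of_real (\<phi>' x)) = - (LINT x|leb L. w' x * of_real (\<phi> x))" .
qed

lemma is_weak_derivative_linear:
  assumes L2: "f \<in> L2_interval L" "g \<in> L2_interval L" "v \<in> L2_interval L" "w \<in> L2_interval L"
    and f: "is_weak_derivative L f v" and g: "is_weak_derivative L g w"
  shows "is_weak_derivative L (\<lambda>x. a * f x + b * g x) (\<lambda>x. a * v x + b * w x)"
  unfolding is_weak_derivative_def
proof (intro allI impI, elim conjE)
  fix \<phi> \<phi>' :: "real \<Rightarrow> real"
  assume d: "\<forall>x. (\<phi> has_real_derivative \<phi>' x) (at x)" and c: "continuous_on UNIV \<phi>'"
    and s: "\<exists>a b. 0 < a \<and> b < L \<and> (\<forall>x. x \<notin> {a..b} \<longrightarrow> \<phi> x = 0)"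
  have c': "continuous_on UNIV \<phi>"
    using d by (meson DERIV_isCont continuous_at_imp_continuous_on)
  have lin: "(LINT x|leb L. (a * p x + b * q x) * of_real (\<psi> x)) =
      a * (LINT x|leb L. p x * of_real (\<psi> x)) + b * (LINT x|leb L. q x * of_real (\<psi> x))"
    if "p \<in> L2_interval L" "q \<in> L2_interval L" "continuous_on UNIV \<psi>" for p q and \<psi> :: "real \<Rightarrow> real"
    using integrable_mult_bounded_continuous[OF L2_intervalD(3)[OF that(1)] that(3)]
      integrable_mult_bounded_continuous[OF L2_intervalD(3)[OF that(2)] that(3)]
    by (simp add: distrib_right mult.assoc)
  have "(LINT x|leb L. f x * of_real (\<phi>' x)) = - (LINT x|leb L. v x * of_real (\<phi> x))"
    "(LINT x|leb L. g x * of_real (\<phi>' x)) = - (LINT x|leb L. w x * of_real (\<phi> x))"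
    using f g d c s unfolding is_weak_derivative_def by blast+
  then show "(LINT x|leb L. (a * f x + b * g x) * of_real (\<phi>' x)) =
      - (LINT x|leb L. (a * v x + b * w x) * of_real (\<phi> x))"
    using L2 c c' by (simp add: lin)
qed

text \<open>Integration by parts, read off from the fundamental theorem of calculus for f times
  \<phi>; the boundary terms vanish with \<phi> at 0 and L.\<close>

lemma is_weak_derivative_classical:
  fixes f f' :: "real \<Rightarrow> complex"
  assumes L: "L > 0" and f: "\<And>x. x \<in> {0..L} \<Longrightarrow> (f has_vector_derivative f' x) (at x within {0..L})"
    and f': "continuous_on {0..L} f'"
  shows "is_weak_derivative L f f'"
  unfolding is_weak_derivative_def
proof (intro allI impI, elim conjE exE)
  fix \<phi> \<phi>' :: "real \<Rightarrow> real" and a b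
  assume d: "\<forall>x. (\<phi> has_real_derivative \<phi>' x) (at x)" and c: "continuous_on UNIV \<phi>'"
    and s: "0 < a" "b < L" "\<forall>x. x \<notin> {a..b} \<longrightarrow> \<phi> x = 0"
  have cf: "continuous_on {0..L} f"
    using f by (meson continuous_on_eq_continuous_within has_vector_derivative_continuous)
  have c': "continuous_on UNIV \<phi>"
    using d by (meson DERIV_isCont continuous_at_imp_continuous_on)
  have i: "integrable (leb L) f" "integrable (leb L) f'"
    using L2_intervalD(3)[OF L2_interval_continuous] cf f' by blast+
  note i' = integrable_mult_bounded_continuous[OF i(1) c] integrable_mult_bounded_continuous[OF i(2) c']
  have "((\<lambda>x. f x * of_real (\<phi>' x) + f' x * of_real (\<phi> x)) has_integral
      f L * of_real (\<phi> L) - f 0 * of_real (\<phi> 0)) {0..L}"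
  proof (rule fundamental_theorem_of_calculus)
    fix x assume x: "x \<in> {0..L}"
    have "(\<phi> has_vector_derivative \<phi>' x) (at x within {0..L})"
      using d has_real_derivative_iff_has_vector_derivative has_field_derivative_at_within by blast
    then have "((\<lambda>x. complex_of_real (\<phi> x)) has_vector_derivative of_real (\<phi>' x)) (at x within {0..L})"
      by (rule bounded_linear.has_vector_derivative[OF bounded_linear_of_real])
    from has_vector_derivative_mult[OF f[OF x] this]
    show "((\<lambda>x. f x * of_real (\<phi> x)) has_vector_derivative f x * of_real (\<phi>' x) + f' x * of_real (\<phi> x)) (at x within {0..L})" .
  qed (use L in simp)
  moreover have "\<phi> 0 = 0" "\<phi> L = 0" using s by auto
  ultimately have "integral {0..L} (\<lambda>x. f x * of_real (\<phi>' x) + f' x * of_real (\<phi> x)) = 0"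
    by (simp add: integral_unique)
  moreover have "(LINT x|leb L. f x * of_real (\<phi>' x) + f' x * of_real (\<phi> x)) =
      integral {0..L} (\<lambda>x. f x * of_real (\<phi>' x) + f' x * of_real (\<phi> x))"
    using i' by (intro lebesgue_integral_eq_integral Bochner_Integration.integrable_add) auto
  moreover have "(LINT x|leb L. f x * of_real (\<phi>' x) + f' x * of_real (\<phi> x)) =
      (LINT x|leb L. f x * of_real (\<phi>' x)) + (LINT x|leb L. f' x * of_real (\<phi> x))"
    using i' by (rule Bochner_Integration.integral_add)
  ultimately show "(LINT x|leb L. f x * of_real (\<phi>' x)) = - (LINT x|leb L. f' x * of_real (\<phi> x))"
    by (simp add: eq_neg_iff_add_eq_0)
qed

lemma continuous_on_primitive:
  fixes w :: "real \<Rightarrow> complex"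
  assumes "w \<in> L2_interval L"
  shows "continuous_on {0..L} (\<lambda>x. k + integral {0..x} w)"
  using integrable_interval_integrable_on[OF L2_intervalD(3)[OF assms]]
  by (intro continuous_intros indefinite_integral_continuous_1)

lemma AE_interval_sym:
  "AE x in leb L. f x = g x \<Longrightarrow> AE x in leb L. g x = f x"
  by (erule eventually_mono) simp

lemma AE_interval_trans:
  "AE x in leb L. f x = g x \<Longrightarrow> AE x in leb L. g x = h x \<Longrightarrow>
    AE x in leb L. f x = h x"
  by (rule eventually_elim2) auto

text \<open>Makes the choice in \<open>cont_rep\<close> computable: any continuous function in the
  class of f may be used on [0, L].\<close>

lemma cont_rep_eq:
  assumes L: "L > 0" and h: "continuous_on {0..L} h" "AE x in leb L. h x = f x" and x: "x \<in> {0..L}"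
  shows "cont_rep L f x = h x"
proof -
  have "continuous_on {0..L} (cont_rep L f) \<and> (AE x in leb L. cont_rep L f x = f x)"
    unfolding cont_rep_def by (rule someI[of _ h]) (use h in simp)
  then have "continuous_on {0..L} (cont_rep L f)" "AE x in leb L. cont_rep L f x = h x"
    using AE_interval_trans[OF _ AE_interval_sym[OF h(2)]] by blast+
  then show ?thesis
    by (rule AE_interval_continuous_eq[OF _ h(1) L _ x])
qed

text \<open>The two primitives of v and w represent the same f, so they agree everywhere by
  continuity. At x = 0 this equates the constants, and then v - w has vanishing integral over every
  [0, x].\<close>

lemma weak_derivative_unique:
  assumes L: "L > 0" and L2: "f \<in> L2_interval L" "v \<in> L2_interval L" "w \<in> L2_interval L"
    and wd: "is_weak_derivative L f v" "is_weak_derivative L f w"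
  shows "AE x in leb L. v x = w x"
proof -
  obtain j where j: "AE x in leb L. j + integral {0..x} v = f x"
    using weak_derivative_imp_primitive[OF L2(1,2) wd(1)] .
  obtain k where k: "AE x in leb L. k + integral {0..x} w = f x"
    using weak_derivative_imp_primitive[OF L2(1,3) wd(2)] .
  have eq: "j + integral {0..x} v = k + integral {0..x} w" if "x \<in> {0..L}" for x
    by (intro AE_interval_continuous_eq[OF _ _ L AE_interval_trans[OF j AE_interval_sym[OF k]] that]
        continuous_on_primitive L2)
  have "j = k" using eq[of 0] L by simp
  have int: "v integrable_on {0..L}" "w integrable_on {0..L}"
    using integrable_interval_integrable_on L2_intervalD(3) L2 by blast+
  have "AE x in leb L. v x - w x = 0"
  proof (rule integral_zero_imp_AE_zero)
    show "(\<lambda>x. v x - w x) integrable_on {0..L}"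
      using int by (rule integrable_diff)
    fix x assume x: "x \<in> {0..L}"
    then have "v integrable_on {0..x}" "w integrable_on {0..x}"
      using int by (auto intro: integrable_subinterval_real)
    then show "integral {0..x} (\<lambda>x. v x - w x) = 0"
      using eq[OF x] \<open>j = k\<close> by (simp add: Henstock_Kurzweil_Integration.integral_diff)
  qed
  then show ?thesis by simp
qed

lemma H1_intervalD:
  assumes "f \<in> H1_interval L"
  shows "f \<in> L2_interval L" "weak_deriv L f \<in> L2_interval L" "is_weak_derivative L f (weak_deriv L f)"
proof -
  show "f \<in> L2_interval L" using assms by (simp add: H1_interval_def)
  have "weak_deriv L f \<in> L2_interval L \<and> is_weak_derivative L f (weak_deriv L f)"
    unfolding weak_deriv_def by (rule someI_ex[of "\<lambda>w. w \<in> L2_interval L \<and> is_weak_derivative L f w"])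
      (use assms in \<open>auto simp: H1_interval_def\<close>)
  then show "weak_deriv L f \<in> L2_interval L" "is_weak_derivative L f (weak_deriv L f)" by auto
qed

lemma H1_intervalI:
  assumes "L > 0" "f \<in> L2_interval L" "w \<in> L2_interval L" "is_weak_derivative L f w"
  shows "f \<in> H1_interval L" "AE x in leb L. weak_deriv L f x = w x"
proof -
  show f: "f \<in> H1_interval L" using assms by (auto simp: H1_interval_def)
  show "AE x in leb L. weak_deriv L f x = w x"
    using H1_intervalD[OF f] assms by (intro weak_derivative_unique[of L f]) auto
qed

text \<open>A primitive of the weak derivative is a continuous function in the class of f, so
  \<open>cont_rep\<close> is a genuine choice and coincides with it; the constant of integration is
  the value at 0.\<close>

lemma H1_cont_rep:
  assumes L: "L > 0" and f: "f \<in> H1_interval L"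
  shows "continuous_on {0..L} (cont_rep L f)"
    and "AE x in leb L. cont_rep L f x = f x"
    and "\<And>x. x \<in> {0..L} \<Longrightarrow> cont_rep L f x = cont_rep L f 0 + integral {0..x} (weak_deriv L f)"
proof -
  note H1 = H1_intervalD[OF f]
  obtain k where k: "AE x in leb L. k + integral {0..x} (weak_deriv L f) = f x"
    using weak_derivative_imp_primitive[OF H1] .
  note c = continuous_on_primitive[OF H1(2), of k]
  have "continuous_on {0..L} (cont_rep L f) \<and> (AE x in leb L. cont_rep L f x = f x)"
    unfolding cont_rep_def by (rule someI[of _ "\<lambda>x. k + integral {0..x} (weak_deriv L f)"]) (use c k in simp)
  then show "continuous_on {0..L} (cont_rep L f)" "AE x in leb L. cont_rep L f x = f x"
    by auto
  fix x assume "x \<in> {0..L}"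
  then show "cont_rep L f x = cont_rep L f 0 + integral {0..x} (weak_deriv L f)"
    using cont_rep_eq[OF L c k, of x] cont_rep_eq[OF L c k, of 0] L by simp
qed

text \<open>\<open>weak_deriv\<close> chooses a function depending on the representative, so a
  second derivative is a choice made from a choice. This lemma allows the inner choice to be
  replaced by a convenient function.\<close>

lemma H1_interval_cong_AE:
  assumes L: "L > 0" and f: "f \<in> H1_interval L" and g: "g \<in> L2_interval L"
    and ae: "AE x in leb L. f x = g x"
  shows "g \<in> H1_interval L" "AE x in leb L. weak_deriv L g x = weak_deriv L f x"
    "\<And>x. x \<in> {0..L} \<Longrightarrow> cont_rep L g x = cont_rep L f x"
proof -
  note H1 = H1_intervalD[OF f]
  have "is_weak_derivative L g (weak_deriv L f)"
    by (rule is_weak_derivative_cong_AE[OF H1(1) g H1(2) H1(2) ae _ H1(3)]) simp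
  from H1_intervalI[OF L g H1(2) this]
  show "g \<in> H1_interval L" "AE x in leb L. weak_deriv L g x = weak_deriv L f x" .
  fix x assume "x \<in> {0..L}"
  then show "cont_rep L g x = cont_rep L f x"
    by (intro cont_rep_eq[OF L H1_cont_rep(1)[OF L f]] AE_interval_trans[OF H1_cont_rep(2)[OF L f] ae])
qed

lemma H1_interval_linear:
  assumes L: "L > 0" and f: "f \<in> H1_interval L" and g: "g \<in> H1_interval L"
  shows "(\<lambda>x. a * f x + b * g x) \<in> H1_interval L"
    "AE x in leb L. weak_deriv L (\<lambda>x. a * f x + b * g x) x = a * weak_deriv L f x + b * weak_deriv L g x"
    "\<And>x. x \<in> {0..L} \<Longrightarrow> cont_rep L (\<lambda>x. a * f x + b * g x) x = a * cont_rep L f x + b * cont_rep L g x"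
proof -
  note F = H1_intervalD[OF f] and G = H1_intervalD[OF g]
  have "is_weak_derivative L (\<lambda>x. a * f x + b * g x) (\<lambda>x. a * weak_deriv L f x + b * weak_deriv L g x)"
    by (intro is_weak_derivative_linear F G)
  from H1_intervalI[OF L L2_interval_linear[OF F(1) G(1)] L2_interval_linear[OF F(2) G(2)] this]
  show "(\<lambda>x. a * f x + b * g x) \<in> H1_interval L"
    "AE x in leb L. weak_deriv L (\<lambda>x. a * f x + b * g x) x = a * weak_deriv L f x + b * weak_deriv L g x" .
  fix x assume x: "x \<in> {0..L}"
  have "AE x in leb L. a * cont_rep L f x + b * cont_rep L g x = a * f x + b * g x"
    using H1_cont_rep(2)[OF L f] H1_cont_rep(2)[OF L g] by eventually_elim simp
  then show "cont_rep L (\<lambda>x. a * f x + b * g x) x = a * cont_rep L f x + b * cont_rep L g x"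
    by (intro cont_rep_eq[OF L _ _ x] continuous_intros H1_cont_rep(1) L f g)
qed

lemma H2_intervalD:
  assumes "f \<in> H2_interval L"
  shows "f \<in> H1_interval L" "weak_deriv L f \<in> H1_interval L"
  using assms by (auto simp: H2_interval_def)

lemma H2_intervalI:
  assumes L: "L > 0" and f: "f \<in> L2_interval L" "is_weak_derivative L f v"
    and v: "v \<in> L2_interval L" "is_weak_derivative L v w" and w: "w \<in> L2_interval L"
  shows "f \<in> H2_interval L"
    "AE x in leb L. weak_deriv L f x = v x"
    "AE x in leb L. weak_deriv L (weak_deriv L f) x = w x"
    "\<And>x. x \<in> {0..L} \<Longrightarrow> cont_rep L (weak_deriv L f) x = cont_rep L v x"
proof -
  note F = H1_intervalI[OF L f(1) v(1) f(2)] and V = H1_intervalI[OF L v(1) w v(2)]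
  note C = H1_interval_cong_AE[OF L V(1) H1_intervalD(2)[OF F(1)] AE_interval_sym[OF F(2)]]
  show "f \<in> H2_interval L" using F(1) C(1) by (simp add: H2_interval_def)
  show "AE x in leb L. weak_deriv L f x = v x" by (rule F(2))
  show "AE x in leb L. weak_deriv L (weak_deriv L f) x = w x"
    by (rule AE_interval_trans[OF C(2) V(2)])
  show "cont_rep L (weak_deriv L f) x = cont_rep L v x" if "x \<in> {0..L}" for x
    by (rule C(3)[OF that])
qed

text \<open>Bundles f with a.e. versions v, w of its derivatives and with functions u, u' giving the
  exact values of the continuous representatives of f and of its derivative. Linear combinations
  then pass through all these choices in a single induction.\<close>

definition H2_rep ::
  "real \<Rightarrow> (real \<Rightarrow> complex) \<Rightarrow> (real \<Rightarrow> complex) \<Rightarrow> (real \<Rightarrow> complex) \<Rightarrow> (real \<Rightarrow> complex) \<Rightarrow> (real \<Rightarrow> complex) \<Rightarrow> bool" where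
  "H2_rep L f v w u u' \<longleftrightarrow> f \<in> H2_interval L \<and> (AE x in leb L. weak_deriv L f x = v x) \<and>
    (AE x in leb L. weak_deriv L (weak_deriv L f) x = w x) \<and>
    (\<forall>x\<in>{0..L}. cont_rep L f x = u x \<and> cont_rep L (weak_deriv L f) x = u' x)"

lemma H2_rep_self: "f \<in> H2_interval L \<Longrightarrow>
    H2_rep L f (weak_deriv L f) (weak_deriv L (weak_deriv L f)) (cont_rep L f) (cont_rep L (weak_deriv L f))"
  by (simp add: H2_rep_def)

lemma H2_rep_linear:
  assumes L: "L > 0" and f: "H2_rep L f v w u u'" and g: "H2_rep L g p q r r'"
  shows "H2_rep L (\<lambda>x. a * f x + b * g x) (\<lambda>x. a * v x + b * p x) (\<lambda>x. a * w x + b * q x)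
    (\<lambda>x. a * u x + b * r x) (\<lambda>x. a * u' x + b * r' x)"
proof -
  have "f \<in> H2_interval L" "g \<in> H2_interval L" using f g by (simp_all add: H2_rep_def)
  note F = H2_intervalD[OF this(1)] and G = H2_intervalD[OF this(2)]
  note H = H1_interval_linear[OF L F(1) G(1), where a = a and b = b]
    and H' = H1_interval_linear[OF L F(2) G(2), where a = a and b = b]
  note C = H1_interval_cong_AE[OF L H'(1) H1_intervalD(2)[OF H(1)] AE_interval_sym[OF H(2)]]
  have fv: "AE x in leb L. weak_deriv L f x = v x" "AE x in leb L. weak_deriv L (weak_deriv L f) x = w x"
    and gp: "AE x in leb L. weak_deriv L g x = p x" "AE x in leb L. weak_deriv L (weak_deriv L g) x = q x"
    using f g by (simp_all add: H2_rep_def)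
  show ?thesis
    unfolding H2_rep_def
  proof (intro conjI ballI)
    show "(\<lambda>x. a * f x + b * g x) \<in> H2_interval L" using H(1) C(1) by (simp add: H2_interval_def)
    show "AE x in leb L. weak_deriv L (\<lambda>x. a * f x + b * g x) x = a * v x + b * p x"
      using H(2) fv(1) gp(1) by eventually_elim simp
    show "AE x in leb L. weak_deriv L (weak_deriv L (\<lambda>x. a * f x + b * g x)) x = a * w x + b * q x"
      using C(2) H'(2) fv(2) gp(2) by eventually_elim simp
    fix x assume x: "x \<in> {0..L}"
    then have "cont_rep L f x = u x" "cont_rep L (weak_deriv L f) x = u' x"
      "cont_rep L g x = r x" "cont_rep L (weak_deriv L g) x = r' x"
      using f g by (simp_all add: H2_rep_def)
    then show "cont_rep L (\<lambda>x. a * f x + b * g x) x = a * u x + b * r x"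
      "cont_rep L (weak_deriv L (\<lambda>x. a * f x + b * g x)) x = a * u' x + b * r' x"
      using H(3)[OF x] C(3)[OF x] H'(3)[OF x] by simp_all
  qed
qed

section \<open>Pointwise estimates for Sobolev functions\<close>

lemma integral_cong_AE_interval:
  fixes f g :: "real \<Rightarrow> complex"
  assumes ae: "AE x in leb L. f x = g x" and ab: "{a..b} \<subseteq> {0..L}"
  shows "integral {a..b} f = integral {a..b} g"
proof -
  have "AE y in lebesgue. y \<in> {0..L} \<longrightarrow> f y = g y"
    using ae by (subst (asm) AE_restrict_space_iff) auto
  then obtain N where A: "\<And>y. y \<in> space lebesgue - N \<Longrightarrow> y \<in> {0..L} \<longrightarrow> f y = g y" and N: "N \<in> null_sets lebesgue"
    by (rule AE_E3) (rule that)
  show ?thesis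
  proof (rule integral_spike)
    show "negligible N" using N negligible_iff_null_sets by blast
    fix x assume "x \<in> {a..b} - N"
    then show "g x = f x" using A[of x] ab by auto
  qed
qed

text \<open>The weak derivative may be replaced by its continuous representative under the integral,
  and the integral of a continuous function is classically differentiable.\<close>

lemma H2_cont_rep_has_derivative:
  assumes L: "L > 0" and f: "f \<in> H2_interval L" and x: "x \<in> {0..L}"
  shows "(cont_rep L f has_vector_derivative cont_rep L (weak_deriv L f) x) (at x within {0..L})"
proof -
  note F = H2_intervalD[OF f]
  note C = H1_cont_rep[OF L F(1)] and C' = H1_cont_rep[OF L F(2)]
  have eq: "cont_rep L f 0 + integral {0..y} (cont_rep L (weak_deriv L f)) = cont_rep L f y" if "y \<in> {0..L}" for y
    using C(3)[OF that] integral_cong_AE_interval[OF C'(2), of 0 y] that by simp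
  have "((\<lambda>y. integral {0..y} (cont_rep L (weak_deriv L f))) has_vector_derivative cont_rep L (weak_deriv L f) x) (at x within {0..L})"
    using C'(1) x by (rule integral_has_vector_derivative)
  then have "((\<lambda>y. cont_rep L f 0 + integral {0..y} (cont_rep L (weak_deriv L f))) has_vector_derivative
      0 + cont_rep L (weak_deriv L f) x) (at x within {0..L})"
    by (intro has_vector_derivative_add has_vector_derivative_const)
  then have "((\<lambda>y. cont_rep L f 0 + integral {0..y} (cont_rep L (weak_deriv L f))) has_vector_derivative
      cont_rep L (weak_deriv L f) x) (at x within {0..L})" by simp
  then show ?thesis
    by (rule has_vector_derivative_transform[OF x, rotated]) (use eq in simp)
qed

text \<open>The Cauchy-Schwarz inequality against the constant 1, derived from the fact that a
  variance is nonnegative.\<close>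

lemma norm_integral_squared_le:
  assumes L: "L > 0" and w: "w \<in> L2_interval L" and ab: "0 \<le> a" "b \<le> L"
  shows "(cmod (integral {a..b} w))\<^sup>2 \<le> L * (LINT x|leb L. (cmod (w x))\<^sup>2)"
proof -
  let ?M = "leb L"
  interpret finite_measure ?M by (rule finite_measure_interval)
  note W = L2_intervalD[OF w]
  define I where "I = (LINT x|?M. cmod (w x))"
  define J where "J = (LINT x|?M. (cmod (w x))\<^sup>2)"
  have mL: "measure ?M (space ?M) = L"
    using L by (simp add: measure_restrict_space space_restrict_space)
  have i: "integrable ?M (\<lambda>x. cmod (w x))" using W(3) by simp
  \<comment> \<open>I / L is the mean of |w| over the interval.\<close>
  have "0 \<le> (LINT x|?M. (cmod (w x) - I / L)\<^sup>2)"
    by (rule integral_nonneg_AE) simp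
  also have "\<dots> = (LINT x|?M. (cmod (w x))\<^sup>2 - 2 * (I / L) * cmod (w x) + (I / L)\<^sup>2)"
    by (simp add: power2_diff algebra_simps)
  also have "\<dots> = J - 2 * (I / L) * I + (I / L)\<^sup>2 * L"
    using i W(2) mL by (simp add: I_def J_def)
  also have "\<dots> = J - I\<^sup>2 / L"
    using L by (simp add: power2_eq_square field_simps)
  finally have IJ: "I\<^sup>2 \<le> L * J" using L by (simp add: field_simps)
  have "cmod (integral {a..b} w) \<le> integral {a..b} (\<lambda>x. cmod (w x))"
  proof (rule integral_norm_bound_integral)
    have "w integrable_on {0..L}" "(\<lambda>x. cmod (w x)) integrable_on {0..L}"
      using W(3) i by (auto intro!: integrable_on_lebesgue_on)
    then show "w integrable_on {a..b}" "(\<lambda>x. cmod (w x)) integrable_on {a..b}"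
      using ab by (auto intro: integrable_subinterval_real)
  qed simp
  also have "\<dots> \<le> integral {0..L} (\<lambda>x. cmod (w x))"
  proof (rule integral_subset_le)
    show i': "(\<lambda>x. cmod (w x)) integrable_on {0..L}"
      using i by (auto intro!: integrable_on_lebesgue_on)
    show "(\<lambda>x. cmod (w x)) integrable_on {a..b}"
      using ab by (auto intro: integrable_subinterval_real[OF i'])
  qed (use ab in auto)
  also have "\<dots> = I"
    unfolding I_def by (rule lebesgue_integral_eq_integral[symmetric]) (use i in auto)
  finally have "(cmod (integral {a..b} w))\<^sup>2 \<le> I\<^sup>2" by (rule power_mono) simp
  with IJ show ?thesis by (simp add: J_def)
qed

text \<open>With B the integral of |f'|^2, any two values satisfy |f x|^2 <= 2 |f y|^2 + 2 L B.
  Integrating over y in [0, L] and dividing by L produces the constants 2 / L and 2 L.\<close>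

lemma H1_cont_rep_bound:
  assumes L: "L > 0" and f: "f \<in> H1_interval L" and x: "x \<in> {0..L}"
  shows "(cmod (cont_rep L f x))\<^sup>2 \<le> (2 / L + 2 * L) *
    ((LINT x|leb L. (cmod (f x))\<^sup>2) + (LINT x|leb L. (cmod (weak_deriv L f x))\<^sup>2))"
proof -
  let ?M = "leb L"
  interpret finite_measure ?M by (rule finite_measure_interval)
  note F = H1_intervalD[OF f] and C = H1_cont_rep[OF L f]
  note F2 = L2_intervalD[OF F(1)]
  define A where "A = (LINT x|?M. (cmod (f x))\<^sup>2)"
  define B where "B = (LINT x|?M. (cmod (weak_deriv L f x))\<^sup>2)"
  have AB: "0 \<le> A" "0 \<le> B" unfolding A_def B_def by (auto intro: integral_nonneg_AE)
  have mL: "measure ?M (space ?M) = L"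
    using L by (simp add: measure_restrict_space space_restrict_space)
  have diff: "(cmod (cont_rep L f x - cont_rep L f y))\<^sup>2 \<le> L * B" if "x \<in> {0..L}" "y \<in> {0..L}" "y \<le> x" for x y
  proof -
    have "weak_deriv L f integrable_on {0..x}"
      using integrable_interval_integrable_on[OF L2_intervalD(3)[OF F(2)]] that
      by (auto intro: integrable_subinterval_real)
    then have "integral {0..y} (weak_deriv L f) + integral {y..x} (weak_deriv L f) = integral {0..x} (weak_deriv L f)"
      using that by (intro Henstock_Kurzweil_Integration.integral_combine) auto
    then have "cont_rep L f x - cont_rep L f y = integral {y..x} (weak_deriv L f)"
      using C(3)[OF that(1)] C(3)[OF that(2)] by (simp add: algebra_simps)
    then show ?thesis
      using norm_integral_squared_le[OF L F(2), of y x] that by (simp add: B_def)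
  qed
  have pt: "(cmod (cont_rep L f x))\<^sup>2 \<le> 2 * (cmod (cont_rep L f y))\<^sup>2 + 2 * (L * B)" if "y \<in> {0..L}" for y
  proof -
    have "(cmod (cont_rep L f x - cont_rep L f y))\<^sup>2 \<le> L * B"
      using diff[of x y] diff[of y x] x that by (cases "y \<le> x") (auto simp: norm_minus_commute)
    then show ?thesis
      using norm_add_squared_le[of "cont_rep L f y" "cont_rep L f x - cont_rep L f y"] by simp
  qed
  have "(cmod (cont_rep L f x))\<^sup>2 * L = (LINT y|?M. (cmod (cont_rep L f x))\<^sup>2)"
    using mL by simp
  also have "\<dots> \<le> (LINT y|?M. 2 * (cmod (f y))\<^sup>2 + 2 * (L * B))"
  proof (rule integral_mono_AE)
    have "AE y in ?M. y \<in> {0..L}" by (rule AE_I2) (simp add: space_restrict_space)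
    with C(2) show "AE y in ?M. (cmod (cont_rep L f x))\<^sup>2 \<le> 2 * (cmod (f y))\<^sup>2 + 2 * (L * B)"
    proof eventually_elim
      case (elim y)
      show ?case using pt[OF elim(2)] elim(1) by simp
    qed
  qed (use F2(2) in auto)
  also have "\<dots> = 2 * A + 2 * (L * B) * L"
    using F2(2) mL by (simp add: A_def)
  finally have "(cmod (cont_rep L f x))\<^sup>2 \<le> 2 / L * A + 2 * L * B"
    using L by (simp add: field_simps)
  also have "\<dots> \<le> (2 / L + 2 * L) * (A + B)"
    using L AB by (simp add: distrib_left distrib_right)
  finally show ?thesis by (simp add: A_def B_def)
qed

lemma H2_cont_rep_Lipschitz:
  assumes L: "L > 0" and f: "f \<in> H2_interval L" and xy: "x \<in> {0..L}" "y \<in> {0..L}"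
    and B: "\<And>z. z \<in> {0..L} \<Longrightarrow> cmod (cont_rep L (weak_deriv L f) z) \<le> B"
  shows "cmod (cont_rep L f x - cont_rep L f y) \<le> B * \<bar>x - y\<bar>"
proof -
  have "onorm (\<lambda>t. t *\<^sub>R cont_rep L (weak_deriv L f) z) \<le> B" if "z \<in> {0..L}" for z
    using B[OF that] by (auto intro!: onorm_le simp: mult.commute[of B] mult_left_mono)
  then have "norm (cont_rep L f x - cont_rep L f y) \<le> B * norm (x - y)"
    using H2_cont_rep_has_derivative[OF L f] xy unfolding has_vector_derivative_def
    by (intro differentiable_bound[of "{0..L}" _ "\<lambda>z t. t *\<^sub>R cont_rep L (weak_deriv L f) z"]) auto
  then show ?thesis by simp
qed

section \<open>The homogeneous equation on one edge\<close>

definition kappa :: complex where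
  "kappa = Complex (1 / sqrt 2) (- 1 / sqrt 2)"

lemma kappa_squared: "kappa * kappa = - \<i>"
  by (simp add: kappa_def complex_eq_iff field_simps)

lemma kappa_nonzero: "kappa \<noteq> 0"
  by (simp add: kappa_def complex_eq_iff)

text \<open>\<open>kappa\<close> is the square root exp (-\<i> \<pi> / 4) of -\<i>. Its nonzero real
  part gives exp (kappa L) and exp (-kappa L) different moduli for L > 0, which makes the two
  exponentials on an edge independent.\<close>

lemma Re_kappa_pos: "Re kappa > 0"
  by (simp add: kappa_def)

lemma exp_has_vector_derivative:
  fixes k :: complex
  shows "((\<lambda>x. exp (k * of_real x)) has_vector_derivative k * exp (k * of_real x)) (at x within S)"
  by (rule has_vector_derivative_real_field) (auto intro!: derivative_eq_intros)

text \<open>Factorisation of the operator into first order ones: for each root k of k^2 = -\<i>, the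
  function (f' - k f) exp (k x) is constant. The two constants for k = kappa and k = -kappa form a
  linear system from which f is eliminated.\<close>

lemma H2_homogeneous_solution:
  assumes L: "L > 0" and f: "f \<in> H2_interval L"
    and ode: "AE x in leb L. - weak_deriv L (weak_deriv L f) x - \<i> * f x = 0"
  obtains c d where "\<And>x. x \<in> {0..L} \<Longrightarrow> cont_rep L f x = c * exp (kappa * of_real x) + d * exp (- kappa * of_real x)"
proof -
  note F = H2_intervalD[OF f]
  note C = H1_cont_rep[OF L F(1)] and C' = H1_cont_rep[OF L F(2)]
  let ?u = "cont_rep L f" and ?v = "cont_rep L (weak_deriv L f)"
  have w: "AE x in leb L. weak_deriv L (weak_deriv L f) x = - \<i> * ?u x"
    using ode C(2)
  proof eventually_elim
    case (elim x)
    from elim(1) have "weak_deriv L (weak_deriv L f) x = - (\<i> * f x)"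
      by (metis eq_iff_diff_eq_0 minus_equation_iff)
    with elim(2) show ?case by simp
  qed
  have u: "(?u has_vector_derivative ?v x) (at x within {0..L})" if "x \<in> {0..L}" for x
    by (rule H2_cont_rep_has_derivative[OF L f that])
  \<comment> \<open>The equation shows that the second weak derivative agrees a.e. with a continuous
    function, so the solution is classical.\<close>
  have v: "(?v has_vector_derivative - \<i> * ?u x) (at x within {0..L})" if x: "x \<in> {0..L}" for x
  proof -
    have "continuous_on {0..L} (\<lambda>x. - \<i> * ?u x)" by (intro continuous_intros C(1))
    then have "((\<lambda>y. integral {0..y} (\<lambda>x. - \<i> * ?u x)) has_vector_derivative - \<i> * ?u x) (at x within {0..L})"
      using x by (rule integral_has_vector_derivative)
    then have "((\<lambda>y. ?v 0 + integral {0..y} (\<lambda>x. - \<i> * ?u x)) has_vector_derivative 0 + - \<i> * ?u x) (at x within {0..L})"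
      by (intro has_vector_derivative_add has_vector_derivative_const)
    then have "((\<lambda>y. ?v 0 + integral {0..y} (\<lambda>x. - \<i> * ?u x)) has_vector_derivative - \<i> * ?u x) (at x within {0..L})"
      by simp
    then show ?thesis
    proof (rule has_vector_derivative_transform[OF x, rotated])
      fix y assume y: "y \<in> {0..L}"
      then show "?v y = ?v 0 + integral {0..y} (\<lambda>x. - \<i> * ?u x)"
        using C'(3)[OF y] integral_cong_AE_interval[OF w, of 0 y] by simp
    qed
  qed
  have const: "\<exists>p. \<forall>x\<in>{0..L}. (?v x - k * ?u x) * exp (k * of_real x) = p" if k: "k * k = - \<i>" for k
  proof -
    have "((\<lambda>x. (?v x - k * ?u x) * exp (k * of_real x)) has_vector_derivative 0) (at x within {0..L})"
      if x: "x \<in> {0..L}" for x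
    proof -
      have "((\<lambda>x. ?v x - k * ?u x) has_vector_derivative - \<i> * ?u x - k * ?v x) (at x within {0..L})"
        by (intro has_vector_derivative_diff v[OF x] has_vector_derivative_mult_right u[OF x])
      from has_vector_derivative_mult[OF this exp_has_vector_derivative[of k x]]
      have "((\<lambda>x. (?v x - k * ?u x) * exp (k * of_real x)) has_vector_derivative
        (?v x - k * ?u x) * (k * exp (k * of_real x)) + (- \<i> * ?u x - k * ?v x) * exp (k * of_real x)) (at x within {0..L})" .
      moreover have "(?v x - k * ?u x) * (k * exp (k * of_real x)) + (- \<i> * ?u x - k * ?v x) * exp (k * of_real x)
          = (- \<i> - k * k) * ?u x * exp (k * of_real x)"
        by (simp add: algebra_simps)
      ultimately show ?thesis using k by simp
    qed
    then obtain p where "\<And>x. x \<in> {0..L} \<Longrightarrow> (?v x - k * ?u x) * exp (k * of_real x) = p"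
      by (rule has_vector_derivative_zero_constant[OF convex_real_interval(5)]) (assumption, metis that)
    then show ?thesis by blast
  qed
  obtain p where p: "\<forall>x\<in>{0..L}. (?v x - kappa * ?u x) * exp (kappa * of_real x) = p"
    using const[OF kappa_squared] by blast
  obtain q where q: "\<forall>x\<in>{0..L}. (?v x - (- kappa) * ?u x) * exp (- kappa * of_real x) = q"
    using const[of "- kappa"] kappa_squared by auto
  show thesis
  proof (rule that)
    fix x assume x: "x \<in> {0..L}"
    have e: "exp (kappa * of_real x) * exp (- kappa * of_real x) = 1"
      by (simp add: exp_minus)
    have "?v x - kappa * ?u x = p * exp (- kappa * of_real x)"
      using p x e by (metis mult.assoc mult.right_neutral)
    moreover have "?v x + kappa * ?u x = q * exp (kappa * of_real x)"
      using q x e by (metis (no_types, lifting) diff_minus_eq_add mult.assoc mult.commute mult.right_neutral mult_minus_left)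
    ultimately have "2 * kappa * ?u x = q * exp (kappa * of_real x) - p * exp (- kappa * of_real x)"
      by (simp add: algebra_simps)
    then show "?u x = q / (2 * kappa) * exp (kappa * of_real x) + (- p / (2 * kappa)) * exp (- kappa * of_real x)"
      using kappa_nonzero by (simp add: field_simps)
  qed
qed

section \<open>Power series in finitely many variables\<close>

abbreviation monom_at :: "'i set \<Rightarrow> ('i \<Rightarrow> complex) \<Rightarrow> ('i \<Rightarrow> nat) \<Rightarrow> complex" where
  "monom_at I h \<alpha> \<equiv> \<Prod>c\<in>I. h c ^ \<alpha> c"

abbreviation weight :: "'i set \<Rightarrow> real \<Rightarrow> (('i \<Rightarrow> nat) \<Rightarrow> complex) \<Rightarrow> ('i \<Rightarrow> nat) \<Rightarrow> real" where
  "weight I r a \<alpha> \<equiv> norm (a \<alpha>) * r ^ sum \<alpha> I"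

text \<open>Unordered sums over extensional exponent functions, as in
  \<open>analytic_operator_family\<close>; r is one radius for all coordinates.\<close>

definition power_series_coeffs ::
  "'i set \<Rightarrow> real \<Rightarrow> real \<Rightarrow> (('i \<Rightarrow> complex) \<Rightarrow> complex) \<Rightarrow> (('i \<Rightarrow> nat) \<Rightarrow> complex) \<Rightarrow> bool" where
  "power_series_coeffs I r K F a \<longleftrightarrow>
     weight I r a summable_on (I \<rightarrow>\<^sub>E UNIV) \<and> infsum (weight I r a) (I \<rightarrow>\<^sub>E UNIV) \<le> K \<and>
     (\<forall>h. (\<forall>c\<in>I. norm (h c) < r) \<longrightarrow> ((\<lambda>\<alpha>. a \<alpha> * monom_at I h \<alpha>) has_sum F h) (I \<rightarrow>\<^sub>E UNIV))"

text \<open>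
  \<open>K\<close> bounds a weighted \<open>l\<^sup>1\<close>-norm of the coefficients.  This norm is submultiplicative, which is why
  the geometric series of a power series with \<open>K < 1\<close> can be expanded.
\<close>

definition power_series_on :: "'i set \<Rightarrow> real \<Rightarrow> real \<Rightarrow> (('i \<Rightarrow> complex) \<Rightarrow> complex) \<Rightarrow> bool" where
  "power_series_on I r K F \<longleftrightarrow> (\<exists>a. power_series_coeffs I r K F a)"

lemma power_series_coeffsD:
  assumes "power_series_coeffs I r K F a"
  shows "weight I r a summable_on (I \<rightarrow>\<^sub>E UNIV)" "infsum (weight I r a) (I \<rightarrow>\<^sub>E UNIV) \<le> K"
    "\<And>h. \<forall>c\<in>I. norm (h c) < r \<Longrightarrow> ((\<lambda>\<alpha>. a \<alpha> * monom_at I h \<alpha>) has_sum F h) (I \<rightarrow>\<^sub>E UNIV)"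
  using assms by (auto simp: power_series_coeffs_def)

text \<open>Grouping of an unordered sum by the value of \<pi>: the index set is rewritten as the
  disjoint union of the fibres.\<close>

lemma has_sum_fibers:
  fixes f :: "'p \<Rightarrow> 'a :: {topological_comm_monoid_add, t3_space}"
  assumes "(f has_sum S) P" and "\<pi> ` P \<subseteq> B"
    and "\<And>b. b \<in> B \<Longrightarrow> (f has_sum g b) {p \<in> P. \<pi> p = b}"
  shows "(g has_sum S) B"
proof -
  have bij: "bij_betw snd (SIGMA b:B. {p \<in> P. \<pi> p = b}) P"
    using assms(2) by (intro bij_betwI[where g = "\<lambda>p. (\<pi> p, p)"]) auto
  have "((\<lambda>x. f (snd x)) has_sum S) (SIGMA b:B. {p \<in> P. \<pi> p = b})"
    using assms(1) has_sum_reindex_bij_betw[OF bij] by blast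
  then show ?thesis
    by (rule has_sum_SigmaD) (use assms(3) in auto)
qed

lemma norm_times_monomial_le:
  fixes h :: "'i \<Rightarrow> 'a :: {real_normed_field}"
  assumes "\<forall>c\<in>I. norm (h c) < r"
  shows "norm (u * (\<Prod>c\<in>I. h c ^ \<alpha> c)) \<le> norm u * r ^ sum \<alpha> I"
proof -
  have "(\<Prod>c\<in>I. norm (h c) ^ \<alpha> c) \<le> (\<Prod>c\<in>I. r ^ \<alpha> c)"
    using assms by (intro prod_mono conjI power_mono) (auto intro: less_imp_le)
  then show ?thesis
    by (auto simp: norm_mult power_sum norm_power simp flip: prod_norm intro!: mult_left_mono)
qed

text \<open>The common source of all closure properties. An absolutely summable family of terms A p
  times the monomial with exponent \<pi> p, over any index set P, is a power series whose
  coefficient at \<gamma> sums A over the fibre of \<gamma>. For products P consists of pairs of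
  exponents and \<pi> adds them; for geometric series P consists of pairs (n, \<alpha>) and \<pi>
  forgets n.\<close>

lemma power_series_on_regroup:
  assumes I: "finite I" and r: "r > 0"
    and norms: "((\<lambda>p. norm (A p) * r ^ sum (\<pi> p) I) has_sum K') P" "K' \<le> K"
    and \<pi>: "\<pi> ` P \<subseteq> I \<rightarrow>\<^sub>E UNIV"
    and F: "\<And>h. \<forall>c\<in>I. norm (h c) < r \<Longrightarrow> ((\<lambda>p. A p * (\<Prod>c\<in>I. h c ^ \<pi> p c)) has_sum F h) P"
  shows "power_series_on I r K F"
proof -
  define fib where "fib \<gamma> = {p \<in> P. \<pi> p = \<gamma>}" for \<gamma>
  define a where "a \<gamma> = infsum A (fib \<gamma>)" for \<gamma>
  define b where "b \<gamma> = (\<Sum>\<^sub>\<infinity>p\<in>fib \<gamma>. norm (A p) * r ^ sum (\<pi> p) I)" for \<gamma>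
  have fibsum: "(\<lambda>p. norm (A p) * r ^ sum (\<pi> p) I) summable_on fib \<gamma>" for \<gamma>
    using has_sum_imp_summable[OF norms(1)] by (rule summable_on_subset_banach) (auto simp: fib_def)
  have fibA: "(\<lambda>p. norm (A p)) summable_on fib \<gamma>" for \<gamma>
  proof -
    \<comment> \<open>On a fibre the factor with r is constant and positive, so it can be divided
      out.\<close>
    have "(\<lambda>p. norm (A p) * r ^ sum \<gamma> I) summable_on fib \<gamma>"
      using fibsum[of \<gamma>] by (rule summable_on_cong[THEN iffD1, rotated]) (auto simp: fib_def)
    then show ?thesis
      using r summable_on_cmult_left'[of "r ^ sum \<gamma> I" "\<lambda>p. norm (A p)"] by simp
  qed
  have b: "(b has_sum K') (I \<rightarrow>\<^sub>E UNIV)"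
    by (rule has_sum_fibers[OF norms(1) \<pi>])
       (use fibsum in \<open>auto simp: b_def fib_def[symmetric]\<close>)
  have le: "norm (a \<gamma>) * r ^ sum \<gamma> I \<le> b \<gamma>" for \<gamma>
  proof -
    have "norm (a \<gamma>) \<le> (\<Sum>\<^sub>\<infinity>p\<in>fib \<gamma>. norm (A p))"
      unfolding a_def by (rule norm_infsum_bound[OF fibA])
    then have "norm (a \<gamma>) * r ^ sum \<gamma> I \<le> (\<Sum>\<^sub>\<infinity>p\<in>fib \<gamma>. norm (A p)) * r ^ sum \<gamma> I"
      using r by (intro mult_right_mono) auto
    also have "\<dots> = (\<Sum>\<^sub>\<infinity>p\<in>fib \<gamma>. norm (A p) * r ^ sum \<gamma> I)"
      by (rule infsum_cmult_left'[symmetric])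
    also have "\<dots> = b \<gamma>"
      unfolding b_def by (rule infsum_cong) (auto simp: fib_def)
    finally show ?thesis .
  qed
  have summ: "(\<lambda>\<gamma>. norm (a \<gamma>) * r ^ sum \<gamma> I) summable_on (I \<rightarrow>\<^sub>E UNIV)"
    by (rule summable_on_comparison_test[OF has_sum_imp_summable[OF b]]) (use le r in auto)
  have "(\<Sum>\<^sub>\<infinity>\<gamma>\<in>I \<rightarrow>\<^sub>E UNIV. norm (a \<gamma>) * r ^ sum \<gamma> I) \<le> K'"
    using has_sum_mono[OF has_sum_infsum[OF summ] b] le by blast
  moreover have "((\<lambda>\<gamma>. a \<gamma> * (\<Prod>c\<in>I. h c ^ \<gamma> c)) has_sum F h) (I \<rightarrow>\<^sub>E UNIV)"
    if h: "\<forall>c\<in>I. norm (h c) < r" for h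
  proof (rule has_sum_fibers[OF F[OF h] \<pi>])
    fix \<gamma>
    have "((\<lambda>p. A p * (\<Prod>c\<in>I. h c ^ \<gamma> c)) has_sum a \<gamma> * (\<Prod>c\<in>I. h c ^ \<gamma> c)) (fib \<gamma>)"
      unfolding a_def using abs_summable_summable[OF fibA] by (intro has_sum_cmult_left) auto
    then show "((\<lambda>p. A p * (\<Prod>c\<in>I. h c ^ \<pi> p c)) has_sum a \<gamma> * (\<Prod>c\<in>I. h c ^ \<gamma> c))
        {p \<in> P. \<pi> p = \<gamma>}"
      unfolding fib_def by (rule has_sum_cong[THEN iffD1, rotated]) auto
  qed
  ultimately show ?thesis
    unfolding power_series_on_def power_series_coeffs_def using summ norms(2) by (meson order_trans)
qed

lemma power_series_on_const:
  assumes "finite I" "r > 0"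
  shows "power_series_on I r (norm z) (\<lambda>h. z)"
  by (rule power_series_on_regroup[where P = "{()}" and A = "\<lambda>_. z" and \<pi> = "\<lambda>_. \<lambda>c\<in>I. 0"])
     (use assms in \<open>auto intro!: has_sum_finiteI\<close>)

lemma power_series_on_coord:
  assumes I: "finite I" and r: "r > 0" and c: "c \<in> I"
  shows "power_series_on I r r (\<lambda>h. h c)"
proof (rule power_series_on_regroup[where P = "{()}" and A = "\<lambda>_. 1" and K' = r
      and \<pi> = "\<lambda>_. \<lambda>c'\<in>I. if c' = c then 1 else 0"])
  have "(\<Sum>x\<in>I. if x = c then 1 else 0) = (1::nat)"
    using I c by simp
  then show "((\<lambda>p. norm (1::complex) * r ^ (\<Sum>c'\<in>I. (\<lambda>c'\<in>I. if c' = c then 1 else 0) c')) has_sum r) {()}"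
    by (intro has_sum_finiteI) auto
  fix h :: "'a \<Rightarrow> complex"
  have "(\<Prod>x\<in>I. h x ^ (if x = c then 1 else 0)) = (\<Prod>x\<in>I. if x = c then h c else 1)"
    by (rule prod.cong) auto
  then show "((\<lambda>p. 1 * (\<Prod>c'\<in>I. h c' ^ (\<lambda>c'\<in>I. if c' = c then 1 else 0) c')) has_sum h c) {()}"
    using I c by (intro has_sum_finiteI) auto
qed (use assms in auto)

lemma power_series_on_add:
  assumes "r > 0" "power_series_on I r K F" "power_series_on I r L G"
  shows "power_series_on I r (K + L) (\<lambda>h. F h + G h)"
proof -
  let ?MI = "I \<rightarrow>\<^sub>E (UNIV :: nat set)"
  from assms obtain a b where "power_series_coeffs I r K F a" "power_series_coeffs I r L G b"
    by (auto simp: power_series_on_def)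
  note a = power_series_coeffsD[OF this(1)] and b = power_series_coeffsD[OF this(2)]
  have ab: "(\<lambda>\<alpha>. weight I r a \<alpha> + weight I r b \<alpha>) summable_on ?MI"
    using a(1) b(1) by (rule summable_on_add)
  have le: "norm (a \<alpha> + b \<alpha>) * r ^ sum \<alpha> I \<le> weight I r a \<alpha> + weight I r b \<alpha>" for \<alpha>
    using assms(1) norm_triangle_ineq[of "a \<alpha>" "b \<alpha>"]
    by (simp add: distrib_right[symmetric])
  have s: "(\<lambda>\<alpha>. norm (a \<alpha> + b \<alpha>) * r ^ sum \<alpha> I) summable_on ?MI"
    by (rule summable_on_comparison_test[OF ab]) (use le assms(1) in auto)
  have "(\<Sum>\<^sub>\<infinity>\<alpha>\<in>?MI. norm (a \<alpha> + b \<alpha>) * r ^ sum \<alpha> I)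
      \<le> (\<Sum>\<^sub>\<infinity>\<alpha>\<in>?MI. weight I r a \<alpha> + weight I r b \<alpha>)"
    using le by (intro infsum_mono s ab) auto
  also have "\<dots> \<le> K + L"
    using a b by (simp add: infsum_add)
  finally have "(\<Sum>\<^sub>\<infinity>\<alpha>\<in>?MI. norm (a \<alpha> + b \<alpha>) * r ^ sum \<alpha> I) \<le> K + L" .
  then show ?thesis
    unfolding power_series_on_def power_series_coeffs_def
    using s a(3) b(3)
    by (intro exI[of _ "\<lambda>\<alpha>. a \<alpha> + b \<alpha>"]) (auto simp: distrib_right intro!: has_sum_add)
qed

lemma has_sum_times:
  fixes f g :: "_ \<Rightarrow> 'a :: {real_normed_div_algebra, banach, second_countable_topology}"
  assumes "(\<lambda>a. norm (f a)) summable_on A" "(\<lambda>b. norm (g b)) summable_on B" "(f has_sum x) A" "(g has_sum y) B"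
  shows "((\<lambda>(a, b). f a * g b) has_sum x * y) (A \<times> B)"
proof (rule has_sum_SigmaI)
  show "((\<lambda>b. case (a, b) of (a, b) \<Rightarrow> f a * g b) has_sum f a * y) B" for a
    using has_sum_cmult_right[OF assms(4)] by simp
  show "((\<lambda>a. f a * y) has_sum x * y) A"
    using has_sum_cmult_left[OF assms(3)] .
  have "(\<lambda>p. norm (case p of (a, b) \<Rightarrow> f a * g b)) summable_on A \<times> B"
    unfolding Infinite_Sum.abs_summable_on_Sigma_iff
    using assms(1,2)
    by (auto simp: norm_mult infsum_cmult_right' abs_mult infsum_nonneg
        intro!: summable_on_cmult_right summable_on_cmult_left)
  then show "(\<lambda>(a, b). f a * g b) summable_on A \<times> B"
    by (rule abs_summable_summable)
qed

text \<open>The Cauchy product: the weights of a pair of coefficients multiply because degrees add,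
  so the two weighted sums multiply as well.\<close>

lemma power_series_on_mult:
  assumes I: "finite I" and r: "r > 0" and F: "power_series_on I r K F" and G: "power_series_on I r L G"
  shows "power_series_on I r (K * L) (\<lambda>h. F h * G h)"
proof -
  let ?MI = "I \<rightarrow>\<^sub>E (UNIV :: nat set)"
  from F obtain a where "power_series_coeffs I r K F a" by (auto simp: power_series_on_def)
  note a = power_series_coeffsD[OF this]
  from G obtain b where "power_series_coeffs I r L G b" by (auto simp: power_series_on_def)
  note b = power_series_coeffsD[OF this]
  have K0: "0 \<le> K"
    by (rule order_trans[OF infsum_nonneg a(2)]) (use r in auto)
  have abs: "(\<lambda>\<alpha>. norm (u \<alpha> * monom_at I h \<alpha>)) summable_on ?MI"
    if "weight I r u summable_on ?MI" "\<forall>c\<in>I. norm (h c) < r"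
    for u h :: "_ \<Rightarrow> complex"
    using norm_times_monomial_le[OF that(2)] by (intro summable_on_comparison_test[OF that(1)]) auto
  show ?thesis
  proof (rule power_series_on_regroup[where P = "?MI \<times> ?MI" and A = "\<lambda>(\<alpha>, \<beta>). a \<alpha> * b \<beta>"
        and \<pi> = "\<lambda>(\<alpha>, \<beta>). \<lambda>c\<in>I. \<alpha> c + \<beta> c"])
    have "((\<lambda>(\<alpha>, \<beta>). (weight I r a \<alpha>) * (norm (b \<beta>) * r ^ sum \<beta> I))
        has_sum (\<Sum>\<^sub>\<infinity>\<alpha>\<in>?MI. weight I r a \<alpha>) * (\<Sum>\<^sub>\<infinity>\<alpha>\<in>?MI. weight I r b \<alpha>)) (?MI \<times> ?MI)"
      using a(1) b(1) r by (intro has_sum_times) auto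
    then show "((\<lambda>p. norm (case p of (\<alpha>, \<beta>) \<Rightarrow> a \<alpha> * b \<beta>) *
          r ^ sum (case p of (\<alpha>, \<beta>) \<Rightarrow> \<lambda>c\<in>I. \<alpha> c + \<beta> c) I)
        has_sum (\<Sum>\<^sub>\<infinity>\<alpha>\<in>?MI. weight I r a \<alpha>) * (\<Sum>\<^sub>\<infinity>\<alpha>\<in>?MI. weight I r b \<alpha>)) (?MI \<times> ?MI)"
      by (rule has_sum_cong[THEN iffD1, rotated])
         (auto simp: norm_mult sum.distrib power_add)
    show "(\<Sum>\<^sub>\<infinity>\<alpha>\<in>?MI. weight I r a \<alpha>) * (\<Sum>\<^sub>\<infinity>\<alpha>\<in>?MI. weight I r b \<alpha>) \<le> K * L"
      using a(2) b(2) r K0 by (intro mult_mono infsum_nonneg) auto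
    fix h assume h: "\<forall>c\<in>I. norm (h c :: complex) < r"
    have "((\<lambda>(\<alpha>, \<beta>). (a \<alpha> * monom_at I h \<alpha>) * (b \<beta> * (\<Prod>c\<in>I. h c ^ \<beta> c))) has_sum F h * G h) (?MI \<times> ?MI)"
      using abs[OF a(1) h] abs[OF b(1) h] a(3)[OF h] b(3)[OF h] by (intro has_sum_times)
    then show "((\<lambda>p. (case p of (\<alpha>, \<beta>) \<Rightarrow> a \<alpha> * b \<beta>) *
        (\<Prod>c\<in>I. h c ^ (case p of (\<alpha>, \<beta>) \<Rightarrow> \<lambda>c\<in>I. \<alpha> c + \<beta> c) c)) has_sum F h * G h) (?MI \<times> ?MI)"
      by (rule has_sum_cong[THEN iffD1, rotated])
         (auto simp: prod.distrib power_add)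
  qed (use I r in auto)
qed

lemma power_series_on_power:
  assumes "finite I" "r > 0" "power_series_on I r K F"
  shows "power_series_on I r (K ^ n) (\<lambda>h. F h ^ n)"
proof (induction n)
  case 0
  show ?case using power_series_on_const[OF assms(1,2), of 1] by simp
next
  case (Suc n)
  show ?case using power_series_on_mult[OF assms Suc] by simp
qed

text \<open>The n-th power has weight at most K^n, so the double family over powers and exponents is
  absolutely summable with total at most 1 / (1 - K) and can be regrouped. Moreover |F h| <= K < 1,
  which excludes the value 1 and makes the scalar geometric series converge.\<close>

lemma power_series_on_geometric:
  assumes I: "finite I" and r: "r > 0" and F: "power_series_on I r K F" and K: "K < 1"
  shows "power_series_on I r (1 / (1 - K)) (\<lambda>h. 1 / (1 - F h))"
    and "\<And>h. \<forall>c\<in>I. norm (h c) < r \<Longrightarrow> F h \<noteq> 1"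
proof -
  let ?MI = "I \<rightarrow>\<^sub>E (UNIV :: nat set)"
  have "\<exists>a. \<forall>n. power_series_coeffs I r (K ^ n) (\<lambda>h. F h ^ n) (a n)"
    by (rule choice) (use power_series_on_power[OF I r F] in \<open>simp add: power_series_on_def\<close>)
  then obtain a where "\<And>n. power_series_coeffs I r (K ^ n) (\<lambda>h. F h ^ n) (a n)" by blast
  note a = power_series_coeffsD[OF this]
  have K0: "0 \<le> K"
    using a(2)[of 1] infsum_nonneg[of ?MI "\<lambda>\<alpha>. weight I r (a 1) \<alpha>"] r by auto
  define k where "k n = (\<Sum>\<^sub>\<infinity>\<alpha>\<in>?MI. weight I r (a n) \<alpha>)" for n
  have k0: "0 \<le> k n" for n
    unfolding k_def by (rule infsum_nonneg) (use r in auto)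
  have geo: "((\<lambda>n. K ^ n) has_sum 1 / (1 - K)) UNIV"
    using K K0 by (intro sums_nonneg_imp_has_sum) (auto intro: geometric_sums)
  have ksum: "k summable_on UNIV"
    by (rule summable_on_comparison_test[OF has_sum_imp_summable[OF geo]])
       (use a(2) k0 in \<open>auto simp: k_def\<close>)
  have kle: "infsum k UNIV \<le> 1 / (1 - K)"
    using has_sum_mono[OF has_sum_infsum[OF ksum] geo] a(2) unfolding k_def by blast
  have nsum: "(\<lambda>(n, \<alpha>). weight I r (a n) \<alpha>) summable_on UNIV \<times> ?MI"
    by (rule summable_on_SigmaI[where g = k]) (use a(1) r ksum in \<open>auto simp: k_def\<close>)
  have nhs: "((\<lambda>(n, \<alpha>). weight I r (a n) \<alpha>) has_sum infsum k UNIV) (UNIV \<times> ?MI)"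
    by (rule has_sum_SigmaI[where g = k]) (use a(1) ksum nsum in \<open>auto simp: k_def\<close>)
  have Fn: "norm (F h) \<le> K" if h: "\<forall>c\<in>I. norm (h c) < r" for h
  proof -
    \<comment> \<open>The exponent 1 selects the member n = 1 of the chosen coefficient families,
      whose weight is at most K.\<close>
    have "norm (F h ^ 1) \<le> (\<Sum>\<^sub>\<infinity>\<alpha>\<in>?MI. weight I r (a 1) \<alpha>)"
    proof -
      have sm: "(\<lambda>\<alpha>. norm (a 1 \<alpha> * monom_at I h \<alpha>)) summable_on ?MI"
        using norm_times_monomial_le[OF h] by (intro summable_on_comparison_test[OF a(1)[of 1]]) auto
      have "norm (F h ^ 1) \<le> (\<Sum>\<^sub>\<infinity>\<alpha>\<in>?MI. norm (a 1 \<alpha> * monom_at I h \<alpha>))"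
        by (rule norm_has_sum_bound[OF has_sum_infsum[OF sm] a(3)[OF h]])
      also have "\<dots> \<le> (\<Sum>\<^sub>\<infinity>\<alpha>\<in>?MI. weight I r (a 1) \<alpha>)"
        using norm_times_monomial_le[OF h] by (intro infsum_mono sm a(1))
      finally show ?thesis .
    qed
    with a(2)[of 1] show ?thesis by simp
  qed
  show "F h \<noteq> 1" if "\<forall>c\<in>I. norm (h c) < r" for h
    using Fn[OF that] K by auto
  show "power_series_on I r (1 / (1 - K)) (\<lambda>h. 1 / (1 - F h))"
  proof (rule power_series_on_regroup[where P = "UNIV \<times> ?MI" and A = "\<lambda>(n, \<alpha>). a n \<alpha>"
        and \<pi> = snd and K' = "infsum k UNIV"])
    show "((\<lambda>p. norm (case p of (n, \<alpha>) \<Rightarrow> a n \<alpha>) * r ^ sum (snd p) I) has_sum infsum k UNIV) (UNIV \<times> ?MI)"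
      using nhs by (simp add: case_prod_unfold)
    fix h assume h: "\<forall>c\<in>I. norm (h c :: complex) < r"
    show "((\<lambda>p. (case p of (n, \<alpha>) \<Rightarrow> a n \<alpha>) * (\<Prod>c\<in>I. h c ^ snd p c)) has_sum 1 / (1 - F h)) (UNIV \<times> ?MI)"
    proof (rule has_sum_SigmaI[where g = "\<lambda>n. F h ^ n"])
      show "((\<lambda>n. F h ^ n) has_sum 1 / (1 - F h)) UNIV"
        using Fn[OF h] K
        by (intro norm_summable_imp_has_sum)
           (auto simp: norm_power intro!: geometric_sums summable_geometric)
      show "(\<lambda>p. (case p of (n, \<alpha>) \<Rightarrow> a n \<alpha>) * (\<Prod>c\<in>I. h c ^ snd p c)) summable_on UNIV \<times> ?MI"
      proof (rule abs_summable_summable, rule summable_on_comparison_test[OF nsum])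
        fix p :: "nat \<times> ('a \<Rightarrow> nat)"
        obtain n \<alpha> where p: "p = (n, \<alpha>)" by (cases p)
        show "norm ((case p of (n, \<alpha>) \<Rightarrow> a n \<alpha>) * (\<Prod>c\<in>I. h c ^ snd p c))
            \<le> (case p of (n, \<alpha>) \<Rightarrow> weight I r (a n) \<alpha>)"
          unfolding p prod.case snd_conv by (rule norm_times_monomial_le[OF h])
      qed (rule norm_ge_zero)
    qed (use a(3)[OF h] in auto)
  qed (use I r kle in auto)
qed

lemma power_series_on_mono:
  assumes F: "power_series_on I r K F" and s: "0 < s" "s \<le> r"
  shows "power_series_on I s K F"
proof -
  let ?MI = "I \<rightarrow>\<^sub>E (UNIV :: nat set)"
  from F obtain a where "power_series_coeffs I r K F a" by (auto simp: power_series_on_def)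
  note a = power_series_coeffsD[OF this]
  have le: "weight I s a \<alpha> \<le> weight I r a \<alpha>" for \<alpha>
    using s by (intro mult_left_mono power_mono) auto
  have sm: "(\<lambda>\<alpha>. weight I s a \<alpha>) summable_on ?MI"
    by (rule summable_on_comparison_test[OF a(1)]) (use le s in auto)
  have "(\<Sum>\<^sub>\<infinity>\<alpha>\<in>?MI. weight I s a \<alpha>) \<le> K"
    by (rule order_trans[OF infsum_mono[OF sm a(1)] a(2)]) (use le in auto)
  moreover have "\<forall>c\<in>I. norm (h c) < r" if "\<forall>c\<in>I. norm (h c) < s" for h :: "_ \<Rightarrow> complex"
    using s that by force
  ultimately show ?thesis
    unfolding power_series_on_def power_series_coeffs_def using sm a(3) by blast
qed

text \<open>Without a constant term all monomials have degree at least 1, so scaling the radius by t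
  <= 1 gains a factor t in the weighted norm.\<close>

lemma power_series_on_shrink:
  assumes I: "finite I" and r: "r > 0" and F: "power_series_on I r K F" and F0: "F (\<lambda>_. 0) = 0"
    and e: "e > 0"
  obtains s where "0 < s" "s \<le> r" "power_series_on I s e F"
proof -
  let ?MI = "I \<rightarrow>\<^sub>E (UNIV :: nat set)"
  let ?z = "\<lambda>c\<in>I. 0 :: nat"
  from F obtain a where "power_series_coeffs I r K F a" by (auto simp: power_series_on_def)
  note a = power_series_coeffsD[OF this]
  have K0: "0 \<le> K"
    by (rule order_trans[OF infsum_nonneg a(2)]) (use r in auto)
  have nz: "\<exists>c\<in>I. \<alpha> c \<noteq> 0" if "\<alpha> \<in> ?MI" "\<alpha> \<noteq> ?z" for \<alpha>
  proof (rule ccontr)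
    assume "\<not> ?thesis"
    then have "\<alpha> = ?z" using that(1) by (intro PiE_ext[of \<alpha> I "\<lambda>_. UNIV" ?z]) auto
    with that(2) show False by simp
  qed
  \<comment> \<open>At h = 0 only the constant monomial survives, by 0 ^ 0 = 1.\<close>
  have a0: "a ?z = 0"
  proof -
    have "((\<lambda>\<alpha>. a \<alpha> * (\<Prod>c\<in>I. (\<lambda>_. 0) c ^ \<alpha> c)) has_sum a ?z) ?MI"
    proof (rule has_sum_finite_neutralI[where B = "{?z}"])
      fix \<alpha> assume "\<alpha> \<in> ?MI - {?z}"
      with nz obtain c where "c \<in> I" "\<alpha> c \<noteq> 0" by blast
      then have "(\<Prod>c\<in>I. (0::complex) ^ \<alpha> c) = 0"
        using I by (auto simp: prod_zero_iff)
      then show "a \<alpha> * (\<Prod>c\<in>I. 0 ^ \<alpha> c) = 0" by simp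
    qed auto
    moreover have "((\<lambda>\<alpha>. a \<alpha> * (\<Prod>c\<in>I. (\<lambda>_. 0) c ^ \<alpha> c)) has_sum F (\<lambda>_. 0)) ?MI"
      by (rule a(3)) (use r in auto)
    ultimately have "a ?z = F (\<lambda>_. 0)" by (rule has_sum_unique)
    then show ?thesis using F0 by simp
  qed
  \<comment> \<open>Adding 1 to K keeps the denominator positive when K = 0.\<close>
  define t where "t = min 1 (e / (K + 1))"
  have t: "0 < t" "t \<le> 1" "t * K \<le> e"
  proof -
    show "0 < t" "t \<le> 1" using K0 e by (auto simp: t_def)
    have "t * K \<le> (e / (K + 1)) * K" using K0 by (intro mult_right_mono) (auto simp: t_def)
    also have "\<dots> \<le> e" using K0 e by (simp add: field_simps)
    finally show "t * K \<le> e" .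
  qed
  have le: "weight I (t * r) a \<alpha> \<le> t * (weight I r a \<alpha>)" if "\<alpha> \<in> ?MI" for \<alpha>
  proof (cases "\<alpha> = ?z")
    case False
    with nz[OF that] obtain c where c: "c \<in> I" "\<alpha> c \<noteq> 0" by blast
    then have "sum \<alpha> I \<noteq> 0" using I by auto
    then have "t ^ sum \<alpha> I \<le> t ^ 1" using t by (intro power_decreasing) auto
    then have "t ^ sum \<alpha> I * (weight I r a \<alpha>) \<le> t * (weight I r a \<alpha>)"
      using r by (intro mult_right_mono) auto
    then show ?thesis by (simp add: power_mult_distrib mult_ac)
  qed (use a0 in simp)
  have ts: "(\<lambda>\<alpha>. t * (weight I r a \<alpha>)) summable_on ?MI"
    using a(1) by (rule summable_on_cmult_right)
  have sm: "(\<lambda>\<alpha>. weight I (t * r) a \<alpha>) summable_on ?MI"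
    by (rule summable_on_comparison_test[OF ts]) (use le t r in auto)
  have "(\<Sum>\<^sub>\<infinity>\<alpha>\<in>?MI. weight I (t * r) a \<alpha>) \<le> (\<Sum>\<^sub>\<infinity>\<alpha>\<in>?MI. t * (weight I r a \<alpha>))"
    using le by (intro infsum_mono sm ts) auto
  also have "\<dots> = t * (\<Sum>\<^sub>\<infinity>\<alpha>\<in>?MI. weight I r a \<alpha>)"
    by (rule infsum_cmult_right')
  also have "\<dots> \<le> t * K" using a(2) t by (intro mult_left_mono) auto
  also have "\<dots> \<le> e" by (rule t)
  finally have *: "(\<Sum>\<^sub>\<infinity>\<alpha>\<in>?MI. weight I (t * r) a \<alpha>) \<le> e" .
  have tr: "t * r \<le> r" using t r by simp
  then have "\<forall>c\<in>I. norm (h c) < r" if "\<forall>c\<in>I. norm (h c) < t * r" for h :: "_ \<Rightarrow> complex"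
    using that by force
  then have "power_series_on I (t * r) e F"
    unfolding power_series_on_def power_series_coeffs_def using * sm a(3) by blast
  then show thesis
    using t r tr by (intro that[of "t * r"]) auto
qed

section \<open>Analytic functions near the origin, with unspecified radius\<close>

definition analytic_at_0 :: "'i set \<Rightarrow> (('i \<Rightarrow> complex) \<Rightarrow> complex) \<Rightarrow> bool" where
  "analytic_at_0 I F \<longleftrightarrow> (\<exists>r>0. \<exists>K. power_series_on I r K F)"

lemma analytic_at_0I: "r > 0 \<Longrightarrow> power_series_on I r K F \<Longrightarrow> analytic_at_0 I F"
  unfolding analytic_at_0_def by blast

lemma analytic_at_0_const: "finite I \<Longrightarrow> analytic_at_0 I (\<lambda>h. z)"
  using power_series_on_const[of I 1] by (metis analytic_at_0I zero_less_one_class.zero_less_one)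

lemma analytic_at_0_coord: "finite I \<Longrightarrow> c \<in> I \<Longrightarrow> analytic_at_0 I (\<lambda>h. h c)"
  using power_series_on_coord[of I 1] by (metis analytic_at_0I zero_less_one_class.zero_less_one)

lemma analytic_at_0_common_radius:
  assumes "analytic_at_0 I F" "analytic_at_0 I G"
  obtains r K L where "r > 0" "power_series_on I r K F" "power_series_on I r L G"
proof -
  from assms obtain r K s L where *: "r > 0" "power_series_on I r K F" "s > 0" "power_series_on I s L G"
    unfolding analytic_at_0_def by blast
  show thesis
    by (rule that[of "min r s" K L])
       (use * power_series_on_mono[of I r K F "min r s"] power_series_on_mono[of I s L G "min r s"] in auto)
qed

lemma analytic_at_0_add:
  assumes "analytic_at_0 I F" "analytic_at_0 I G"
  shows "analytic_at_0 I (\<lambda>h. F h + G h)"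
proof -
  from assms obtain r K L where "r > 0" "power_series_on I r K F" "power_series_on I r L G"
    by (rule analytic_at_0_common_radius)
  then show ?thesis
    by (metis analytic_at_0I power_series_on_add)
qed

lemma analytic_at_0_mult:
  assumes "finite I" "analytic_at_0 I F" "analytic_at_0 I G"
  shows "analytic_at_0 I (\<lambda>h. F h * G h)"
proof -
  from assms(2,3) obtain r K L where "r > 0" "power_series_on I r K F" "power_series_on I r L G"
    by (rule analytic_at_0_common_radius)
  then show ?thesis
    by (metis analytic_at_0I power_series_on_mult[OF assms(1)])
qed

lemma analytic_at_0_sum:
  assumes "finite I" "\<And>x. x \<in> X \<Longrightarrow> analytic_at_0 I (F x)"
  shows "analytic_at_0 I (\<lambda>h. \<Sum>x\<in>X. F x h)"
  using assms(2)
  by (induction X rule: infinite_finite_induct)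
     (simp_all add: analytic_at_0_const analytic_at_0_add assms(1))

lemma analytic_at_0_prod:
  assumes "finite I" "\<And>x. x \<in> X \<Longrightarrow> analytic_at_0 I (F x)"
  shows "analytic_at_0 I (\<lambda>h. \<Prod>x\<in>X. F x h)"
  using assms(2)
  by (induction X rule: infinite_finite_induct)
     (simp_all add: analytic_at_0_const analytic_at_0_mult assms(1))

text \<open>With d the value of F at 0, write F = d (1 - g), where g = 1 - F / d vanishes at 0. The
  radius is shrunk until g has weight 1/2, and then 1 / (1 - g) is a geometric series.\<close>

lemma analytic_at_0_inverse:
  assumes I: "finite I" and F: "analytic_at_0 I F" and F0: "F (\<lambda>_. 0) \<noteq> 0"
  shows "analytic_at_0 I (\<lambda>h. 1 / F h)"
    and "\<exists>r>0. \<forall>h. (\<forall>c\<in>I. norm (h c) < r) \<longrightarrow> F h \<noteq> 0"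
proof -
  let ?d = "F (\<lambda>_. 0)"
  have "analytic_at_0 I (\<lambda>h. 1 + (- 1 / ?d) * F h)"
    by (intro analytic_at_0_add analytic_at_0_mult analytic_at_0_const I F)
  then obtain r K where r: "r > 0" "power_series_on I r K (\<lambda>h. 1 + (- 1 / ?d) * F h)"
    unfolding analytic_at_0_def by blast
  then obtain s where s: "s > 0" "power_series_on I s (1/2) (\<lambda>h. 1 + (- 1 / ?d) * F h)"
    by (rule power_series_on_shrink[OF I, where e = "1/2"]) (use F0 in auto)
  note g = power_series_on_geometric[OF I s]
  have "analytic_at_0 I (\<lambda>h. 1 / (1 - (1 + (- 1 / ?d) * F h)))"
    using s(1) g(1) by (rule analytic_at_0I) simp
  then have "analytic_at_0 I (\<lambda>h. (1 / ?d) * (1 / (1 - (1 + (- 1 / ?d) * F h))))"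
    by (intro analytic_at_0_mult analytic_at_0_const I)
  also have "(\<lambda>h. (1 / ?d) * (1 / (1 - (1 + (- 1 / ?d) * F h)))) = (\<lambda>h. 1 / F h)"
    using F0 by (auto simp: fun_eq_iff divide_simps)
  finally show "analytic_at_0 I (\<lambda>h. 1 / F h)" .
  show "\<exists>r>0. \<forall>h. (\<forall>c\<in>I. norm (h c) < r) \<longrightarrow> F h \<noteq> 0"
    using s(1) g(2) by force
qed

lemma analytic_at_0_det:
  assumes I: "finite I" and M: "\<And>h. M h \<in> carrier_mat n n"
    and an: "\<And>i j. i < n \<Longrightarrow> j < n \<Longrightarrow> analytic_at_0 I (\<lambda>h. M h $$ (i, j))"
  shows "analytic_at_0 I (\<lambda>h. Determinant.det (M h))"
proof -
  have "analytic_at_0 I (\<lambda>h. \<Sum>p\<in>{p. p permutes {0..<n}}. signof p * (\<Prod>i = 0..<n. M h $$ (i, p i)))"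
    using permutes_in_image
    by (intro analytic_at_0_sum analytic_at_0_mult analytic_at_0_prod analytic_at_0_const I an) force+
  then show ?thesis
    by (simp add: det_def'[OF M])
qed

lemma analytic_at_0_adj_mat:
  assumes I: "finite I" and M: "\<And>h. M h \<in> carrier_mat n n"
    and an: "\<And>i j. i < n \<Longrightarrow> j < n \<Longrightarrow> analytic_at_0 I (\<lambda>h. M h $$ (i, j))"
    and ij: "i < n" "j < n"
  shows "analytic_at_0 I (\<lambda>h. adj_mat (M h) $$ (i, j))"
proof -
  have dim: "dim_row (M h) = n" "dim_col (M h) = n" for h
    using M[of h] by auto
  \<comment> \<open>Deleting a row and a column only shifts later indices, so the entries of a minor
    are again entries of M h.\<close>
  have entry: "mat_delete (M h) j i $$ (k, l) =
      M h $$ (if k < j then k else Suc k, if l < i then l else Suc l)"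
    if "k < n - 1" "l < n - 1" for h k l
    unfolding mat_delete_def dim using that by simp
  have "analytic_at_0 I (\<lambda>h. Determinant.det (mat_delete (M h) j i))"
  proof (rule analytic_at_0_det[OF I, where n = "n - 1"])
    show "mat_delete (M h) j i \<in> carrier_mat (n - 1) (n - 1)" for h
      unfolding mat_delete_def dim by simp
    show "analytic_at_0 I (\<lambda>h. mat_delete (M h) j i $$ (k, l))" if "k < n - 1" "l < n - 1" for k l
      unfolding entry[OF that] by (rule an) (use that in auto)
  qed
  then have "analytic_at_0 I (\<lambda>h. (- 1) ^ (j + i) * Determinant.det (mat_delete (M h) j i))"
    by (intro analytic_at_0_mult analytic_at_0_const I)
  then show ?thesis
    using ij by (simp add: adj_mat_def dim cofactor_def)
qed

section \<open>Function spaces on a metric graph\<close>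

lemma H2_rep_zero:
  assumes L: "L > 0"
  shows "H2_rep L (\<lambda>x. 0) (\<lambda>x. 0) (\<lambda>x. 0) (\<lambda>x. 0) (\<lambda>x. 0)"
proof -
  have z: "(\<lambda>x. 0) \<in> L2_interval L" by (rule L2_interval_continuous) simp
  have wd: "is_weak_derivative L (\<lambda>x. 0) (\<lambda>x. 0)" by (simp add: is_weak_derivative_def)
  have "cont_rep L (\<lambda>x. 0) x = 0" if "x \<in> {0..L}" for x
    by (rule cont_rep_eq[OF L _ _ that]) auto
  with H2_intervalI[OF L z wd z wd z] show ?thesis by (simp add: H2_rep_def)
qed

lemma L2_interval_sum:
  assumes "\<And>m. m \<in> I \<Longrightarrow> f m \<in> L2_interval L"
  shows "(\<lambda>x. \<Sum>m\<in>I. c m * f m x) \<in> L2_interval L"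
  using assms
proof (induction I rule: infinite_finite_induct)
  case (insert m I)
  then have "(\<lambda>x. c m * f m x + 1 * (\<Sum>m\<in>I. c m * f m x)) \<in> L2_interval L"
    by (intro L2_interval_linear) auto
  then show ?case using insert by simp
qed (auto intro: L2_interval_continuous)

lemma H2_rep_sum:
  assumes L: "L > 0" and I: "finite I" and f: "\<And>m. m \<in> I \<Longrightarrow> f m \<in> H2_interval L"
  shows "H2_rep L (\<lambda>x. \<Sum>m\<in>I. c m * f m x) (\<lambda>x. \<Sum>m\<in>I. c m * weak_deriv L (f m) x)
    (\<lambda>x. \<Sum>m\<in>I. c m * weak_deriv L (weak_deriv L (f m)) x)
    (\<lambda>x. \<Sum>m\<in>I. c m * cont_rep L (f m) x) (\<lambda>x. \<Sum>m\<in>I. c m * cont_rep L (weak_deriv L (f m)) x)"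
  using I f
proof (induction I)
  case empty
  show ?case using H2_rep_zero[OF L] by simp
next
  case (insert m I)
  then have "f m \<in> H2_interval L" by simp
  from H2_rep_linear[OF L H2_rep_self[OF this] insert.IH[OF insert.prems[OF insertI2]], of "c m" 1]
  show ?case using insert.hyps by simp
qed

lemma H2_interval_exp:
  assumes L: "L > 0"
  shows "(\<lambda>x. exp (k * of_real x)) \<in> H2_interval L"
    "AE x in leb L. weak_deriv L (weak_deriv L (\<lambda>x. exp (k * of_real x))) x = k * k * exp (k * of_real x)"
proof -
  have c: "continuous_on {0..L} (\<lambda>x. j * exp (k * of_real x))" for j
    by (intro continuous_intros)
  have m: "(\<lambda>x. j * exp (k * of_real x)) \<in> L2_interval L" for j
    by (rule L2_interval_continuous[OF c])
  \<comment> \<open>The factor j lets one computation serve for the exponential (j = 1) and for its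
    derivative (j = k).\<close>
  have wd: "is_weak_derivative L (\<lambda>x. j * exp (k * of_real x)) (\<lambda>x. j * k * exp (k * of_real x))" for j
  proof (rule is_weak_derivative_classical[OF L _ c])
    show "((\<lambda>x. j * exp (k * of_real x)) has_vector_derivative j * k * exp (k * of_real x)) (at x within {0..L})" for x
      using has_vector_derivative_mult_right[OF exp_has_vector_derivative[of k x "{0..L}"], of j] by (simp add: mult.assoc)
  qed
  note I = H2_intervalI[OF L, of "\<lambda>x. exp (k * of_real x)" "\<lambda>x. k * exp (k * of_real x)" "\<lambda>x. k * k * exp (k * of_real x)"]
  show "(\<lambda>x. exp (k * of_real x)) \<in> H2_interval L"
    "AE x in leb L. weak_deriv L (weak_deriv L (\<lambda>x. exp (k * of_real x))) x = k * k * exp (k * of_real x)"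
    using I(1,3) m[of 1] wd[of 1] m[of k] wd[of k] m[of "k * k"] by simp_all
qed

locale metric_graph_context =
  fixes G :: "('v, 'e) metric_graph"
  assumes compact: "compact_metric_graph G"
begin

abbreviation len :: "'e \<Rightarrow> real" where
  "len \<equiv> edge_length G"

lemma fin: "fin_digraph (graph_of G)"
  using compact by (simp add: compact_metric_graph_def)

lemma finite_edges [simp]: "finite (edges G)"
  using fin by (simp add: fin_digraph.finite_arcs)

lemma finite_vertices [simp]: "finite (vertices G)"
  using fin by (simp add: fin_digraph.finite_verts)

lemma length_pos: "e \<in> edges G \<Longrightarrow> len e > 0"
  using compact by (simp add: compact_metric_graph_def)

lemma ends_at:
  assumes "v \<in> vertices G"
  shows "distinct (ends_at G v)" "set (ends_at G v) = edge_ends G v" "length (ends_at G v) = deg G v"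
proof -
  show *: "distinct (ends_at G v)" "set (ends_at G v) = edge_ends G v"
    using compact assms by (auto simp: compact_metric_graph_def)
  show "length (ends_at G v) = deg G v"
    using distinct_card[OF *(1)] *(2) by (simp add: deg_def)
qed

lemma ends_at_edge:
  assumes "v \<in> vertices G" "i < deg G v"
  shows "fst (ends_at G v ! i) \<in> edges G"
proof -
  have "ends_at G v ! i \<in> edge_ends G v"
    using ends_at[OF assms(1)] assms(2) nth_mem by metis
  then show ?thesis by (auto simp: edge_ends_def)
qed

lemma L2_eqI:
  "(\<And>e. e \<in> edges G \<Longrightarrow> AE x in leb (len e). f e x = g e x) \<Longrightarrow> L2_eq G f g"
  by (simp add: L2_eq_def)

lemma L2_eqD:
  "L2_eq G f g \<Longrightarrow> e \<in> edges G \<Longrightarrow> AE x in leb (len e). f e x = g e x"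
  by (simp add: L2_eq_def)

lemma L2_eq_refl [simp]: "L2_eq G f f"
  by (simp add: L2_eq_def)

lemma L2_eq_sym: "L2_eq G f g \<Longrightarrow> L2_eq G g f"
  by (auto simp: L2_eq_def intro: AE_interval_sym)

lemma L2_eq_trans: "L2_eq G f g \<Longrightarrow> L2_eq G g h \<Longrightarrow> L2_eq G f h"
  by (auto simp: L2_eq_def intro: AE_interval_trans)

lemma L2_eq_sum:
  assumes "finite I" "\<And>m. m \<in> I \<Longrightarrow> L2_eq G (f m) (g m)"
  shows "L2_eq G (\<lambda>e x. \<Sum>m\<in>I. c m * f m e x) (\<lambda>e x. \<Sum>m\<in>I. c m * g m e x)"
proof (rule L2_eqI)
  fix e assume "e \<in> edges G"
  then have "AE x in leb (len e). \<forall>m\<in>I. f m e x = g m e x"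
    using assms by (intro AE_finite_allI) (auto intro: L2_eqD)
  then show "AE x in leb (len e). (\<Sum>m\<in>I. c m * f m e x) = (\<Sum>m\<in>I. c m * g m e x)"
    by eventually_elim simp
qed

lemma L2_eq_linear:
  assumes "L2_eq G f f'" "L2_eq G g g'"
  shows "L2_eq G (\<lambda>e x. a * f e x + b * g e x) (\<lambda>e x. a * f' e x + b * g' e x)"
proof (rule L2_eqI)
  fix e assume e: "e \<in> edges G"
  show "AE x in leb (len e). a * f e x + b * g e x = a * f' e x + b * g' e x"
    using L2_eqD[OF assms(1) e] L2_eqD[OF assms(2) e] by eventually_elim simp
qed

lemma L2_sum: "(\<And>m. m \<in> I \<Longrightarrow> f m \<in> L2 G) \<Longrightarrow> (\<lambda>e x. \<Sum>m\<in>I. c m * f m e x) \<in> L2 G"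
  by (auto simp: L2_def intro: L2_interval_sum)

lemma L2_linear: "f \<in> L2 G \<Longrightarrow> g \<in> L2 G \<Longrightarrow> (\<lambda>e x. a * f e x + b * g e x) \<in> L2 G"
  by (auto simp: L2_def intro: L2_interval_linear)

lemma L2_zero: "(\<lambda>e x. 0) \<in> L2 G"
  using L2_sum[of "{}"] by simp

lemma L2_norm_squared:
  "(L2_norm G f)\<^sup>2 = (\<Sum>e\<in>edges G. LINT x|leb (len e). (cmod (f e x))\<^sup>2)"
  unfolding L2_norm_def by (rule real_sqrt_pow2) (auto intro!: sum_nonneg integral_nonneg_AE)

lemma L2_norm_nonneg [simp]: "0 \<le> L2_norm G f"
  unfolding L2_norm_def by (auto intro!: sum_nonneg integral_nonneg_AE)

lemma L2_norm_cong:
  assumes "L2_eq G f g" "f \<in> L2 G" "g \<in> L2 G"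
  shows "L2_norm G f = L2_norm G g"
proof -
  have "(LINT x|leb (len e). (cmod (f e x))\<^sup>2) =
      (LINT x|leb (len e). (cmod (g e x))\<^sup>2)" if e: "e \<in> edges G" for e
  proof (rule integral_cong_AE)
    show "(\<lambda>x. (cmod (f e x))\<^sup>2) \<in> borel_measurable (leb (len e))"
      "(\<lambda>x. (cmod (g e x))\<^sup>2) \<in> borel_measurable (leb (len e))"
      using assms(2,3) e by (auto simp: L2_def dest!: bspec L2_intervalD(2) intro: borel_measurable_integrable)
    show "AE x in leb (len e). (cmod (f e x))\<^sup>2 = (cmod (g e x))\<^sup>2"
      using L2_eqD[OF assms(1) e] by eventually_elim simp
  qed
  then show ?thesis unfolding L2_norm_def by simp
qed

lemma L2_norm_zero_iff:
  assumes f: "f \<in> L2 G"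
  shows "L2_norm G f = 0 \<longleftrightarrow> L2_eq G f (\<lambda>e x. 0)"
proof
  assume "L2_norm G f = 0"
  then have "(\<Sum>e\<in>edges G. LINT x|leb (len e). (cmod (f e x))\<^sup>2) = 0"
    using L2_norm_squared[of f] by simp
  then have z: "(LINT x|leb (len e). (cmod (f e x))\<^sup>2) = 0" if "e \<in> edges G" for e
    using that by (subst (asm) sum_nonneg_eq_0_iff) (auto intro: integral_nonneg_AE)
  show "L2_eq G f (\<lambda>e x. 0)"
  proof (rule L2_eqI)
    fix e assume e: "e \<in> edges G"
    have "integrable (leb (len e)) (\<lambda>x. (cmod (f e x))\<^sup>2)"
      using f e by (auto simp: L2_def intro: L2_intervalD)
    then have "AE x in leb (len e). (cmod (f e x))\<^sup>2 = 0"
      using integral_nonneg_eq_0_iff_AE[of "leb (len e)" "\<lambda>x. (cmod (f e x))\<^sup>2"] z[OF e] by simp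
    then show "AE x in leb (len e). f e x = 0" by simp
  qed
next
  assume "L2_eq G f (\<lambda>e x. 0)"
  from L2_norm_cong[OF this f L2_zero] show "L2_norm G f = 0" by (simp add: L2_norm_def)
qed

text \<open>The pointwise bound of |sum|^2 by \<open>card I\<close> times the sum of squares is
  integrated. The squared form can be added over the three parts of the H^2 norm, and the factor is
  harmless, as only boundedness and convergence to 0 matter.\<close>

lemma L2_norm_sum_squared_le:
  assumes I: "finite I" and f: "\<And>m. m \<in> I \<Longrightarrow> f m \<in> L2 G"
  shows "(L2_norm G (\<lambda>e x. \<Sum>m\<in>I. c m * f m e x))\<^sup>2 \<le> real (card I) * (\<Sum>m\<in>I. (cmod (c m) * L2_norm G (f m))\<^sup>2)"
proof -
  have int: "integrable (leb (len e)) (\<lambda>x. (cmod (f m e x))\<^sup>2)" if "e \<in> edges G" "m \<in> I" for e m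
    using f[OF that(2)] that(1) by (auto simp: L2_def intro: L2_intervalD)
  have "(LINT x|leb (len e). (cmod (\<Sum>m\<in>I. c m * f m e x))\<^sup>2) \<le>
      real (card I) * (\<Sum>m\<in>I. (cmod (c m))\<^sup>2 * (LINT x|leb (len e). (cmod (f m e x))\<^sup>2))"
    (is "_ \<le> ?R") if e: "e \<in> edges G" for e
  proof -
    have "(LINT x|leb (len e). (cmod (\<Sum>m\<in>I. c m * f m e x))\<^sup>2) \<le>
        (LINT x|leb (len e). real (card I) * (\<Sum>m\<in>I. (cmod (c m))\<^sup>2 * (cmod (f m e x))\<^sup>2))"
    proof (rule integral_mono)
      show "integrable (leb (len e)) (\<lambda>x. (cmod (\<Sum>m\<in>I. c m * f m e x))\<^sup>2)"
        using f e by (intro L2_intervalD(2) L2_interval_sum) (auto simp: L2_def)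
      show "integrable (leb (len e)) (\<lambda>x. real (card I) * (\<Sum>m\<in>I. (cmod (c m))\<^sup>2 * (cmod (f m e x))\<^sup>2))"
        using int[OF e] by (intro integrable_mult_right Bochner_Integration.integrable_sum) auto
      fix x
      have "(cmod (\<Sum>m\<in>I. c m * f m e x))\<^sup>2 \<le> (\<Sum>m\<in>I. cmod (c m * f m e x))\<^sup>2"
        by (intro power_mono norm_sum norm_ge_zero)
      also have "\<dots> \<le> (\<Sum>m\<in>I. (cmod (c m * f m e x))\<^sup>2) * real (card I)"
        by (rule sum_squared_le_sum_of_squares)
      finally show "(cmod (\<Sum>m\<in>I. c m * f m e x))\<^sup>2 \<le> real (card I) * (\<Sum>m\<in>I. (cmod (c m))\<^sup>2 * (cmod (f m e x))\<^sup>2)"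
        by (simp add: norm_mult power_mult_distrib mult.commute)
    qed
    also have "\<dots> = ?R"
      using int[OF e] by (simp add: Bochner_Integration.integral_sum)
    finally show ?thesis .
  qed
  then have "(L2_norm G (\<lambda>e x. \<Sum>m\<in>I. c m * f m e x))\<^sup>2 \<le> (\<Sum>e\<in>edges G.
      real (card I) * (\<Sum>m\<in>I. (cmod (c m))\<^sup>2 * (LINT x|leb (len e). (cmod (f m e x))\<^sup>2)))"
    unfolding L2_norm_squared by (intro sum_mono)
  also have "\<dots> = real (card I) * (\<Sum>m\<in>I. \<Sum>e\<in>edges G. (cmod (c m))\<^sup>2 * (LINT x|leb (len e). (cmod (f m e x))\<^sup>2))"
    by (subst sum.swap) (simp add: sum_distrib_left)
  also have "\<dots> = real (card I) * (\<Sum>m\<in>I. (cmod (c m) * L2_norm G (f m))\<^sup>2)"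
    by (simp add: L2_norm_squared power_mult_distrib sum_distrib_left)
  finally show ?thesis .
qed

text \<open>For nonnegative terms a sum of squares is at most the square of the sum, and
  \<open>card I\<close> is at most its square for nonempty I; for empty I the hypothesis forces N =
  0.\<close>

lemma sqrt_sum_squares_bound:
  fixes N :: real
  assumes I: "finite I" and a: "\<And>m. m \<in> I \<Longrightarrow> 0 \<le> a m" and N: "N\<^sup>2 \<le> real (card I) * (\<Sum>m\<in>I. (a m)\<^sup>2)"
  shows "N \<le> real (card I) * (\<Sum>m\<in>I. a m)"
proof (cases "I = {}")
  case False
  have s: "0 \<le> (\<Sum>m\<in>I. a m)" by (intro sum_nonneg a)
  have "(\<Sum>m\<in>I. (a m)\<^sup>2) \<le> (\<Sum>m\<in>I. a m * (\<Sum>m\<in>I. a m))"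
  proof (rule sum_mono)
    fix m assume "m \<in> I"
    then have "a m \<le> (\<Sum>m\<in>I. a m)" using I a by (intro member_le_sum) auto
    with a[OF \<open>m \<in> I\<close>] show "(a m)\<^sup>2 \<le> a m * (\<Sum>m\<in>I. a m)"
      by (simp add: power2_eq_square mult_left_mono)
  qed
  also have "\<dots> = (\<Sum>m\<in>I. a m)\<^sup>2" by (simp add: sum_distrib_right power2_eq_square)
  finally have "(\<Sum>m\<in>I. (a m)\<^sup>2) \<le> (\<Sum>m\<in>I. a m)\<^sup>2" .
  then have "N\<^sup>2 \<le> real (card I) * (\<Sum>m\<in>I. a m)\<^sup>2"
    using N by (meson mult_left_mono of_nat_0_le_iff order_trans)
  also have "\<dots> \<le> (real (card I))\<^sup>2 * (\<Sum>m\<in>I. a m)\<^sup>2"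
  proof (rule mult_right_mono)
    have "1 \<le> real (card I)" using False I by (simp add: Suc_le_eq card_gt_0_iff)
    then show "real (card I) \<le> (real (card I))\<^sup>2" by (simp add: power2_eq_square)
  qed simp
  finally have "N\<^sup>2 \<le> (real (card I) * (\<Sum>m\<in>I. a m))\<^sup>2" by (simp add: power_mult_distrib)
  then show ?thesis using s by (rule power2_le_imp_le[OF _ mult_nonneg_nonneg[OF of_nat_0_le_iff]])
qed (use N in simp)

lemma L2_norm_sum_le:
  assumes "finite I" "\<And>m. m \<in> I \<Longrightarrow> f m \<in> L2 G"
  shows "L2_norm G (\<lambda>e x. \<Sum>m\<in>I. c m * f m e x) \<le> real (card I) * (\<Sum>m\<in>I. cmod (c m) * L2_norm G (f m))"
  by (rule sqrt_sum_squares_bound[OF assms(1) _ L2_norm_sum_squared_le[OF assms]]) auto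

lemma L2_norm_scale: "L2_norm G (\<lambda>e x. a * f e x) = cmod a * L2_norm G f"
proof -
  have "(L2_norm G (\<lambda>e x. a * f e x))\<^sup>2 = (cmod a * L2_norm G f)\<^sup>2"
    unfolding power_mult_distrib L2_norm_squared by (simp add: norm_mult power_mult_distrib sum_distrib_left)
  then show ?thesis
    by (rule power2_eq_imp_eq) auto
qed

section \<open>The second order Sobolev space of the graph\<close>

lemma H2D:
  assumes "f \<in> H2 G" "e \<in> edges G"
  shows "f e \<in> H2_interval (len e)"
  using assms by (simp add: H2_def)

lemma H2_subset_L2:
  assumes "f \<in> H2 G"
  shows "f \<in> L2 G" "edge_deriv G f \<in> L2 G" "edge_deriv G (edge_deriv G f) \<in> L2 G"
  using H2_intervalD[OF H2D[OF assms]] H1_intervalD by (auto simp: L2_def edge_deriv_def)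

lemma shifted_op_L2:
  assumes "f \<in> H2 G"
  shows "shifted_op G z f \<in> L2 G"
  using L2_linear[OF H2_subset_L2(3)[OF assms] H2_subset_L2(1)[OF assms], of "-1" "-z"]
  by (simp add: shifted_op_def)

text \<open>Derivatives of a combination are determined only up to null sets, whereas end values add
  up exactly, since they come from continuous representatives.\<close>

lemma H2_sum:
  assumes I: "finite I" and f: "\<And>m. m \<in> I \<Longrightarrow> f m \<in> H2 G"
  shows "(\<lambda>e x. \<Sum>m\<in>I. c m * f m e x) \<in> H2 G"
    "L2_eq G (edge_deriv G (\<lambda>e x. \<Sum>m\<in>I. c m * f m e x)) (\<lambda>e x. \<Sum>m\<in>I. c m * edge_deriv G (f m) e x)"
    "L2_eq G (edge_deriv G (edge_deriv G (\<lambda>e x. \<Sum>m\<in>I. c m * f m e x)))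
       (\<lambda>e x. \<Sum>m\<in>I. c m * edge_deriv G (edge_deriv G (f m)) e x)"
    "L2_eq G (shifted_op G z (\<lambda>e x. \<Sum>m\<in>I. c m * f m e x)) (\<lambda>e x. \<Sum>m\<in>I. c m * shifted_op G z (f m) e x)"
    "\<And>e b. e \<in> edges G \<Longrightarrow> end_value G (\<lambda>e x. \<Sum>m\<in>I. c m * f m e x) (e, b) = (\<Sum>m\<in>I. c m * end_value G (f m) (e, b))"
    "\<And>e b. e \<in> edges G \<Longrightarrow> end_value G (edge_deriv G (\<lambda>e x. \<Sum>m\<in>I. c m * f m e x)) (e, b) =
       (\<Sum>m\<in>I. c m * end_value G (edge_deriv G (f m)) (e, b))"
proof -
  have S: "H2_rep (len e) (\<lambda>x. \<Sum>m\<in>I. c m * f m e x) (\<lambda>x. \<Sum>m\<in>I. c m * edge_deriv G (f m) e x)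
      (\<lambda>x. \<Sum>m\<in>I. c m * edge_deriv G (edge_deriv G (f m)) e x)
      (\<lambda>x. \<Sum>m\<in>I. c m * cont_rep (len e) (f m e) x) (\<lambda>x. \<Sum>m\<in>I. c m * cont_rep (len e) (edge_deriv G (f m) e) x)"
    if e: "e \<in> edges G" for e
    unfolding edge_deriv_def by (rule H2_rep_sum[OF length_pos[OF e] I H2D[OF f e]])
  show 1: "(\<lambda>e x. \<Sum>m\<in>I. c m * f m e x) \<in> H2 G"
    using S by (simp add: H2_def H2_rep_def)
  show "L2_eq G (edge_deriv G (\<lambda>e x. \<Sum>m\<in>I. c m * f m e x)) (\<lambda>e x. \<Sum>m\<in>I. c m * edge_deriv G (f m) e x)"
    using S by (intro L2_eqI) (simp add: edge_deriv_def H2_rep_def)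
  show 3: "L2_eq G (edge_deriv G (edge_deriv G (\<lambda>e x. \<Sum>m\<in>I. c m * f m e x)))
       (\<lambda>e x. \<Sum>m\<in>I. c m * edge_deriv G (edge_deriv G (f m)) e x)"
    using S by (intro L2_eqI) (simp add: edge_deriv_def H2_rep_def)
  show "L2_eq G (shifted_op G z (\<lambda>e x. \<Sum>m\<in>I. c m * f m e x)) (\<lambda>e x. \<Sum>m\<in>I. c m * shifted_op G z (f m) e x)"
  proof (rule L2_eqI)
    fix e assume "e \<in> edges G"
    from L2_eqD[OF 3 this]
    show "AE x in leb (len e). shifted_op G z (\<lambda>e x. \<Sum>m\<in>I. c m * f m e x) e x =
        (\<Sum>m\<in>I. c m * shifted_op G z (f m) e x)"
    proof eventually_elim
      case (elim x)
      have "(\<Sum>m\<in>I. c m * shifted_op G z (f m) e x) =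
          (\<Sum>m\<in>I. - (c m * edge_deriv G (edge_deriv G (f m)) e x) - z * (c m * f m e x))"
        by (intro sum.cong) (simp_all add: shifted_op_def algebra_simps)
      then show ?case
        using elim by (simp add: shifted_op_def sum_subtractf sum_negf sum_distrib_left)
    qed
  qed
  fix e b assume e: "e \<in> edges G"
  show "end_value G (\<lambda>e x. \<Sum>m\<in>I. c m * f m e x) (e, b) = (\<Sum>m\<in>I. c m * end_value G (f m) (e, b))"
    using S[OF e] length_pos[OF e] by (simp add: end_value_def H2_rep_def)
  show "end_value G (edge_deriv G (\<lambda>e x. \<Sum>m\<in>I. c m * f m e x)) (e, b) =
       (\<Sum>m\<in>I. c m * end_value G (edge_deriv G (f m)) (e, b))"
    using S[OF e] length_pos[OF e] by (simp add: end_value_def edge_deriv_def H2_rep_def)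
qed

text \<open>Everything that enters the vertex conditions and norms depends on the class of f alone;
  this lets solutions be exchanged for a.e. equal ones.\<close>

lemma H2_cong:
  assumes f: "f \<in> H2 G" and g: "g \<in> H2 G" and eq: "L2_eq G f g"
  shows "L2_eq G (edge_deriv G f) (edge_deriv G g)"
    "L2_eq G (edge_deriv G (edge_deriv G f)) (edge_deriv G (edge_deriv G g))"
    "\<And>e b. e \<in> edges G \<Longrightarrow> end_value G f (e, b) = end_value G g (e, b)"
    "\<And>e b. e \<in> edges G \<Longrightarrow> end_value G (edge_deriv G f) (e, b) = end_value G (edge_deriv G g) (e, b)"
    "H2_norm G f = H2_norm G g"
proof -
  note F = H2_intervalD[OF H2D[OF f]] and G = H2_intervalD[OF H2D[OF g]]
  have C: "AE x in leb (len e). weak_deriv (len e) (f e) x = weak_deriv (len e) (g e) x"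
    "\<And>x. x \<in> {0..len e} \<Longrightarrow> cont_rep (len e) (f e) x = cont_rep (len e) (g e) x"
    if e: "e \<in> edges G" for e
    using H1_interval_cong_AE[OF length_pos[OF e] G(1)[OF e] H1_intervalD(1)[OF F(1)[OF e]] AE_interval_sym[OF L2_eqD[OF eq e]]]
    by blast+
  have C': "AE x in leb (len e). weak_deriv (len e) (weak_deriv (len e) (f e)) x =
      weak_deriv (len e) (weak_deriv (len e) (g e)) x"
    "\<And>x. x \<in> {0..len e} \<Longrightarrow> cont_rep (len e) (weak_deriv (len e) (f e)) x =
      cont_rep (len e) (weak_deriv (len e) (g e)) x"
    if e: "e \<in> edges G" for e
    using H1_interval_cong_AE[OF length_pos[OF e] G(2)[OF e] H1_intervalD(1)[OF F(2)[OF e]] AE_interval_sym[OF C(1)[OF e]]]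
    by blast+
  show 1: "L2_eq G (edge_deriv G f) (edge_deriv G g)"
    using C(1) by (intro L2_eqI) (simp add: edge_deriv_def)
  show 2: "L2_eq G (edge_deriv G (edge_deriv G f)) (edge_deriv G (edge_deriv G g))"
    using C'(1) by (intro L2_eqI) (simp add: edge_deriv_def)
  show "end_value G f (e, b) = end_value G g (e, b)" if e: "e \<in> edges G" for e b
    using C(2)[OF e] length_pos[OF e] by (simp add: end_value_def)
  show "end_value G (edge_deriv G f) (e, b) = end_value G (edge_deriv G g) (e, b)" if e: "e \<in> edges G" for e b
    using C'(2)[OF e] length_pos[OF e] by (simp add: end_value_def edge_deriv_def)
  show "H2_norm G f = H2_norm G g"
    unfolding H2_norm_def
    using L2_norm_cong[OF eq] L2_norm_cong[OF 1] L2_norm_cong[OF 2] H2_subset_L2[OF f] H2_subset_L2[OF g] by simp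
qed

lemma H2_norm_nonneg [simp]: "0 \<le> H2_norm G f"
  by (simp add: H2_norm_def)

lemma H2_norm_squared:
  "(H2_norm G f)\<^sup>2 = (L2_norm G f)\<^sup>2 + (L2_norm G (edge_deriv G f))\<^sup>2 + (L2_norm G (edge_deriv G (edge_deriv G f)))\<^sup>2"
  by (simp add: H2_norm_def)

lemma L2_norm_le_H2_norm: "L2_norm G f \<le> H2_norm G f"
  by (rule power2_le_imp_le) (simp_all add: H2_norm_squared)

lemma H2_norm_sum_le:
  assumes I: "finite I" and f: "\<And>m. m \<in> I \<Longrightarrow> f m \<in> H2 G"
  shows "H2_norm G (\<lambda>e x. \<Sum>m\<in>I. c m * f m e x) \<le> real (card I) * (\<Sum>m\<in>I. cmod (c m) * H2_norm G (f m))"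
proof (rule sqrt_sum_squares_bound[OF I])
  have S: "(\<lambda>e x. \<Sum>m\<in>I. c m * f m e x) \<in> H2 G"
    by (intro H2_sum(1) I f)
  note m = H2_subset_L2[OF f] and s = H2_subset_L2[OF S]
  have e1: "L2_norm G (edge_deriv G (\<lambda>e x. \<Sum>m\<in>I. c m * f m e x)) =
      L2_norm G (\<lambda>e x. \<Sum>m\<in>I. c m * edge_deriv G (f m) e x)"
    by (intro L2_norm_cong H2_sum(2) I f L2_sum m s)
  have e2: "L2_norm G (edge_deriv G (edge_deriv G (\<lambda>e x. \<Sum>m\<in>I. c m * f m e x))) =
      L2_norm G (\<lambda>e x. \<Sum>m\<in>I. c m * edge_deriv G (edge_deriv G (f m)) e x)"
    by (intro L2_norm_cong H2_sum(3) I f L2_sum m s)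
  have "(L2_norm G (edge_deriv G (\<lambda>e x. \<Sum>m\<in>I. c m * f m e x)))\<^sup>2 \<le>
      real (card I) * (\<Sum>m\<in>I. (cmod (c m) * L2_norm G (edge_deriv G (f m)))\<^sup>2)"
    unfolding e1 by (intro L2_norm_sum_squared_le I m)
  moreover have "(L2_norm G (edge_deriv G (edge_deriv G (\<lambda>e x. \<Sum>m\<in>I. c m * f m e x))))\<^sup>2 \<le>
      real (card I) * (\<Sum>m\<in>I. (cmod (c m) * L2_norm G (edge_deriv G (edge_deriv G (f m))))\<^sup>2)"
    unfolding e2 by (intro L2_norm_sum_squared_le I m)
  moreover have "(L2_norm G (\<lambda>e x. \<Sum>m\<in>I. c m * f m e x))\<^sup>2 \<le> real (card I) * (\<Sum>m\<in>I. (cmod (c m) * L2_norm G (f m))\<^sup>2)"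
    by (intro L2_norm_sum_squared_le I m)
  moreover have "(\<Sum>m\<in>I. (cmod (c m) * H2_norm G (f m))\<^sup>2) = (\<Sum>m\<in>I. (cmod (c m) * L2_norm G (f m))\<^sup>2) +
      (\<Sum>m\<in>I. (cmod (c m) * L2_norm G (edge_deriv G (f m)))\<^sup>2) +
      (\<Sum>m\<in>I. (cmod (c m) * L2_norm G (edge_deriv G (edge_deriv G (f m))))\<^sup>2)"
    by (simp add: power_mult_distrib H2_norm_squared distrib_left sum.distrib)
  ultimately show "(H2_norm G (\<lambda>e x. \<Sum>m\<in>I. c m * f m e x))\<^sup>2 \<le> real (card I) * (\<Sum>m\<in>I. (cmod (c m) * H2_norm G (f m))\<^sup>2)"
    by (simp add: H2_norm_squared distrib_left)
qed simp

text \<open>Summing the constants 2 / L + 2 L of the interval estimate gives one bound valid on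
  every edge.\<close>

definition trace_const :: real where
  "trace_const = sqrt (\<Sum>e\<in>edges G. 2 / len e + 2 * len e)"

lemma trace_const_nonneg: "0 \<le> trace_const"
  unfolding trace_const_def using length_pos
  by (intro real_sqrt_ge_zero sum_nonneg add_nonneg_nonneg divide_nonneg_nonneg mult_nonneg_nonneg)
     (auto intro: less_imp_le)

lemma cont_rep_bound:
  assumes f: "f \<in> H2 G" and e: "e \<in> edges G" and x: "x \<in> {0..len e}"
  shows "cmod (cont_rep (len e) (f e) x) \<le> trace_const * H2_norm G f"
    "cmod (cont_rep (len e) (edge_deriv G f e) x) \<le> trace_const * H2_norm G f"
proof -
  let ?L = "len e"
  note F = H2_intervalD[OF H2D[OF f e]]
  have le: "(LINT x|leb ?L. (cmod (g e x))\<^sup>2) \<le> (L2_norm G g)\<^sup>2" for g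
    unfolding L2_norm_squared using e
    by (intro member_le_sum[of e "edges G" "\<lambda>e. LINT x|leb (len e). (cmod (g e x))\<^sup>2"])
       (auto intro: integral_nonneg_AE)
  have c: "2 / ?L + 2 * ?L \<le> trace_const\<^sup>2"
    unfolding trace_const_def using e length_pos
    by (subst real_sqrt_pow2; intro sum_nonneg member_le_sum[of e]) (auto simp: less_imp_le)
  have bound: "cmod z \<le> trace_const * H2_norm G f"
    if "(cmod z)\<^sup>2 \<le> (2 / ?L + 2 * ?L) * (a + b)" "a + b \<le> (H2_norm G f)\<^sup>2" "0 \<le> a + b" for z a b
  proof (rule power2_le_imp_le)
    have "(2 / ?L + 2 * ?L) * (a + b) \<le> trace_const\<^sup>2 * (H2_norm G f)\<^sup>2"
      using c that by (intro mult_mono) auto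
    with that(1) show "(cmod z)\<^sup>2 \<le> (trace_const * H2_norm G f)\<^sup>2"
      by (simp add: power_mult_distrib)
  qed (use trace_const_nonneg in simp)
  have n: "0 \<le> (LINT x|leb ?L. (cmod (g x))\<^sup>2)" for g :: "real \<Rightarrow> complex"
    by (auto intro: integral_nonneg_AE)
  have ed: "weak_deriv ?L (f e) = edge_deriv G f e"
    "weak_deriv ?L (edge_deriv G f e) = edge_deriv G (edge_deriv G f) e"
    by (simp_all add: edge_deriv_def)
  show "cmod (cont_rep ?L (f e) x) \<le> trace_const * H2_norm G f"
  proof (rule bound)
    show "(cmod (cont_rep ?L (f e) x))\<^sup>2 \<le> (2 / ?L + 2 * ?L) *
        ((LINT x|leb ?L. (cmod (f e x))\<^sup>2) + (LINT x|leb ?L. (cmod (edge_deriv G f e x))\<^sup>2))"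
      using H1_cont_rep_bound[OF length_pos[OF e] F(1) x] unfolding ed .
  next
    show "(LINT x|leb ?L. (cmod (f e x))\<^sup>2) + (LINT x|leb ?L. (cmod (edge_deriv G f e x))\<^sup>2)
        \<le> (H2_norm G f)\<^sup>2"
      using le[of f] le[of "edge_deriv G f"] zero_le_power2[of "L2_norm G (edge_deriv G (edge_deriv G f))"]
      unfolding H2_norm_squared by linarith
  qed (intro add_nonneg_nonneg n)
  show "cmod (cont_rep ?L (edge_deriv G f e) x) \<le> trace_const * H2_norm G f"
  proof (rule bound)
    show "(cmod (cont_rep ?L (edge_deriv G f e) x))\<^sup>2 \<le> (2 / ?L + 2 * ?L) *
        ((LINT x|leb ?L. (cmod (edge_deriv G f e x))\<^sup>2) +
         (LINT x|leb ?L. (cmod (edge_deriv G (edge_deriv G f) e x))\<^sup>2))"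
      using H1_cont_rep_bound[OF length_pos[OF e] F(2) x] unfolding ed .
  next
    show "(LINT x|leb ?L. (cmod (edge_deriv G f e x))\<^sup>2) +
        (LINT x|leb ?L. (cmod (edge_deriv G (edge_deriv G f) e x))\<^sup>2) \<le> (H2_norm G f)\<^sup>2"
      using le[of "edge_deriv G f"] le[of "edge_deriv G (edge_deriv G f)"] zero_le_power2[of "L2_norm G f"]
      unfolding H2_norm_squared by linarith
  qed (intro add_nonneg_nonneg n)
qed

section \<open>Vertex traces and scalar vertex conditions\<close>

definition vertex_trace :: "'v \<Rightarrow> nat \<Rightarrow> ('e \<Rightarrow> real \<Rightarrow> complex) \<Rightarrow> complex" where
  "vertex_trace v j f =
    (if j < deg G v then vertex_values G f v $ j else vertex_derivs G f v $ (j - deg G v))"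

text \<open>One row of the vertex conditions: values and derivatives are stacked into a single
  vector of length 2 deg, on which row \<open>snd p\<close> of (A B) at the vertex
  \<open>fst p\<close> acts. For fixed f it is linear in the matrix entries, the source of all
  analyticity in \<A>.\<close>

definition vertex_condition :: "('v \<Rightarrow> complex Matrix.mat) \<Rightarrow> 'v \<times> nat \<Rightarrow> ('e \<Rightarrow> real \<Rightarrow> complex) \<Rightarrow> complex" where
  "vertex_condition \<A> p f = (\<Sum>j<2 * deg G (fst p). \<A> (fst p) $$ (snd p, j) * vertex_trace (fst p) j f)"

text \<open>Reduces facts about traces to end values of f and of its derivative; the unimodular s is
  the orientation sign.\<close>

lemma vertex_trace_cases:
  assumes v: "v \<in> vertices G" and j: "j < 2 * deg G v"
  obtains p where "fst p \<in> edges G" "\<And>f. vertex_trace v j f = end_value G f p"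
  | p s where "fst p \<in> edges G" "cmod s = 1" "\<And>f. vertex_trace v j f = s * end_value G (edge_deriv G f) p"
proof (cases "j < deg G v")
  case True
  then show thesis
    using that(1)[OF ends_at_edge[OF v True]] by (simp add: vertex_trace_def vertex_values_def)
next
  case False
  then have j': "j - deg G v < deg G v" using j by simp
  show thesis
    by (rule that(2)[OF ends_at_edge[OF v j'], of "if snd (ends_at G v ! (j - deg G v)) then - 1 else 1"])
       (use False j' in \<open>simp_all add: vertex_trace_def vertex_derivs_def\<close>)
qed

lemma vertex_trace_sum:
  assumes I: "finite I" and f: "\<And>m. m \<in> I \<Longrightarrow> f m \<in> H2 G" and v: "v \<in> vertices G" and j: "j < 2 * deg G v"
  shows "vertex_trace v j (\<lambda>e x. \<Sum>m\<in>I. c m * f m e x) = (\<Sum>m\<in>I. c m * vertex_trace v j (f m))"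
  using H2_sum(5,6)[OF I f, where c = c]
  by (cases rule: vertex_trace_cases[OF v j]) (force simp: sum_distrib_left mult.left_commute)+

lemma vertex_trace_cong:
  assumes f: "f \<in> H2 G" and g: "g \<in> H2 G" and eq: "L2_eq G f g" and v: "v \<in> vertices G" and j: "j < 2 * deg G v"
  shows "vertex_trace v j f = vertex_trace v j g"
  using H2_cong(3,4)[OF f g eq] by (cases rule: vertex_trace_cases[OF v j]) force+

lemma vertex_trace_bound:
  assumes f: "f \<in> H2 G" and v: "v \<in> vertices G" and j: "j < 2 * deg G v"
  shows "cmod (vertex_trace v j f) \<le> trace_const * H2_norm G f"
proof -
  have b: "cmod (end_value G f p) \<le> trace_const * H2_norm G f"
    "cmod (end_value G (edge_deriv G f) p) \<le> trace_const * H2_norm G f" if "fst p \<in> edges G" for p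
    using cont_rep_bound[OF f that] length_pos[OF that] by (auto simp: end_value_def split: prod.splits)
  show ?thesis
    by (cases rule: vertex_trace_cases[OF v j]) (simp_all add: norm_mult b)
qed

lemma op_domain_iff:
  "f \<in> op_domain G \<A> \<longleftrightarrow>
    f \<in> H2 G \<and> (\<forall>p \<in> Sigma (vertices G) (\<lambda>v. {..<deg G v}). vertex_condition \<A> p f = 0)"
proof -
  have "left_block (deg G v) (\<A> v) *\<^sub>v vertex_values G f v + right_block (deg G v) (\<A> v) *\<^sub>v vertex_derivs G f v
      = 0\<^sub>v (deg G v) \<longleftrightarrow> (\<forall>i<deg G v. vertex_condition \<A> (v, i) f = 0)" for v
  proof -
    let ?d = "deg G v"
    let ?x = "left_block ?d (\<A> v) *\<^sub>v vertex_values G f v + right_block ?d (\<A> v) *\<^sub>v vertex_derivs G f v"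
    have "?x $ i = vertex_condition \<A> (v, i) f" if i: "i < ?d" for i
    proof -
      have "?x $ i = (\<Sum>j = 0..<?d. \<A> v $$ (i, j) * vertex_values G f v $ j) +
          (\<Sum>j = 0..<?d. \<A> v $$ (i, ?d + j) * vertex_derivs G f v $ j)"
        using i by (simp add: left_block_def right_block_def scalar_prod_def vertex_values_def vertex_derivs_def)
      also have "(\<Sum>j = 0..<?d. \<A> v $$ (i, j) * vertex_values G f v $ j) =
          (\<Sum>j = 0..<?d. \<A> v $$ (i, j) * vertex_trace v j f)"
        by (intro sum.cong) (auto simp: vertex_trace_def)
      also have "(\<Sum>j = 0..<?d. \<A> v $$ (i, ?d + j) * vertex_derivs G f v $ j) =
          (\<Sum>j = 0..<?d. \<A> v $$ (i, j + ?d) * vertex_trace v (j + ?d) f)"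
        by (intro sum.cong) (auto simp: vertex_trace_def add.commute)
      \<comment> \<open>Shifting by the degree moves the B block to the columns behind the A block,
        so both sums join into one.\<close>
      also have "\<dots> = (\<Sum>j = 0 + ?d..<?d + ?d. \<A> v $$ (i, j) * vertex_trace v j f)"
        by (rule sum.shift_bounds_nat_ivl[symmetric])
      also have "(\<Sum>j = 0..<?d. \<A> v $$ (i, j) * vertex_trace v j f) +
          (\<Sum>j = 0 + ?d..<?d + ?d. \<A> v $$ (i, j) * vertex_trace v j f) = vertex_condition \<A> (v, i) f"
        by (simp add: vertex_condition_def sum.atLeastLessThan_concat mult_2 lessThan_atLeast0)
      finally show ?thesis .
    qed
    moreover have "?x \<in> carrier_vec ?d"
      by (intro add_carrier_vec mult_mat_vec_carrier[of _ ?d ?d])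
         (auto simp: left_block_def right_block_def vertex_values_def vertex_derivs_def)
    moreover have "dim_row (right_block ?d (\<A> v)) = ?d" by (simp add: right_block_def)
    ultimately show ?thesis by (auto simp: vec_eq_iff)
  qed
  then show ?thesis by (auto simp: op_domain_def)
qed

lemma vertex_condition_sum:
  assumes I: "finite I" and f: "\<And>m. m \<in> I \<Longrightarrow> f m \<in> H2 G" and p: "fst p \<in> vertices G"
  shows "vertex_condition \<A> p (\<lambda>e x. \<Sum>m\<in>I. c m * f m e x) = (\<Sum>m\<in>I. c m * vertex_condition \<A> p (f m))"
proof -
  have "vertex_condition \<A> p (\<lambda>e x. \<Sum>m\<in>I. c m * f m e x) =
      (\<Sum>j<2 * deg G (fst p). \<Sum>m\<in>I. c m * (\<A> (fst p) $$ (snd p, j) * vertex_trace (fst p) j (f m)))"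
    unfolding vertex_condition_def using vertex_trace_sum[OF I f p]
    by (intro sum.cong) (auto simp: sum_distrib_left mult_ac)
  also have "\<dots> = (\<Sum>m\<in>I. c m * vertex_condition \<A> p (f m))"
    unfolding vertex_condition_def by (subst sum.swap) (simp add: sum_distrib_left)
  finally show ?thesis .
qed

lemma vertex_condition_cong:
  assumes "f \<in> H2 G" "g \<in> H2 G" "L2_eq G f g" "fst p \<in> vertices G"
  shows "vertex_condition \<A> p f = vertex_condition \<A> p g"
  unfolding vertex_condition_def using vertex_trace_cong[OF assms] by simp

lemma op_domain_sum:
  assumes "finite I" "\<And>m. m \<in> I \<Longrightarrow> f m \<in> op_domain G \<A>"
  shows "(\<lambda>e x. \<Sum>m\<in>I. c m * f m e x) \<in> op_domain G \<A>"
  using assms H2_sum(1)[of I f c] vertex_condition_sum[of I f _ \<A> c]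
  by (auto simp: op_domain_iff)

end

section \<open>The boundary value problem\<close>

lemma adj_mat_entry:
  fixes M :: "'a :: comm_ring_1 Matrix.mat"
  assumes M: "M \<in> carrier_mat n n" and k: "k < n" "k' < n"
  shows "(\<Sum>l<n. M $$ (k, l) * adj_mat M $$ (l, k')) = (if k = k' then Determinant.det M else 0)"
proof -
  have "(M * adj_mat M) $$ (k, k') = (\<Sum>l<n. M $$ (k, l) * adj_mat M $$ (l, k'))"
    using M adj_mat(1)[OF M] k by (auto simp: scalar_prod_def lessThan_atLeast0)
  then show ?thesis
    unfolding adj_mat(2)[OF M] using k by (cases "k = k'") auto
qed

text \<open>Cramer's rule with visible adjugate entries: they are polynomials in the entries of M,
  and this form is differentiated from an abstract inverse by being open to power series.\<close>

lemma adj_mat_solves: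
  fixes M :: "'a :: field Matrix.mat"
  assumes M: "M \<in> carrier_mat n n" and d: "Determinant.det M \<noteq> 0" and k: "k < n"
  shows "(\<Sum>l<n. M $$ (k, l) * (\<Sum>k'<n. adj_mat M $$ (l, k') / Determinant.det M * b k')) = b k"
proof -
  have "(\<Sum>l<n. M $$ (k, l) * (\<Sum>k'<n. adj_mat M $$ (l, k') / Determinant.det M * b k')) =
      (\<Sum>l<n. \<Sum>k'<n. M $$ (k, l) * adj_mat M $$ (l, k') * (b k' / Determinant.det M))"
    by (simp add: sum_distrib_left mult_ac)
  also have "\<dots> = (\<Sum>k'<n. (\<Sum>l<n. M $$ (k, l) * adj_mat M $$ (l, k')) * (b k' / Determinant.det M))"
    by (subst sum.swap) (simp only: sum_distrib_right)
  also have "\<dots> = (\<Sum>k'<n. (if k = k' then Determinant.det M else 0) * (b k' / Determinant.det M))"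
    using adj_mat_entry[OF M k] by (intro sum.cong) auto
  also have "\<dots> = (\<Sum>k'<n. if k = k' then b k' else 0)"
    using d by (intro sum.cong) auto
  also have "\<dots> = b k" using k by simp
  finally show ?thesis .
qed

text \<open>The column space is the range of M, here the whole space.\<close>

lemma rank_surjective:
  fixes M :: "complex Matrix.mat"
  assumes M: "M \<in> carrier_mat d m" and surj: "\<And>y. y \<in> carrier_vec d \<Longrightarrow> \<exists>x\<in>carrier_vec m. M *\<^sub>v x = y"
  shows "vec_space.rank d M = d"
proof -
  interpret vec_space "TYPE(complex)" d .
  have "col_space M = carrier_vec d"
    unfolding col_space_eq[OF M] using M surj by auto
  then have "span (set (cols M)) = carrier_vec d" by (simp add: col_space_def)
  then have "rank M = vectorspace.dim class_ring (vs (carrier_vec d))"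
    by (simp add: rank_def)
  also have "vs (carrier_vec d) = V" by (simp add: module_vec_def)
  finally show ?thesis using dim_is_n by simp
qed

section \<open>Exponential solutions and the condition matrix\<close>

context metric_graph_context
begin

text \<open>The Boolean selects the sign of the exponent. The index pairs have the type of
  edge-ends, so their number is that of all edge-ends.\<close>

definition basis :: "'e \<times> bool \<Rightarrow> 'e \<Rightarrow> real \<Rightarrow> complex" where
  "basis p = (\<lambda>e x. if e = fst p then exp ((if snd p then - kappa else kappa) * of_real x) else 0)"

lemma basis_H2: "basis p \<in> H2 G"
proof -
  have "basis p e \<in> H2_interval (len e)" if e: "e \<in> edges G" for e
    using H2_interval_exp(1)[OF length_pos[OF e]] H2_rep_zero[OF length_pos[OF e]]
    by (cases "e = fst p") (simp_all add: basis_def H2_rep_def)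
  then show ?thesis by (simp add: H2_def)
qed

lemma shifted_op_basis: "L2_eq G (shifted_op G \<i> (basis p)) (\<lambda>e x. 0)"
proof (rule L2_eqI)
  fix e assume e: "e \<in> edges G"
  define k where "k = (if snd p then - kappa else kappa)"
  have k: "k * k = - \<i>" using kappa_squared by (simp add: k_def)
  show "AE x in leb (len e). shifted_op G \<i> (basis p) e x = 0"
  proof (cases "e = fst p")
    case True
    then have "basis p e = (\<lambda>x. exp (k * of_real x))" by (simp add: basis_def k_def)
    moreover have "AE x in leb (len e).
        - weak_deriv (len e) (weak_deriv (len e) (\<lambda>x. exp (k * of_real x))) x - \<i> * exp (k * of_real x) = 0"
      using H2_interval_exp(2)[OF length_pos[OF e], of k] by eventually_elim (simp add: k)
    ultimately show ?thesis by (simp add: shifted_op_def edge_deriv_def)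
  next
    case False
    then have "basis p e = (\<lambda>x. 0)" by (simp add: basis_def)
    then show ?thesis
      using H2_rep_zero[OF length_pos[OF e]] by (simp add: shifted_op_def edge_deriv_def H2_rep_def)
  qed
qed

definition n_ends :: nat where
  "n_ends = card (edges G \<times> (UNIV :: bool set))"

abbreviation vertex_rows :: "('v \<times> nat) set" where
  "vertex_rows \<equiv> Sigma (vertices G) (\<lambda>v. {..<deg G v})"

text \<open>The handshake identity: each edge-end sits at exactly one vertex and occurs once in its
  list, so (v, i) and the i-th end at v correspond bijectively. Hence there are as many conditions
  as exponentials.\<close>

lemma card_vertex_rows: "card vertex_rows = n_ends"
proof -
  have "bij_betw (\<lambda>(v, i). ends_at G v ! i) vertex_rows (edges G \<times> UNIV)"
    unfolding bij_betw_def
  proof (intro conjI inj_onI subset_antisym subsetI)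
    fix p q assume p: "p \<in> vertex_rows" and q: "q \<in> vertex_rows"
      and eq: "(case p of (v, i) \<Rightarrow> ends_at G v ! i) = (case q of (v, i) \<Rightarrow> ends_at G v ! i)"
    obtain v i w j where pq: "p = (v, i)" "q = (w, j)" by (cases p, cases q)
    have vi: "v \<in> vertices G" "i < deg G v" "w \<in> vertices G" "j < deg G w"
      using p q pq by auto
    have "ends_at G v ! i \<in> edge_ends G v" "ends_at G w ! j \<in> edge_ends G w"
      using vi ends_at nth_mem by metis+
    \<comment> \<open>An edge-end determines its vertex, the head or the tail of the edge.\<close>
    then have "v = w" using eq pq by (auto simp: edge_ends_def)
    moreover have "i = j"
      using ends_at(1)[OF vi(1)] ends_at(3)[OF vi(1)] vi eq pq \<open>v = w\<close> by (simp add: nth_eq_iff_index_eq)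
    ultimately show "p = q" using pq by simp
  next
    fix z assume "z \<in> (\<lambda>(v, i). ends_at G v ! i) ` vertex_rows"
    then show "z \<in> edges G \<times> UNIV" using ends_at_edge by (auto simp: mem_Times_iff)
  next
    fix z :: "'e \<times> bool" assume z: "z \<in> edges G \<times> UNIV"
    obtain e b where eb: "z = (e, b)" by (cases z)
    define v where "v = (if b then head (graph_of G) e else tail (graph_of G) e)"
    interpret fin_digraph "graph_of G" by (rule fin)
    have v: "v \<in> vertices G" using z eb by (auto simp: v_def)
    have "z \<in> set (ends_at G v)"
      using z eb unfolding ends_at(2)[OF v] by (simp add: edge_ends_def v_def)
    then obtain i where "i < deg G v" "ends_at G v ! i = z"
      using ends_at(3)[OF v] by (metis in_set_conv_nth)
    then show "z \<in> (\<lambda>(v, i). ends_at G v ! i) ` vertex_rows"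
      using v by (intro image_eqI[of _ _ "(v, i)"]) auto
  qed
  then show ?thesis unfolding n_ends_def by (rule bij_betw_same_card)
qed

text \<open>Matrices need numerical indices; the order is arbitrary, as it affects determinants only
  up to sign.\<close>

definition end_enum :: "nat \<Rightarrow> 'e \<times> bool" where
  "end_enum = (SOME h. bij_betw h {..<n_ends} (edges G \<times> UNIV))"

definition row_enum :: "nat \<Rightarrow> 'v \<times> nat" where
  "row_enum = (SOME h. bij_betw h {..<n_ends} vertex_rows)"

lemma end_enum: "bij_betw end_enum {..<n_ends} (edges G \<times> UNIV)"
proof -
  have "\<exists>h. bij_betw h {..<n_ends} (edges G \<times> (UNIV :: bool set))"
    by (rule finite_same_card_bij) (auto simp: n_ends_def)
  then show ?thesis unfolding end_enum_def by (rule someI_ex)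
qed

lemma row_enum: "bij_betw row_enum {..<n_ends} vertex_rows"
proof -
  have "\<exists>h. bij_betw h {..<n_ends} vertex_rows"
    by (rule finite_same_card_bij) (auto simp: card_vertex_rows)
  then show ?thesis unfolding row_enum_def by (rule someI_ex)
qed

lemma row_enum_mem:
  assumes "k < n_ends"
  shows "fst (row_enum k) \<in> vertices G" "snd (row_enum k) < deg G (fst (row_enum k))"
  using bij_betw_apply[OF row_enum, of k] assms by auto

lemma row_enum_surj:
  assumes "p \<in> vertex_rows"
  obtains k where "k < n_ends" "p = row_enum k"
  using row_enum assms by (auto simp: bij_betw_def)

definition condition_matrix :: "('v \<Rightarrow> complex Matrix.mat) \<Rightarrow> complex Matrix.mat" where
  "condition_matrix \<A> =
    Matrix.mat n_ends n_ends (\<lambda>(k, l). vertex_condition \<A> (row_enum k) (basis (end_enum l)))"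

lemma condition_matrix_carrier: "condition_matrix \<A> \<in> carrier_mat n_ends n_ends"
  by (simp add: condition_matrix_def)

definition homogeneous :: "(nat \<Rightarrow> complex) \<Rightarrow> 'e \<Rightarrow> real \<Rightarrow> complex" where
  "homogeneous c = (\<lambda>e x. \<Sum>l<n_ends. c l * basis (end_enum l) e x)"

lemma homogeneous_H2: "homogeneous c \<in> H2 G"
  unfolding homogeneous_def by (intro H2_sum(1) basis_H2) simp

lemma shifted_op_homogeneous: "L2_eq G (shifted_op G \<i> (homogeneous c)) (\<lambda>e x. 0)"
proof -
  have 1: "L2_eq G (shifted_op G \<i> (homogeneous c)) (\<lambda>e x. \<Sum>l<n_ends. c l * shifted_op G \<i> (basis (end_enum l)) e x)"
    unfolding homogeneous_def by (intro H2_sum(4) basis_H2) simp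
  have 2: "L2_eq G (\<lambda>e x. \<Sum>l<n_ends. c l * shifted_op G \<i> (basis (end_enum l)) e x) (\<lambda>e x. \<Sum>l<n_ends. c l * 0)"
    by (rule L2_eq_sum[where g = "\<lambda>m e x. 0"]) (auto intro: shifted_op_basis)
  from L2_eq_trans[OF 1 2] show ?thesis by simp
qed

lemma vertex_condition_homogeneous:
  assumes "k < n_ends"
  shows "vertex_condition \<A> (row_enum k) (homogeneous c) = (\<Sum>l<n_ends. condition_matrix \<A> $$ (k, l) * c l)"
  unfolding homogeneous_def
  by (subst vertex_condition_sum)
     (use assms row_enum_mem(1) basis_H2 in \<open>auto simp: condition_matrix_def mult.commute\<close>)

lemma homogeneous_on_edge:
  assumes c: "\<And>l. l < n_ends \<Longrightarrow> c l = cc (end_enum l)" and e: "e \<in> edges G"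
  shows "homogeneous c e x = cc (e, False) * exp (kappa * of_real x) + cc (e, True) * exp (- kappa * of_real x)"
proof -
  have "homogeneous c e x = (\<Sum>l<n_ends. cc (end_enum l) * basis (end_enum l) e x)"
    unfolding homogeneous_def using c by (intro sum.cong) auto
  also have "\<dots> = (\<Sum>p\<in>edges G \<times> UNIV. cc p * basis p e x)"
    by (rule sum.reindex_bij_betw[OF end_enum])
  \<comment> \<open>The exponentials attached to other edges vanish on e.\<close>
  also have "\<dots> = (\<Sum>p\<in>{(e, False), (e, True)}. cc p * basis p e x)"
    by (rule sum.mono_neutral_right) (use e in \<open>auto simp: basis_def\<close>)
  finally show ?thesis by (simp add: basis_def)
qed

lemma homogeneous_solution:
  assumes f: "f \<in> H2 G" and eq: "L2_eq G (shifted_op G \<i> f) (\<lambda>e x. 0)"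
  obtains c where "L2_eq G f (homogeneous c)"
proof -
  have "\<exists>a. \<forall>x\<in>{0..len e}. cont_rep (len e) (f e) x =
      fst a * exp (kappa * of_real x) + snd a * exp (- kappa * of_real x)" if e: "e \<in> edges G" for e
  proof -
    have "AE x in leb (len e).
        - weak_deriv (len e) (weak_deriv (len e) (f e)) x - \<i> * f e x = 0"
      using L2_eqD[OF eq e] by (simp add: shifted_op_def edge_deriv_def)
    from H2_homogeneous_solution[OF length_pos[OF e] H2D[OF f e] this]
    obtain c d where "\<And>x. x \<in> {0..len e} \<Longrightarrow> cont_rep (len e) (f e) x =
        c * exp (kappa * of_real x) + d * exp (- kappa * of_real x)" by blast
    then show ?thesis by (intro exI[of _ "(c, d)"]) simp
  qed
  then obtain a where a: "\<And>e x. e \<in> edges G \<Longrightarrow> x \<in> {0..len e} \<Longrightarrow> cont_rep (len e) (f e) x =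
      fst (a e) * exp (kappa * of_real x) + snd (a e) * exp (- kappa * of_real x)"
    by metis
  define cc where "cc p = (if snd p then snd (a (fst p)) else fst (a (fst p)))" for p
  show thesis
  proof (rule that[of "\<lambda>l. cc (end_enum l)"], rule L2_eqI)
    fix e assume e: "e \<in> edges G"
    have "AE x in leb (len e). x \<in> {0..len e}"
      by (rule AE_I2) (simp add: space_restrict_space)
    with H1_cont_rep(2)[OF length_pos[OF e] H2_intervalD(1)[OF H2D[OF f e]]]
    show "AE x in leb (len e). f e x = homogeneous (\<lambda>l. cc (end_enum l)) e x"
    proof eventually_elim
      case (elim x)
      have "homogeneous (\<lambda>l. cc (end_enum l)) e x = fst (a e) * exp (kappa * of_real x) + snd (a e) * exp (- kappa * of_real x)"
        using homogeneous_on_edge[OF refl e, where cc = cc] by (simp add: cc_def)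
      then show ?case using a[OF e elim(2)] elim(1) by simp
    qed
  qed
qed

text \<open>On one edge, vanishing at x = 0 makes the two coefficients opposite, and vanishing at
  the other end then makes them zero, because exp (kappa L) and exp (-kappa L) have different
  moduli.\<close>

lemma homogeneous_independent:
  assumes eq: "L2_eq G (homogeneous c) (\<lambda>e x. 0)" and l: "l < n_ends"
  shows "c l = 0"
proof -
  define cc where "cc p = c (inv_into {..<n_ends} end_enum p)" for p
  have cc: "c l = cc (end_enum l)" if "l < n_ends" for l
    using end_enum that by (simp add: cc_def bij_betw_def inv_into_f_f)
  have "cc (e, b) = 0" if e: "e \<in> edges G" for e b
  proof -
    let ?L = "len e"
    let ?h = "\<lambda>x. cc (e, False) * exp (kappa * of_real x) + cc (e, True) * exp (- kappa * of_real x)"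
    have L: "?L > 0" by (rule length_pos[OF e])
    have "homogeneous c e x = ?h x" for x
      by (rule homogeneous_on_edge[where cc = cc]) (auto intro: cc e)
    then have "AE x in leb ?L. ?h x = 0"
      using L2_eqD[OF eq e] by simp
    then have h: "?h x = 0" if "x \<in> {0..?L}" for x
      using that by (intro AE_interval_continuous_eq[OF _ _ L]) (auto intro!: continuous_intros)
    have 1: "cc (e, True) = - cc (e, False)"
      using h[of 0] L by (simp add: eq_neg_iff_add_eq_0 add.commute)
    have "cc (e, False) * (exp (kappa * of_real ?L) - exp (- kappa * of_real ?L)) = 0"
      using h[of ?L] L 1 by (simp add: algebra_simps)
    moreover have "exp (kappa * of_real ?L) \<noteq> exp (- kappa * of_real ?L)"
    proof
      assume "exp (kappa * of_real ?L) = exp (- kappa * of_real ?L)"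
      then have "exp (Re (kappa * of_real ?L)) = exp (Re (- kappa * of_real ?L))"
        by (metis norm_exp_eq_Re)
      then show False using Re_kappa_pos L by simp
    qed
    ultimately have "cc (e, False) = 0" by simp
    with 1 show ?thesis by (cases b) auto
  qed
  moreover have "end_enum l \<in> edges G \<times> UNIV"
    using bij_betw_apply[OF end_enum] l by simp
  ultimately show ?thesis using cc[OF l] by (cases "end_enum l") auto
qed

section \<open>Well-posedness of the boundary value problem\<close>

definition solution :: "('v \<Rightarrow> complex Matrix.mat) \<Rightarrow> ('e \<Rightarrow> real \<Rightarrow> complex) \<Rightarrow> ('e \<Rightarrow> real \<Rightarrow> complex) \<Rightarrow> bool" where
  "solution \<A> f g \<longleftrightarrow> f \<in> op_domain G \<A> \<and> L2_eq G (shifted_op G \<i> f) g"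

definition unique_solvable :: "('v \<Rightarrow> complex Matrix.mat) \<Rightarrow> bool" where
  "unique_solvable \<A> \<longleftrightarrow> (\<forall>f. solution \<A> f (\<lambda>e x. 0) \<longrightarrow> L2_eq G f (\<lambda>e x. 0))"

text \<open>Quantitative form of continuous invertibility. The bound is in the H^2 norm because that
  norm controls the traces, including those of the derivative.\<close>

definition well_posed :: "('v \<Rightarrow> complex Matrix.mat) \<Rightarrow> real \<Rightarrow> bool" where
  "well_posed \<A> K \<longleftrightarrow> unique_solvable \<A> \<and>
    (\<forall>g\<in>L2 G. \<exists>f. solution \<A> f g \<and> H2_norm G f \<le> K * L2_norm G g)"

lemma solution_H2: "solution \<A> f g \<Longrightarrow> f \<in> H2 G"
  by (simp add: solution_def op_domain_iff)

lemma solution_sum: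
  assumes I: "finite I" and f: "\<And>m. m \<in> I \<Longrightarrow> solution \<A> (f m) (g m)"
  shows "solution \<A> (\<lambda>e x. \<Sum>m\<in>I. c m * f m e x) (\<lambda>e x. \<Sum>m\<in>I. c m * g m e x)"
proof -
  have "L2_eq G (shifted_op G \<i> (\<lambda>e x. \<Sum>m\<in>I. c m * f m e x)) (\<lambda>e x. \<Sum>m\<in>I. c m * shifted_op G \<i> (f m) e x)"
    by (intro H2_sum(4) I solution_H2[OF f])
  moreover have "L2_eq G (\<lambda>e x. \<Sum>m\<in>I. c m * shifted_op G \<i> (f m) e x) (\<lambda>e x. \<Sum>m\<in>I. c m * g m e x)"
    using f by (intro L2_eq_sum I) (simp add: solution_def)
  ultimately show ?thesis
    using op_domain_sum[OF I, of f \<A> c] f L2_eq_trans by (auto simp: solution_def)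
qed

text \<open>A combination of two functions is treated as a finite sum indexed by the Booleans; the
  same device recurs below.\<close>

lemma solution_linear:
  assumes "solution \<A> f g" "solution \<A> f' g'"
  shows "solution \<A> (\<lambda>e x. a * f e x + b * f' e x) (\<lambda>e x. a * g e x + b * g' e x)"
  using solution_sum[of UNIV \<A> "\<lambda>m. if m then f' else f" "\<lambda>m. if m then g' else g" "\<lambda>m. if m then b else a"] assms
  by (simp add: UNIV_bool)

lemma solution_zero: "solution \<A> (\<lambda>e x. 0) (\<lambda>e x. 0)"
  using solution_sum[of "{}"] by simp

lemma H2_linear: "f \<in> H2 G \<Longrightarrow> g \<in> H2 G \<Longrightarrow> (\<lambda>e x. a * f e x + b * g e x) \<in> H2 G"
  using H2_sum(1)[of UNIV "\<lambda>m. if m then g else f" "\<lambda>m. if m then b else a"]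
  by (simp add: UNIV_bool)

lemma solution_unique:
  assumes u: "unique_solvable \<A>" and f: "solution \<A> f g" and f': "solution \<A> f' g"
  shows "L2_eq G f f'"
proof -
  have "solution \<A> (\<lambda>e x. 1 * f e x + (- 1) * f' e x) (\<lambda>e x. 1 * g e x + (- 1) * g e x)"
    by (rule solution_linear[OF f f'])
  then have "L2_eq G (\<lambda>e x. 1 * f e x + (- 1) * f' e x) (\<lambda>e x. 0)"
    using u by (simp add: unique_solvable_def)
  then show ?thesis by (simp add: L2_eq_def)
qed

text \<open>The map S is not known to be linear or to respect a.e. equality. Continuity yields the
  latter, the left inverse property then yields uniqueness, and uniqueness makes S homogeneous up to
  null sets, so that continuity at 0 turns into a norm bound by scaling.\<close>

lemma continuously_invertible_imp_well_posed:
  assumes "continuously_invertible G \<i> \<A>"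
  obtains K where "well_posed \<A> K"
proof -
  from assms obtain S where
    S1: "\<And>g. g \<in> L2 G \<Longrightarrow> solution \<A> (S g) g" and
    S2: "\<And>f. f \<in> op_domain G \<A> \<Longrightarrow> L2_eq G (S (shifted_op G \<i> f)) f" and
    S3: "\<And>g \<epsilon>. g \<in> L2 G \<Longrightarrow> \<epsilon> > 0 \<Longrightarrow> \<exists>\<delta>>0. \<forall>g'\<in>L2 G. L2_norm G (\<lambda>e x. g' e x - g e x) < \<delta> \<longrightarrow>
             H2_norm G (\<lambda>e x. S g' e x - S g e x) < \<epsilon>"
    unfolding continuously_invertible_def solution_def by blast
  let ?z = "\<lambda>e x. 0 :: complex"
  have S_H2: "S g \<in> H2 G" if "g \<in> L2 G" for g using S1[OF that] by (rule solution_H2)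
  have diff_H2: "(\<lambda>e x. S g' e x - S g e x) \<in> H2 G" if "g \<in> L2 G" "g' \<in> L2 G" for g g'
    using H2_linear[OF S_H2[OF that(2)] S_H2[OF that(1)], of 1 "-1"] by simp
  \<comment> \<open>Functions in the same class have distance 0, below every \<delta>, so the
    distance of their images is below every \<epsilon>.\<close>
  have S_cong: "L2_eq G (S g) (S g')" if g: "g \<in> L2 G" and g': "g' \<in> L2 G" and eq: "L2_eq G g g'" for g g'
  proof -
    have "L2_eq G (\<lambda>e x. g' e x - g e x) ?z"
      using L2_eq_sym[OF eq] by (simp add: L2_eq_def)
    moreover have "(\<lambda>e x. g' e x - g e x) \<in> L2 G"
      using L2_linear[OF g' g, of 1 "-1"] by simp
    ultimately have "L2_norm G (\<lambda>e x. g' e x - g e x) = 0"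
      using L2_norm_zero_iff by blast
    then have "H2_norm G (\<lambda>e x. S g' e x - S g e x) < \<epsilon>" if "\<epsilon> > 0" for \<epsilon>
      using S3[OF g that] g' by auto
    then have "L2_norm G (\<lambda>e x. S g' e x - S g e x) < \<epsilon>" if "\<epsilon> > 0" for \<epsilon>
      using L2_norm_le_H2_norm that by (meson le_less_trans)
    then have "L2_norm G (\<lambda>e x. S g' e x - S g e x) = 0"
      by (metis L2_norm_nonneg less_irrefl order_le_imp_less_or_eq)
    then have "L2_eq G (\<lambda>e x. S g' e x - S g e x) ?z"
      using L2_norm_zero_iff[OF H2_subset_L2(1)[OF diff_H2[OF g g']]] by blast
    then show ?thesis by (auto simp: L2_eq_def intro: AE_interval_sym)
  qed
  have u: "unique_solvable \<A>"
    unfolding unique_solvable_def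
  proof (intro allI impI)
    fix f assume f: "solution \<A> f ?z"
    \<comment> \<open>S recovers both f and 0 from their images, which are a.e. equal.\<close>
    have "L2_eq G (S (shifted_op G \<i> f)) (S (shifted_op G \<i> ?z))"
    proof (rule S_cong)
      show "shifted_op G \<i> f \<in> L2 G" "shifted_op G \<i> ?z \<in> L2 G"
        using shifted_op_L2 solution_H2[OF f] solution_H2[OF solution_zero] by auto
      show "L2_eq G (shifted_op G \<i> f) (shifted_op G \<i> ?z)"
        using f solution_zero[of \<A>] by (meson L2_eq_sym L2_eq_trans solution_def)
    qed
    moreover have "L2_eq G (S (shifted_op G \<i> f)) f" "L2_eq G (S (shifted_op G \<i> ?z)) ?z"
      using S2 f solution_zero[of \<A>] by (auto simp: solution_def)
    ultimately show "L2_eq G f ?z" by (meson L2_eq_sym L2_eq_trans)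
  qed
  obtain \<delta> where \<delta>: "\<delta> > 0" "\<And>g'. g' \<in> L2 G \<Longrightarrow> L2_norm G (\<lambda>e x. g' e x - 0) < \<delta> \<Longrightarrow>
      H2_norm G (\<lambda>e x. S g' e x - S ?z e x) < 1"
    using S3[OF L2_zero, of 1] by auto
  have bound: "H2_norm G (S g) \<le> 2 / \<delta> * L2_norm G g" if g: "g \<in> L2 G" for g
  proof (rule field_le_epsilon)
    fix \<eta> :: real assume \<eta>: "\<eta> > 0"
    \<comment> \<open>The norm of g may be 0, hence the summand with \<eta>. It is chosen such that
      t = \<delta> / (2 N) scales g to norm at most \<delta> / 2 and 1 / t is exactly the claimed
      bound plus \<eta>.\<close>
    define N where "N = L2_norm G g + \<eta> * \<delta> / 2"
    have N: "N > 0" "L2_norm G g \<le> N" using \<eta> \<delta>(1) by (auto simp: N_def intro: add_nonneg_pos)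
    define t where "t = \<delta> / (2 * N)"
    have t: "t > 0" using N \<delta>(1) by (simp add: t_def)
    let ?tg = "\<lambda>e x. of_real t * g e x"
    have tg: "?tg \<in> L2 G" using L2_linear[OF g g, of "of_real t" 0] by simp
    have "L2_norm G ?tg = t * L2_norm G g" using t by (simp add: L2_norm_scale)
    also have "\<dots> \<le> t * N" using t N by simp
    also have "\<dots> < \<delta>" using N \<delta>(1) by (simp add: t_def)
    finally have 1: "H2_norm G (\<lambda>e x. S ?tg e x - S ?z e x) < 1"
      using \<delta>(2)[OF tg] by simp
    have "solution \<A> (\<lambda>e x. 1 * S ?tg e x + (- 1) * S ?z e x) (\<lambda>e x. 1 * ?tg e x + (- 1) * 0)"
      by (rule solution_linear[OF S1[OF tg] S1[OF L2_zero]])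
    moreover have "solution \<A> (\<lambda>e x. of_real t * S g e x + 0 * S g e x) (\<lambda>e x. of_real t * g e x + 0 * g e x)"
      by (rule solution_linear[OF S1[OF g] S1[OF g]])
    ultimately have s: "solution \<A> (\<lambda>e x. S ?tg e x - S ?z e x) ?tg" "solution \<A> (\<lambda>e x. of_real t * S g e x) ?tg"
      by simp_all
    have "H2_norm G (S g) \<le> 1 / t * H2_norm G (\<lambda>e x. of_real t * S g e x)"
      using H2_norm_sum_le[of "{()}" "\<lambda>_ e x. of_real t * S g e x" "\<lambda>_. of_real (1 / t)"] solution_H2[OF s(2)] t
      by (simp add: norm_divide)
    also have "H2_norm G (\<lambda>e x. of_real t * S g e x) = H2_norm G (\<lambda>e x. S ?tg e x - S ?z e x)"
      by (rule H2_cong(5)[OF solution_H2[OF s(2)] solution_H2[OF s(1)] solution_unique[OF u s(2,1)]])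
    also have "1 / t * \<dots> \<le> 1 / t" using 1 t by (intro mult_left_le) auto
    also have "\<dots> = 2 / \<delta> * L2_norm G g + \<eta>" using \<delta>(1) by (simp add: t_def N_def field_simps)
    finally show "H2_norm G (S g) \<le> 2 / \<delta> * L2_norm G g + \<eta>" by simp
  qed
  show thesis
    by (rule that[of "2 / \<delta>"]) (use u S1 bound in \<open>auto simp: well_posed_def\<close>)
qed

text \<open>The bound is assumed for some solution; uniqueness extends it to each one, in particular
  to the one chosen by \<open>resolvent\<close>.\<close>

lemma well_posed_norm:
  assumes wp: "well_posed \<A> K" and f: "solution \<A> f g" and g: "g \<in> L2 G"
  shows "H2_norm G f \<le> K * L2_norm G g"
proof -
  obtain f' where f': "solution \<A> f' g" "H2_norm G f' \<le> K * L2_norm G g"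
    using wp g by (auto simp: well_posed_def)
  have "L2_eq G f f'" by (rule solution_unique[OF _ f f'(1)]) (use wp in \<open>simp add: well_posed_def\<close>)
  from H2_cong(5)[OF solution_H2[OF f] solution_H2[OF f'(1)] this] f'(2) show ?thesis by simp
qed

lemma well_posed_resolvent:
  assumes wp: "well_posed \<A> K" and g: "g \<in> L2 G"
  shows "solution \<A> (resolvent G \<i> \<A> g) g" "H2_norm G (resolvent G \<i> \<A> g) \<le> K * L2_norm G g"
proof -
  have "\<exists>f. f \<in> op_domain G \<A> \<and> L2_eq G (shifted_op G \<i> f) g"
    using wp g by (auto simp: well_posed_def solution_def)
  then show s: "solution \<A> (resolvent G \<i> \<A> g) g"
    unfolding solution_def resolvent_def by (rule someI_ex)
  show "H2_norm G (resolvent G \<i> \<A> g) \<le> K * L2_norm G g"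
    by (rule well_posed_norm[OF wp s g])
qed

lemma well_posed_imp_continuously_invertible:
  assumes wp: "well_posed \<A> K"
  shows "continuously_invertible G \<i> \<A>"
  unfolding continuously_invertible_def
proof (intro exI[of _ "resolvent G \<i> \<A>"] conjI ballI allI impI)
  have u: "unique_solvable \<A>" using wp by (simp add: well_posed_def)
  note R = well_posed_resolvent[OF wp]
  show "resolvent G \<i> \<A> g \<in> op_domain G \<A>" "L2_eq G (shifted_op G \<i> (resolvent G \<i> \<A> g)) g" if "g \<in> L2 G" for g
    using R(1)[OF that] by (auto simp: solution_def)
  show "L2_eq G (resolvent G \<i> \<A> (shifted_op G \<i> f)) f" if f: "f \<in> op_domain G \<A>" for f
  proof (rule solution_unique[OF u])
    show "solution \<A> (resolvent G \<i> \<A> (shifted_op G \<i> f)) (shifted_op G \<i> f)"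
      using f by (intro R shifted_op_L2) (simp add: op_domain_iff)
    show "solution \<A> f (shifted_op G \<i> f)" using f by (simp add: solution_def)
  qed
  fix g and \<epsilon> :: real assume g: "g \<in> L2 G" and \<epsilon>: "\<epsilon> > 0"
  show "\<exists>\<delta>>0. \<forall>g'\<in>L2 G. L2_norm G (\<lambda>e x. g' e x - g e x) < \<delta> \<longrightarrow>
      H2_norm G (\<lambda>e x. resolvent G \<i> \<A> g' e x - resolvent G \<i> \<A> g e x) < \<epsilon>"
  \<comment> \<open>The denominator is positive whatever the sign of K.\<close>
  proof (intro exI[of _ "\<epsilon> / (\<bar>K\<bar> + 1)"] conjI ballI impI)
    fix g' assume g': "g' \<in> L2 G" and d: "L2_norm G (\<lambda>e x. g' e x - g e x) < \<epsilon> / (\<bar>K\<bar> + 1)"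
    have "solution \<A> (\<lambda>e x. 1 * resolvent G \<i> \<A> g' e x + (- 1) * resolvent G \<i> \<A> g e x) (\<lambda>e x. 1 * g' e x + (- 1) * g e x)"
      by (rule solution_linear[OF R(1)[OF g'] R(1)[OF g]])
    moreover have "(\<lambda>e x. 1 * g' e x + (- 1) * g e x) \<in> L2 G"
      by (rule L2_linear[OF g' g])
    ultimately have "H2_norm G (\<lambda>e x. resolvent G \<i> \<A> g' e x - resolvent G \<i> \<A> g e x) \<le> K * L2_norm G (\<lambda>e x. g' e x - g e x)"
      using well_posed_norm[OF wp] by simp
    also have "\<dots> \<le> (\<bar>K\<bar> + 1) * L2_norm G (\<lambda>e x. g' e x - g e x)"
      by (intro mult_right_mono) auto
    also have "\<dots> < \<epsilon>" using d by (simp add: field_simps)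
    finally show "H2_norm G (\<lambda>e x. resolvent G \<i> \<A> g' e x - resolvent G \<i> \<A> g e x) < \<epsilon>" .
  qed (use \<epsilon> in simp)
qed

text \<open>A kernel vector of the matrix gives a homogeneous solution that meets all conditions and
  is nonzero by independence of the exponentials. Conversely, every homogeneous solution is a
  combination of exponentials, and its coefficients form a kernel vector.\<close>

lemma unique_solvable_iff_det: "unique_solvable \<A> \<longleftrightarrow> Determinant.det (condition_matrix \<A>) \<noteq> 0"
proof
  let ?M = "condition_matrix \<A>"
  have mult: "(?M *\<^sub>v v) $ k = (\<Sum>l<n_ends. ?M $$ (k, l) * v $ l)" if "k < n_ends" "v \<in> carrier_vec n_ends" for k v
    using that condition_matrix_carrier[of \<A>] by (auto simp: scalar_prod_def lessThan_atLeast0)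
  {
    assume u: "unique_solvable \<A>"
    show "Determinant.det ?M \<noteq> 0"
    proof
      assume "Determinant.det ?M = 0"
      then obtain v where v: "v \<in> carrier_vec n_ends" "v \<noteq> 0\<^sub>v n_ends" "?M *\<^sub>v v = 0\<^sub>v n_ends"
        using det_0_iff_vec_prod_zero[OF condition_matrix_carrier] by blast
      have "vertex_condition \<A> p (homogeneous (\<lambda>l. v $ l)) = 0" if "p \<in> vertex_rows" for p
      proof -
        from that obtain k where k: "k < n_ends" "p = row_enum k" by (rule row_enum_surj)
        show ?thesis
          using vertex_condition_homogeneous[OF k(1), of \<A> "\<lambda>l. v $ l"] mult[OF k(1) v(1)] v(3) k by simp
      qed
      then have "solution \<A> (homogeneous (\<lambda>l. v $ l)) (\<lambda>e x. 0)"
        using homogeneous_H2 shifted_op_homogeneous by (simp add: solution_def op_domain_iff)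
      with u have "L2_eq G (homogeneous (\<lambda>l. v $ l)) (\<lambda>e x. 0)" by (simp add: unique_solvable_def)
      from homogeneous_independent[OF this] have "v = 0\<^sub>v n_ends"
        using v(1) by (intro eq_vecI) auto
      with v(2) show False by simp
    qed
  next
    assume d: "Determinant.det ?M \<noteq> 0"
    show "unique_solvable \<A>"
      unfolding unique_solvable_def
    proof (intro allI impI)
      fix f assume f: "solution \<A> f (\<lambda>e x. 0)"
      then have "L2_eq G (shifted_op G \<i> f) (\<lambda>e x. 0)" by (simp add: solution_def)
      then obtain c where c: "L2_eq G f (homogeneous c)"
        by (rule homogeneous_solution[OF solution_H2[OF f]])
      define v where "v = Matrix.vec n_ends c"
      have "?M *\<^sub>v v = 0\<^sub>v n_ends"
      proof (rule eq_vecI)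
        fix k assume k: "k < dim_vec (0\<^sub>v n_ends)"
        then have k': "k < n_ends" by simp
        have "row_enum k \<in> vertex_rows" using bij_betw_apply[OF row_enum] k' by simp
        then have "0 = vertex_condition \<A> (row_enum k) f"
          using f unfolding solution_def op_domain_iff by auto
        also have "\<dots> = vertex_condition \<A> (row_enum k) (homogeneous c)"
          by (rule vertex_condition_cong[OF solution_H2[OF f] homogeneous_H2 c row_enum_mem(1)[OF k']])
        also have "\<dots> = (?M *\<^sub>v v) $ k"
          using vertex_condition_homogeneous[OF k'] mult[OF k', of v] by (simp add: v_def)
        finally show "(?M *\<^sub>v v) $ k = 0\<^sub>v n_ends $ k" using k' by simp
      qed (use condition_matrix_carrier[of \<A>] in simp)
      then have "v = 0\<^sub>v n_ends"
        using d det_0_iff_vec_prod_zero[OF condition_matrix_carrier] by (metis v_def vec_carrier)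
      then have "c l = 0" if "l < n_ends" for l
        using that by (metis index_vec index_zero_vec(1) v_def)
      then have "homogeneous c = (\<lambda>e x. 0)" by (simp add: homogeneous_def)
      with c show "L2_eq G f (\<lambda>e x. 0)" by simp
    qed
  }
qed

section \<open>Transport of solutions to other vertex conditions\<close>

definition correction :: "('v \<Rightarrow> complex Matrix.mat) \<Rightarrow> nat \<Rightarrow> nat \<Rightarrow> complex" where
  "correction \<B> l k = - adj_mat (condition_matrix \<B>) $$ (l, k) / Determinant.det (condition_matrix \<B>)"

text \<open>f solves the equation but misses the conditions of \<B> by certain defects.
  \<open>correction \<B>\<close> holds the entries of minus the inverse condition matrix, so the
  added combination of exponentials produces exactly the negative defects while leaving the equation
  intact.\<close>

lemma solution_perturb:
  assumes f: "solution \<A> f g" and d: "Determinant.det (condition_matrix \<B>) \<noteq> 0"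
  shows "solution \<B> (\<lambda>e x. f e x + homogeneous (\<lambda>l. \<Sum>k<n_ends. correction \<B> l k * vertex_condition \<B> (row_enum k) f) e x) g"
proof -
  let ?M = "condition_matrix \<B>"
  let ?b = "\<lambda>k. vertex_condition \<B> (row_enum k) f"
  define c where "c l = (\<Sum>k<n_ends. correction \<B> l k * ?b k)" for l
  define F where "F = (\<lambda>m::bool. if m then homogeneous c else f)"
  have F: "F m \<in> H2 G" for m using solution_H2[OF f] homogeneous_H2 by (simp add: F_def)
  have eq: "(\<lambda>e x. \<Sum>m\<in>UNIV. 1 * F m e x) = (\<lambda>e x. f e x + homogeneous c e x)"
    by (simp add: F_def UNIV_bool)
  have "vertex_condition \<B> p (\<lambda>e x. f e x + homogeneous c e x) = 0" if "p \<in> vertex_rows" for p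
  proof -
    from that obtain k where k: "k < n_ends" "p = row_enum k" by (rule row_enum_surj)
    have "vertex_condition \<B> p (\<lambda>e x. \<Sum>m\<in>UNIV. 1 * F m e x) = (\<Sum>m\<in>UNIV. 1 * vertex_condition \<B> p (F m))"
      using that by (intro vertex_condition_sum F) auto
    then have "vertex_condition \<B> p (\<lambda>e x. f e x + homogeneous c e x) = ?b k + (\<Sum>l<n_ends. ?M $$ (k, l) * c l)"
      unfolding eq using k vertex_condition_homogeneous[OF k(1)] by (simp add: F_def UNIV_bool)
    also have "(\<Sum>l<n_ends. ?M $$ (k, l) * c l) =
        - (\<Sum>l<n_ends. ?M $$ (k, l) * (\<Sum>k'<n_ends. adj_mat ?M $$ (l, k') / Determinant.det ?M * ?b k'))"
      by (simp add: c_def correction_def sum_negf)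
    also have "\<dots> = - ?b k"
      using adj_mat_solves[OF condition_matrix_carrier d k(1)] by simp
    finally show ?thesis by simp
  qed
  moreover have "(\<lambda>e x. f e x + homogeneous c e x) \<in> H2 G"
    using H2_linear[OF solution_H2[OF f] homogeneous_H2, of 1 1 c] by simp
  moreover have "L2_eq G (shifted_op G \<i> (\<lambda>e x. f e x + homogeneous c e x)) g"
  proof -
    have 1: "L2_eq G (shifted_op G \<i> (\<lambda>e x. \<Sum>m\<in>UNIV. 1 * F m e x)) (\<lambda>e x. \<Sum>m\<in>UNIV. 1 * shifted_op G \<i> (F m) e x)"
      by (intro H2_sum(4) F) simp
    have 2: "L2_eq G (shifted_op G \<i> (\<lambda>e x. f e x + homogeneous c e x)) (\<lambda>e x. 1 * shifted_op G \<i> f e x + 1 * shifted_op G \<i> (homogeneous c) e x)"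
      using 1 unfolding eq by (simp add: F_def UNIV_bool)
    have 3: "L2_eq G (\<lambda>e x. 1 * shifted_op G \<i> f e x + 1 * shifted_op G \<i> (homogeneous c) e x) (\<lambda>e x. 1 * g e x + 1 * 0)"
      using f shifted_op_homogeneous by (intro L2_eq_linear) (simp_all add: solution_def)
    from L2_eq_trans[OF 2 3] show ?thesis by simp
  qed
  ultimately have "solution \<B> (\<lambda>e x. f e x + homogeneous c e x) g"
    by (simp add: solution_def op_domain_iff)
  then show ?thesis by (simp only: c_def[abs_def])
qed

lemma vertex_condition_bound:
  assumes "f \<in> H2 G" "fst p \<in> vertices G"
  shows "cmod (vertex_condition \<A> p f) \<le>
    (\<Sum>j<2 * deg G (fst p). cmod (\<A> (fst p) $$ (snd p, j)) * trace_const) * H2_norm G f"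
  unfolding vertex_condition_def sum_distrib_right
proof (rule sum_norm_le)
  fix j assume "j \<in> {..<2 * deg G (fst p)}"
  then show "cmod (\<A> (fst p) $$ (snd p, j) * vertex_trace (fst p) j f) \<le>
      cmod (\<A> (fst p) $$ (snd p, j)) * trace_const * H2_norm G f"
    using vertex_trace_bound[OF assms] by (simp add: norm_mult mult.assoc mult_left_mono)
qed

text \<open>The coefficients of the correction are linear in the traces of f, hence bounded by C l
  times its H^2 norm; D collects these bounds for the whole correction. The factor 2 is the number
  of summands in f plus correction.\<close>

lemma well_posed_perturb:
  assumes wp: "well_posed \<A> K" and d: "Determinant.det (condition_matrix \<B>) \<noteq> 0"
  obtains K' where "well_posed \<B> K'"
proof -
  define C where "C l = (\<Sum>k<n_ends. cmod (correction \<B> l k) *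
    (\<Sum>j<2 * deg G (fst (row_enum k)). cmod (\<B> (fst (row_enum k)) $$ (snd (row_enum k), j)) * trace_const))" for l
  define D where "D = real n_ends * (\<Sum>l<n_ends. C l * H2_norm G (basis (end_enum l)))"
  have C0: "0 \<le> C l" for l
    unfolding C_def using trace_const_nonneg by (intro sum_nonneg mult_nonneg_nonneg) auto
  have D0: "0 \<le> D" unfolding D_def using C0 by (intro mult_nonneg_nonneg sum_nonneg) auto
  have K: "well_posed \<B> (2 * (1 + D) * K)"
    unfolding well_posed_def
  proof (intro conjI ballI)
    show "unique_solvable \<B>" using d by (simp add: unique_solvable_iff_det)
    fix g assume g: "g \<in> L2 G"
    define f where "f = resolvent G \<i> \<A> g"
    define c where "c l = (\<Sum>k<n_ends. correction \<B> l k * vertex_condition \<B> (row_enum k) f)" for l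
    have f: "solution \<A> f g" "H2_norm G f \<le> K * L2_norm G g"
      unfolding f_def by (rule well_posed_resolvent[OF wp g])+
    note fH = solution_H2[OF f(1)]
    have c: "cmod (c l) \<le> C l * H2_norm G f" for l
      unfolding c_def C_def sum_distrib_right
    proof (rule sum_norm_le)
      fix k assume "k \<in> {..<n_ends}"
      then show "cmod (correction \<B> l k * vertex_condition \<B> (row_enum k) f) \<le> cmod (correction \<B> l k) *
          (\<Sum>j<2 * deg G (fst (row_enum k)). cmod (\<B> (fst (row_enum k)) $$ (snd (row_enum k), j)) * trace_const) * H2_norm G f"
        using vertex_condition_bound[OF fH row_enum_mem(1)]
        by (simp add: norm_mult mult.assoc mult_left_mono)
    qed
    have "H2_norm G (homogeneous c) \<le> real n_ends * (\<Sum>l<n_ends. cmod (c l) * H2_norm G (basis (end_enum l)))"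
      using H2_norm_sum_le[of "{..<n_ends}" "\<lambda>l. basis (end_enum l)" c] basis_H2 by (simp add: homogeneous_def)
    also have "\<dots> \<le> real n_ends * (\<Sum>l<n_ends. C l * H2_norm G f * H2_norm G (basis (end_enum l)))"
      using c by (intro mult_left_mono sum_mono mult_right_mono) auto
    also have "\<dots> = D * H2_norm G f" by (simp add: D_def sum_distrib_left sum_distrib_right mult_ac)
    finally have h: "H2_norm G (homogeneous c) \<le> D * H2_norm G f" .
    define F where "F = (\<lambda>m::bool. if m then homogeneous c else f)"
    have F: "F m \<in> H2 G" for m using fH homogeneous_H2 by (simp add: F_def)
    have "H2_norm G (\<lambda>e x. \<Sum>m\<in>UNIV. 1 * F m e x) \<le> real (card (UNIV :: bool set)) * (\<Sum>m\<in>UNIV. cmod 1 * H2_norm G (F m))"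
      by (intro H2_norm_sum_le F) simp
    then have "H2_norm G (\<lambda>e x. f e x + homogeneous c e x) \<le> 2 * (H2_norm G f + H2_norm G (homogeneous c))"
      by (simp add: F_def UNIV_bool)
    also have "\<dots> \<le> 2 * (1 + D) * H2_norm G f" using h by (simp add: algebra_simps)
    also have "\<dots> \<le> 2 * (1 + D) * (K * L2_norm G g)" using f(2) D0 by (intro mult_left_mono) auto
    finally have "H2_norm G (\<lambda>e x. f e x + homogeneous c e x) \<le> 2 * (1 + D) * K * L2_norm G g"
      by (simp add: mult.assoc)
    moreover have "solution \<B> (\<lambda>e x. f e x + homogeneous c e x) g"
      using solution_perturb[OF f(1) d] by (simp only: c_def[abs_def])
    ultimately show "\<exists>f. solution \<B> f g \<and> H2_norm G f \<le> 2 * (1 + D) * K * L2_norm G g" by blast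
  qed
  show thesis by (rule that[OF K])
qed

text \<open>To hit y with (A B) at v, solve the full linear system with right-hand side y in the
  rows of v and 0 elsewhere. The traces at v of the resulting combination of exponentials are a
  preimage of y.\<close>

lemma det_nonzero_imp_U:
  assumes \<A>: "\<A> \<in> param_space G" and d: "Determinant.det (condition_matrix \<A>) \<noteq> 0"
  shows "\<A> \<in> U G"
proof -
  let ?M = "condition_matrix \<A>"
  have "vec_space.rank (deg G v) (\<A> v) = deg G v" if v: "v \<in> vertices G" for v
  proof (rule rank_surjective)
    show Av: "\<A> v \<in> carrier_mat (deg G v) (2 * deg G v)"
      using \<A> v by (auto simp: param_space_def)
    fix y :: "complex Matrix.vec" assume y: "y \<in> carrier_vec (deg G v)"
    define b where "b k = (if fst (row_enum k) = v then y $ snd (row_enum k) else 0)" for k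
    define c where "c l = (\<Sum>k<n_ends. adj_mat ?M $$ (l, k) / Determinant.det ?M * b k)" for l
    have Mc: "(\<Sum>l<n_ends. ?M $$ (k, l) * c l) = b k" if "k < n_ends" for k
      unfolding c_def by (rule adj_mat_solves[OF condition_matrix_carrier d that])
    show "\<exists>x\<in>carrier_vec (2 * deg G v). \<A> v *\<^sub>v x = y"
    proof (rule bexI[of _ "Matrix.vec (2 * deg G v) (\<lambda>j. vertex_trace v j (homogeneous c))"])
      show "\<A> v *\<^sub>v Matrix.vec (2 * deg G v) (\<lambda>j. vertex_trace v j (homogeneous c)) = y"
      proof (rule eq_vecI)
        fix i assume "i < dim_vec y"
        then have i: "i < deg G v" using y by simp
        obtain k where k: "k < n_ends" "(v, i) = row_enum k"
          by (rule row_enum_surj[of "(v, i)"]) (use v i in auto)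
        note k(2)[symmetric, simp]
        have "(\<A> v *\<^sub>v Matrix.vec (2 * deg G v) (\<lambda>j. vertex_trace v j (homogeneous c))) $ i =
            vertex_condition \<A> (row_enum k) (homogeneous c)"
          using Av i by (auto simp: vertex_condition_def scalar_prod_def lessThan_atLeast0)
        also have "\<dots> = y $ i"
          using vertex_condition_homogeneous[OF k(1)] Mc[OF k(1)] by (simp add: b_def)
        finally show "(\<A> v *\<^sub>v Matrix.vec (2 * deg G v) (\<lambda>j. vertex_trace v j (homogeneous c))) $ i = y $ i" .
      qed (use Av y in auto)
    qed simp
  qed
  with \<A> show ?thesis by (simp add: U_def)
qed

end

section \<open>Compactness and analyticity of the resolvent\<close>

text \<open>Successive extraction, one index at a time; stability of P under further extraction
  preserves what was gained before.\<close>

lemma common_subsequence: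
  fixes P :: "'e \<Rightarrow> (nat \<Rightarrow> nat) \<Rightarrow> bool"
  assumes "finite E"
    and ex: "\<And>e (s :: nat \<Rightarrow> nat). e \<in> E \<Longrightarrow> strict_mono s \<Longrightarrow> \<exists>k. strict_mono k \<and> P e (s \<circ> k)"
    and sub: "\<And>e s k. P e s \<Longrightarrow> strict_mono k \<Longrightarrow> P e (s \<circ> k)"
  shows "\<exists>s. strict_mono s \<and> (\<forall>e\<in>E. P e s)"
  using assms(1) ex
proof (induction E)
  case empty
  show ?case by (rule exI[of _ id]) (simp add: strict_mono_def)
next
  case (insert e E)
  then obtain s where s: "strict_mono s" "\<forall>e\<in>E. P e s" by auto
  obtain k where k: "strict_mono k" "P e (s \<circ> k)"
    using insert.prems[of e s] s(1) by blast
  have "strict_mono (s \<circ> k)" by (rule strict_mono_o[OF s(1) k(1)])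
  moreover have "\<forall>j\<in>insert e E. P j (s \<circ> k)" using s(2) k sub by blast
  ultimately show ?case by blast
qed

lemma L2_tendsto_of_uniform:
  fixes f :: "nat \<Rightarrow> real \<Rightarrow> complex"
  assumes L: "L > 0" and f: "\<And>n. f n \<in> L2_interval L" and h: "continuous_on {0..L} h"
    and u: "\<And>n. AE x in leb L. u n x = f n x"
    and unif: "\<And>\<epsilon>. \<epsilon> > 0 \<Longrightarrow> \<exists>N. \<forall>n\<ge>N. \<forall>x\<in>{0..L}. norm (u n x - h x) < \<epsilon>"
  shows "(\<lambda>n. LINT x|leb L. (cmod (f n x - h x))\<^sup>2) \<longlonglongrightarrow> 0"
proof (rule LIMSEQ_I)
  fix r :: real assume r: "r > 0"
  let ?M = "leb L"
  interpret finite_measure ?M by (rule finite_measure_interval)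
  have mL: "measure ?M (space ?M) = L"
    using L by (simp add: measure_restrict_space space_restrict_space)
  \<comment> \<open>Chosen so that d^2 L = r L / (L + 1) < r.\<close>
  define d where "d = sqrt (r / (L + 1))"
  have d: "d > 0" "d\<^sup>2 * L < r"
    using L r by (auto simp: d_def field_simps)
  obtain N where N: "\<And>n x. n \<ge> N \<Longrightarrow> x \<in> {0..L} \<Longrightarrow> norm (u n x - h x) < d"
    using unif[OF d(1)] by blast
  have "norm ((LINT x|?M. (cmod (f n x - h x))\<^sup>2) - 0) < r" if n: "n \<ge> N" for n
  proof -
    have i: "integrable ?M (\<lambda>x. (cmod (f n x - h x))\<^sup>2)"
      using L2_intervalD(2)[OF L2_interval_linear[OF f[of n] L2_interval_continuous[OF h], of 1 "-1"]] by simp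
    have "AE x in ?M. x \<in> {0..L}" by (rule AE_I2) (simp add: space_restrict_space)
    with u[of n] have "AE x in ?M. (cmod (f n x - h x))\<^sup>2 \<le> d\<^sup>2"
    proof eventually_elim
      case (elim x)
      have "norm (u n x - h x) < d" by (rule N[OF n elim(2)])
      then show ?case unfolding elim(1) by (intro power_mono) auto
    qed
    then have "(LINT x|?M. (cmod (f n x - h x))\<^sup>2) \<le> (LINT x|?M. d\<^sup>2)"
      using i by (intro integral_mono_AE) auto
    also have "\<dots> = d\<^sup>2 * L" using mL by simp
    finally have "(LINT x|?M. (cmod (f n x - h x))\<^sup>2) < r" using d(2) by simp
    moreover have "0 \<le> (LINT x|?M. (cmod (f n x - h x))\<^sup>2)" by (auto intro: integral_nonneg_AE)
    ultimately show ?thesis by simp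
  qed
  then show "\<exists>N. \<forall>n\<ge>N. norm ((LINT x|?M. (cmod (f n x - h x))\<^sup>2) - 0) < r" by blast
qed

lemma analytic_at_0_common_radius_finite:
  assumes "finite J" "\<And>m. m \<in> J \<Longrightarrow> analytic_at_0 I (q m)"
  shows "\<exists>r>0. \<forall>m\<in>J. \<exists>K. power_series_on I r K (q m)"
  using assms
proof (induction J)
  case empty
  show ?case by (rule exI[of _ 1]) simp
next
  case (insert m J)
  then obtain r where r: "r > 0" "\<forall>m\<in>J. \<exists>K. power_series_on I r K (q m)" by auto
  from insert.prems[of m] obtain s L where s: "s > 0" "power_series_on I s L (q m)"
    by (auto simp: analytic_at_0_def)
  have t: "min r s > 0" "min r s \<le> r" "min r s \<le> s" using r s by auto
  have "\<exists>K. power_series_on I (min r s) K (q j)" if "j \<in> insert m J" for j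
    using that r(2) s(2) power_series_on_mono[OF _ t(1)] t(2,3) by blast
  with t(1) show ?case by blast
qed

section \<open>Boundedness and compactness of the resolvent\<close>

context metric_graph_context
begin

lemma bounded_operator_resolvent:
  assumes wp: "well_posed \<A> K"
  shows "bounded_operator G (resolvent G \<i> \<A>)"
  unfolding bounded_operator_def
proof (intro conjI allI ballI exI)
  note R = well_posed_resolvent[OF wp]
  show "resolvent G \<i> \<A> g \<in> L2 G" if "g \<in> L2 G" for g
    by (rule H2_subset_L2[OF solution_H2[OF R(1)[OF that]]])
  show "L2_eq G (resolvent G \<i> \<A> (\<lambda>e x. a * f e x + b * g e x))
      (\<lambda>e x. a * resolvent G \<i> \<A> f e x + b * resolvent G \<i> \<A> g e x)"
    if "f \<in> L2 G" "g \<in> L2 G" for f g a b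
    by (rule solution_unique[OF _ R(1)[OF L2_linear[OF that]] solution_linear[OF R(1)[OF that(1)] R(1)[OF that(2)]]])
       (use wp in \<open>simp add: well_posed_def\<close>)
  show "L2_norm G (resolvent G \<i> \<A> g) \<le> K * L2_norm G g" if "g \<in> L2 G" for g
    using R(2)[OF that] L2_norm_le_H2_norm order_trans by blast
qed

lemma H2_bounded_subsequence:
  fixes f :: "nat \<Rightarrow> 'e \<Rightarrow> real \<Rightarrow> complex"
  assumes f: "\<And>n. f n \<in> H2 G" and B: "\<And>n. H2_norm G (f n) \<le> B"
  shows "\<exists>h\<in>L2 G. \<exists>s. strict_mono s \<and> (\<lambda>n. L2_norm G (\<lambda>e x. f (s n) e x - h e x)) \<longlonglongrightarrow> 0"
proof -
  define C where "C = trace_const * B"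
  have C0: "0 \<le> C"
    unfolding C_def using trace_const_nonneg B[of 0] H2_norm_nonneg[of "f 0"] by (intro mult_nonneg_nonneg) linarith+
  define u where "u e n = cont_rep (len e) (f n e)" for e n
  \<comment> \<open>Uniform convergence on e along s to some continuous limit, a property inherited
    by subsequences; this permits a common subsequence for all edges.\<close>
  define P where "P e s \<longleftrightarrow> (\<exists>h. continuous_on {0..len e} h \<and>
    (\<forall>\<epsilon>>0. \<exists>N. \<forall>n\<ge>N. \<forall>x\<in>{0..len e}. norm (u e (s n) x - h x) < \<epsilon>))" for e and s :: "nat \<Rightarrow> nat"
  have bnd: "cmod (u e n x) \<le> C" "cmod (cont_rep (len e) (weak_deriv (len e) (f n e)) x) \<le> C"
    if e: "e \<in> edges G" and x: "x \<in> {0..len e}" for e n x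
  proof -
    have "trace_const * H2_norm G (f n) \<le> C"
      unfolding C_def using trace_const_nonneg B by (intro mult_left_mono)
    with cont_rep_bound[OF f e x, of n] show "cmod (u e n x) \<le> C"
      "cmod (cont_rep (len e) (weak_deriv (len e) (f n e)) x) \<le> C"
      unfolding u_def edge_deriv_def by linarith+
  qed
  have "\<exists>s. strict_mono s \<and> (\<forall>e\<in>edges G. P e s)"
  proof (rule common_subsequence[OF finite_edges])
    fix e and s :: "nat \<Rightarrow> nat" assume e: "e \<in> edges G" and "strict_mono s"
    let ?S = "{0..len e}"
    have "\<exists>h (k :: nat \<Rightarrow> nat). continuous_on ?S h \<and> strict_mono k \<and>
      (\<forall>\<epsilon>>0. \<exists>N. \<forall>n x. n \<ge> N \<and> x \<in> ?S \<longrightarrow> norm (u e (s (k n)) x - h x) < \<epsilon>)"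
    proof (rule Arzela_Ascoli[of ?S "\<lambda>n x. u e (s n) x" C])
      show "compact ?S" by simp
      show "norm (u e (s n) x) \<le> C" if "x \<in> ?S" for n x by (rule bnd(1)[OF e that])
      show "\<exists>d>0. \<forall>n y. y \<in> ?S \<and> norm (x - y) < d \<longrightarrow> norm (u e (s n) x - u e (s n) y) < \<epsilon>"
        if x: "x \<in> ?S" and \<epsilon>: "0 < \<epsilon>" for x \<epsilon>
      \<comment> \<open>C is a common Lipschitz constant and may be 0; adding 1 avoids a zero
        denominator.\<close>
      proof (intro exI[of _ "\<epsilon> / (C + 1)"] conjI allI impI)
        show "0 < \<epsilon> / (C + 1)" using \<epsilon> C0 by simp
        fix n y assume y: "y \<in> ?S \<and> norm (x - y) < \<epsilon> / (C + 1)"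
        have "norm (u e (s n) x - u e (s n) y) \<le> C * \<bar>x - y\<bar>"
          unfolding u_def
          by (rule H2_cont_rep_Lipschitz[OF length_pos[OF e] H2D[OF f e] x]) (use y bnd(2)[OF e] in auto)
        also have "\<dots> \<le> (C + 1) * \<bar>x - y\<bar>" by (simp add: mult_right_mono)
        also have "\<dots> < \<epsilon>" using y C0 by (simp add: field_simps)
        finally show "norm (u e (s n) x - u e (s n) y) < \<epsilon>" .
      qed
    next
      fix h and k :: "nat \<Rightarrow> nat"
      assume hk: "continuous_on ?S h" "strict_mono k"
        "\<And>\<epsilon>. 0 < \<epsilon> \<Longrightarrow> \<exists>N. \<forall>n x. n \<ge> N \<and> x \<in> ?S \<longrightarrow> norm (u e (s (k n)) x - h x) < \<epsilon>"
      show ?thesis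
        by (rule exI[of _ h], rule exI[of _ k]) (intro conjI allI impI hk)
    qed
    then obtain h and k :: "nat \<Rightarrow> nat" where h: "continuous_on ?S h" "strict_mono k"
      and lim: "\<forall>\<epsilon>>0. \<exists>N. \<forall>n x. n \<ge> N \<and> x \<in> ?S \<longrightarrow> norm (u e (s (k n)) x - h x) < \<epsilon>"
      by blast
    have "P e (s \<circ> k)"
      unfolding P_def comp_apply
    proof (intro exI[of _ h] conjI allI impI h(1))
      fix \<epsilon> :: real assume "\<epsilon> > 0"
      with lim show "\<exists>N. \<forall>n\<ge>N. \<forall>x\<in>?S. norm (u e (s (k n)) x - h x) < \<epsilon>" by blast
    qed
    with h(2) show "\<exists>k. strict_mono k \<and> P e (s \<circ> k)" by blast
  next
    fix e and s k :: "nat \<Rightarrow> nat" assume P: "P e s" and k: "strict_mono k"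
    have "k n \<ge> N" if "n \<ge> N" for n N using strict_mono_imp_increasing[OF k, of n] that by linarith
    note kN = this
    from P obtain h where h: "continuous_on {0..len e} h"
      and lim: "\<forall>\<epsilon>>0. \<exists>N. \<forall>n\<ge>N. \<forall>x\<in>{0..len e}. norm (u e (s n) x - h x) < \<epsilon>"
      unfolding P_def by blast
    show "P e (s \<circ> k)"
      unfolding P_def comp_apply
    proof (intro exI[of _ h] conjI allI impI h)
      fix \<epsilon> :: real assume "\<epsilon> > 0"
      with lim obtain N where "\<forall>n\<ge>N. \<forall>x\<in>{0..len e}. norm (u e (s n) x - h x) < \<epsilon>" by blast
      with kN show "\<exists>N. \<forall>n\<ge>N. \<forall>x\<in>{0..len e}. norm (u e (s (k n)) x - h x) < \<epsilon>" by blast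
    qed
  qed
  then obtain s where s: "strict_mono s" and "\<forall>e\<in>edges G. P e s" by blast
  from bchoice[OF this(2)[unfolded P_def]]
  obtain h where h: "\<And>e. e \<in> edges G \<Longrightarrow> continuous_on {0..len e} (h e)"
    and lim: "\<And>e \<epsilon>. e \<in> edges G \<Longrightarrow> \<epsilon> > 0 \<Longrightarrow>
      \<exists>N. \<forall>n\<ge>N. \<forall>x\<in>{0..len e}. norm (u e (s n) x - h e x) < \<epsilon>"
    by blast
  have "h \<in> L2 G" using h by (auto simp: L2_def intro: L2_interval_continuous)
  moreover have "(\<lambda>n. LINT x|leb (len e). (cmod (f (s n) e x - h e x))\<^sup>2) \<longlonglongrightarrow> 0"
    if e: "e \<in> edges G" for e
  proof (rule L2_tendsto_of_uniform[OF length_pos[OF e] _ h[OF e], where u = "\<lambda>n. u e (s n)"])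
    note F = H2_intervalD(1)[OF H2D[OF f e]]
    show "f (s n) e \<in> L2_interval (len e)" for n by (rule H1_intervalD(1)[OF F])
    show "AE x in leb (len e). u e (s n) x = f (s n) e x" for n
      unfolding u_def by (rule H1_cont_rep(2)[OF length_pos[OF e] F])
  qed (rule lim[OF e])
  then have "(\<lambda>n. L2_norm G (\<lambda>e x. f (s n) e x - h e x)) \<longlonglongrightarrow> sqrt (\<Sum>e\<in>edges G. 0)"
    unfolding L2_norm_def by (intro tendsto_real_sqrt tendsto_sum)
  ultimately show ?thesis using s by auto
qed

lemma compact_operator_resolvent:
  assumes wp: "well_posed \<A> K"
  shows "compact_operator G (resolvent G \<i> \<A>)"
  unfolding compact_operator_def
proof (intro conjI allI impI)
  show "bounded_operator G (resolvent G \<i> \<A>)" by (rule bounded_operator_resolvent[OF wp])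
  fix g :: "nat \<Rightarrow> 'e \<Rightarrow> real \<Rightarrow> complex"
  assume "(\<forall>n. g n \<in> L2 G) \<and> (\<exists>K. \<forall>n. L2_norm G (g n) \<le> K)"
  then obtain B where g: "\<And>n. g n \<in> L2 G" and B: "\<And>n. L2_norm G (g n) \<le> B" by blast
  note R = well_posed_resolvent[OF wp g]
  show "\<exists>h\<in>L2 G. \<exists>s. strict_mono s \<and> (\<lambda>n. L2_norm G (\<lambda>e x. resolvent G \<i> \<A> (g (s n)) e x - h e x)) \<longlonglongrightarrow> 0"
  proof (rule H2_bounded_subsequence[where f = "\<lambda>n. resolvent G \<i> \<A> (g n)"])
    show "resolvent G \<i> \<A> (g n) \<in> H2 G" for n by (rule solution_H2[OF R(1)])
    show "H2_norm G (resolvent G \<i> \<A> (g n)) \<le> \<bar>K\<bar> * B" for n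
    proof -
      have "K * L2_norm G (g n) \<le> \<bar>K\<bar> * B"
        using B[of n] by (intro mult_mono) auto
      with R(2)[of n] show ?thesis by simp
    qed
  qed
qed

lemma bounded_operator_sum:
  assumes I: "finite I" and T: "\<And>m. m \<in> I \<Longrightarrow> bounded_operator G (T m)"
  shows "bounded_operator G (\<lambda>g e x. \<Sum>m\<in>I. c m * T m g e x)"
  unfolding bounded_operator_def
proof (intro conjI allI ballI)
  have TL: "T m g \<in> L2 G" if "m \<in> I" "g \<in> L2 G" for m g
    using T[OF that(1)] that(2) by (auto simp: bounded_operator_def)
  then show "(\<lambda>e x. \<Sum>m\<in>I. c m * T m g e x) \<in> L2 G" if "g \<in> L2 G" for g
    using that by (intro L2_sum) auto
  show "L2_eq G (\<lambda>e x. \<Sum>m\<in>I. c m * T m (\<lambda>e x. a * f e x + b * g e x) e x)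
      (\<lambda>e x. a * (\<Sum>m\<in>I. c m * T m f e x) + b * (\<Sum>m\<in>I. c m * T m g e x))"
    if fg: "f \<in> L2 G" "g \<in> L2 G" for f g a b
  proof -
    have "L2_eq G (\<lambda>e x. \<Sum>m\<in>I. c m * T m (\<lambda>e x. a * f e x + b * g e x) e x)
        (\<lambda>e x. \<Sum>m\<in>I. c m * (a * T m f e x + b * T m g e x))"
      by (rule L2_eq_sum[OF I, where g = "\<lambda>m e x. a * T m f e x + b * T m g e x"])
         (use T fg in \<open>auto simp: bounded_operator_def\<close>)
    moreover have "(\<lambda>e x. \<Sum>m\<in>I. c m * (a * T m f e x + b * T m g e x)) =
        (\<lambda>e x. a * (\<Sum>m\<in>I. c m * T m f e x) + b * (\<Sum>m\<in>I. c m * T m g e x))"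
      by (simp add: sum_distrib_left distrib_left sum.distrib mult_ac)
    ultimately show ?thesis by simp
  qed
  have "\<forall>m\<in>I. \<exists>K. \<forall>g\<in>L2 G. L2_norm G (T m g) \<le> K * L2_norm G g"
    using T by (auto simp: bounded_operator_def)
  then obtain K where K: "\<And>m g. m \<in> I \<Longrightarrow> g \<in> L2 G \<Longrightarrow> L2_norm G (T m g) \<le> K m * L2_norm G g"
    by metis
  show "\<exists>K. \<forall>g\<in>L2 G. L2_norm G (\<lambda>e x. \<Sum>m\<in>I. c m * T m g e x) \<le> K * L2_norm G g"
  proof (intro exI ballI)
    fix g assume g: "g \<in> L2 G"
    have "L2_norm G (\<lambda>e x. \<Sum>m\<in>I. c m * T m g e x) \<le> real (card I) * (\<Sum>m\<in>I. cmod (c m) * L2_norm G (T m g))"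
      by (intro L2_norm_sum_le I TL g)
    also have "\<dots> \<le> real (card I) * (\<Sum>m\<in>I. cmod (c m) * (K m * L2_norm G g))"
      using K g by (intro mult_left_mono sum_mono) auto
    also have "\<dots> = (real (card I) * (\<Sum>m\<in>I. cmod (c m) * K m)) * L2_norm G g"
      by (simp add: sum_distrib_right mult.assoc)
    finally show "L2_norm G (\<lambda>e x. \<Sum>m\<in>I. c m * T m g e x) \<le> (real (card I) * (\<Sum>m\<in>I. cmod (c m) * K m)) * L2_norm G g" .
  qed
qed

section \<open>Operator norms and finite combinations of operators with analytic
  coefficients\<close>

lemma operator_norm_bounds:
  assumes "\<And>g. g \<in> L2 G \<Longrightarrow> L2_norm G g \<le> 1 \<Longrightarrow> L2_norm G (T g) \<le> B"
  shows "operator_norm G T \<le> B" "0 \<le> operator_norm G T"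
proof -
  have z: "(\<lambda>e x. 0) \<in> {g \<in> L2 G. L2_norm G g \<le> 1}"
    using L2_zero by (simp add: L2_norm_def)
  then show "operator_norm G T \<le> B"
    unfolding operator_norm_def using assms by (intro cSUP_least) auto
  have "bdd_above ((\<lambda>g. L2_norm G (T g)) ` {g \<in> L2 G. L2_norm G g \<le> 1})"
    using assms by (intro bdd_aboveI2) auto
  then show "0 \<le> operator_norm G T"
    unfolding operator_norm_def by (rule cSUP_upper2[OF _ z L2_norm_nonneg])
qed

lemma finite_coords: "finite (coords G)"
proof -
  have "coords G = (SIGMA v:vertices G. {..<deg G v} \<times> {..<2 * deg G v})"
    by (auto simp: coords_def)
  then show ?thesis by simp
qed

text \<open>The operator coefficient at \<alpha> combines the T m with the scalar coefficients at
  \<alpha>, so the remainder of a partial sum is the combination of the T m with the scalar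
  remainders \<open>w F m\<close>. These tend to 0, and there are finitely many. R has to match the
  combination only a.e., as resolvents are choices.\<close>

lemma analytic_combination_of_operators:
  assumes I: "finite I" and T': "\<forall>m\<in>I. bounded_operator G (T m)"
    and q: "\<forall>m\<in>I. analytic_at_0 (coords G) (q m)"
  shows "\<exists>r>0. \<exists>C. (\<forall>\<alpha>. bounded_operator G (C \<alpha>)) \<and>
    (\<forall>h R. (\<forall>c\<in>coords G. cmod (h c) < r) \<longrightarrow>
      (\<forall>g\<in>L2 G. R g \<in> L2 G \<and> L2_eq G (R g) (\<lambda>e x. \<Sum>m\<in>I. q m h * T m g e x)) \<longrightarrow>
      ((\<lambda>F. operator_norm G (\<lambda>g e x. R g e x - (\<Sum>\<alpha>\<in>F. monom_at (coords G) h \<alpha> * C \<alpha> g e x)))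
        \<longlongrightarrow> 0) (finite_subsets_at_top (multi_indices G)))"
proof -
  note T = bspec[OF T']
  obtain r where r: "r > 0" "\<forall>m\<in>I. \<exists>K. power_series_on (coords G) r K (q m)"
    using analytic_at_0_common_radius_finite[OF I, of "coords G" q] q by blast
  then have "\<forall>m\<in>I. \<exists>a. \<forall>h. (\<forall>c\<in>coords G. norm (h c) < r) \<longrightarrow>
      ((\<lambda>\<alpha>. a \<alpha> * monom_at (coords G) h \<alpha>) has_sum q m h) (multi_indices G)"
    unfolding power_series_on_def power_series_coeffs_def multi_indices_def by blast
  from bchoice[OF this] obtain a where a: "\<And>m h. m \<in> I \<Longrightarrow> \<forall>c\<in>coords G. norm (h c) < r \<Longrightarrow>
      ((\<lambda>\<alpha>. a m \<alpha> * monom_at (coords G) h \<alpha>) has_sum q m h) (multi_indices G)"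
    by blast
  define C where "C \<alpha> = (\<lambda>g e x. \<Sum>m\<in>I. a m \<alpha> * T m g e x)" for \<alpha>
  have "\<forall>m\<in>I. \<exists>K. \<forall>g\<in>L2 G. L2_norm G (T m g) \<le> K * L2_norm G g"
    using T by (auto simp: bounded_operator_def)
  then obtain K where K: "\<And>m g. m \<in> I \<Longrightarrow> g \<in> L2 G \<Longrightarrow> L2_norm G (T m g) \<le> K m * L2_norm G g"
    by metis
  have TL: "T m g \<in> L2 G" if "m \<in> I" "g \<in> L2 G" for m g
    using T[OF that(1)] that(2) by (auto simp: bounded_operator_def)
  have Cb: "bounded_operator G (C \<alpha>)" for \<alpha>
    unfolding C_def by (rule bounded_operator_sum[OF I T])
  show ?thesis
  proof (intro exI[of _ r] exI[of _ C] conjI allI impI r(1) Cb)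
    fix h R
    assume h: "\<forall>c\<in>coords G. cmod (h c) < r"
      and R': "\<forall>g\<in>L2 G. R g \<in> L2 G \<and> L2_eq G (R g) (\<lambda>e x. \<Sum>m\<in>I. q m h * T m g e x)"
    have R: "\<And>g. g \<in> L2 G \<Longrightarrow> R g \<in> L2 G \<and> L2_eq G (R g) (\<lambda>e x. \<Sum>m\<in>I. q m h * T m g e x)"
      using R' by blast
    define mon where "mon \<alpha> = monom_at (coords G) h \<alpha>" for \<alpha>
    define w where "w F m = q m h - (\<Sum>\<alpha>\<in>F. a m \<alpha> * mon \<alpha>)" for F m
    define D where "D F = (\<lambda>g e x. R g e x - (\<Sum>\<alpha>\<in>F. mon \<alpha> * C \<alpha> g e x))" for F
    have bound: "L2_norm G (D F g) \<le> real (card I) * (\<Sum>m\<in>I. cmod (w F m) * \<bar>K m\<bar>)"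
      if F: "finite F" and g: "g \<in> L2 G" "L2_norm G g \<le> 1" for F g
    proof -
      have "(\<lambda>e x. 1 * R g e x + (-1) * (\<Sum>\<alpha>\<in>F. mon \<alpha> * C \<alpha> g e x)) \<in> L2 G"
        using R[OF g(1)] Cb g(1) by (intro L2_linear L2_sum) (auto simp: bounded_operator_def)
      then have DL: "D F g \<in> L2 G" by (simp add: D_def)
      have "L2_eq G (D F g) (\<lambda>e x. \<Sum>m\<in>I. w F m * T m g e x)"
      proof -
        have "(\<Sum>m\<in>I. q m h * T m g e x) - (\<Sum>\<alpha>\<in>F. mon \<alpha> * C \<alpha> g e x) = (\<Sum>m\<in>I. w F m * T m g e x)" for e x
        proof -
          have "(\<Sum>\<alpha>\<in>F. mon \<alpha> * C \<alpha> g e x) = (\<Sum>\<alpha>\<in>F. \<Sum>m\<in>I. a m \<alpha> * mon \<alpha> * T m g e x)"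
            by (simp add: C_def sum_distrib_left mult_ac)
          also have "\<dots> = (\<Sum>m\<in>I. (\<Sum>\<alpha>\<in>F. a m \<alpha> * mon \<alpha>) * T m g e x)"
            by (subst sum.swap) (simp only: sum_distrib_right)
          finally show ?thesis by (simp add: w_def left_diff_distrib sum_subtractf)
        qed
        note eq = this
        show ?thesis
        proof (rule L2_eqI)
          fix e assume e: "e \<in> edges G"
          have "AE x in leb (len e). R g e x = (\<Sum>m\<in>I. q m h * T m g e x)"
            using R[OF g(1)] e by (auto dest: L2_eqD)
          then show "AE x in leb (len e). D F g e x = (\<Sum>m\<in>I. w F m * T m g e x)"
            by eventually_elim (simp add: D_def eq)
        qed
      qed
      then have "L2_norm G (D F g) = L2_norm G (\<lambda>e x. \<Sum>m\<in>I. w F m * T m g e x)"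
        by (rule L2_norm_cong[OF _ DL]) (intro L2_sum TL g)
      also have "\<dots> \<le> real (card I) * (\<Sum>m\<in>I. cmod (w F m) * L2_norm G (T m g))"
        by (intro L2_norm_sum_le I TL g)
      also have "\<dots> \<le> real (card I) * (\<Sum>m\<in>I. cmod (w F m) * \<bar>K m\<bar>)"
      proof (intro mult_left_mono sum_mono)
        fix m assume m: "m \<in> I"
        have "L2_norm G (T m g) \<le> K m * L2_norm G g" by (rule K[OF m g(1)])
        also have "\<dots> \<le> \<bar>K m\<bar> * 1" using g(2) by (intro mult_mono) auto
        finally show "L2_norm G (T m g) \<le> \<bar>K m\<bar>" by simp
      qed auto
      finally show ?thesis .
    qed
    let ?flt = "finite_subsets_at_top (multi_indices G)"
    \<comment> \<open>The remainder estimate is stated for finite F, which holds eventually along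
      the filter.\<close>
    have fin: "\<forall>\<^sub>F F in ?flt. finite F"
      by (rule eventually_finite_subsets_at_top_weakI)
    have wlim: "((\<lambda>F. w F m) \<longlongrightarrow> 0) ?flt" if m: "m \<in> I" for m
    proof -
      have "((\<lambda>F. \<Sum>\<alpha>\<in>F. a m \<alpha> * mon \<alpha>) \<longlongrightarrow> q m h) ?flt"
        using a[OF m h] by (simp add: has_sum_def mon_def)
      then have "((\<lambda>F. q m h - (\<Sum>\<alpha>\<in>F. a m \<alpha> * mon \<alpha>)) \<longlongrightarrow> q m h - q m h) ?flt"
        by (intro tendsto_diff tendsto_const)
      then show ?thesis by (simp add: w_def)
    qed
    have "((\<lambda>F. real (card I) * (\<Sum>m\<in>I. cmod (w F m) * \<bar>K m\<bar>)) \<longlongrightarrow> real (card I) * (\<Sum>m\<in>I. cmod 0 * \<bar>K m\<bar>)) ?flt"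
      by (intro tendsto_mult tendsto_const tendsto_sum tendsto_norm wlim)
    then have lim: "((\<lambda>F. real (card I) * (\<Sum>m\<in>I. cmod (w F m) * \<bar>K m\<bar>)) \<longlongrightarrow> 0) ?flt" by simp
    have "((\<lambda>F. operator_norm G (D F)) \<longlongrightarrow> 0) ?flt"
    proof (rule tendsto_sandwich[OF _ _ tendsto_const lim])
      show "\<forall>\<^sub>F F in ?flt. 0 \<le> operator_norm G (D F)"
        using fin by eventually_elim (rule operator_norm_bounds(2)[OF bound])
      show "\<forall>\<^sub>F F in ?flt. operator_norm G (D F) \<le> real (card I) * (\<Sum>m\<in>I. cmod (w F m) * \<bar>K m\<bar>)"
        using fin by eventually_elim (rule operator_norm_bounds(1)[OF bound])
    qed
    then show "((\<lambda>F. operator_norm G (\<lambda>g e x. R g e x - (\<Sum>\<alpha>\<in>F. monom_at (coords G) h \<alpha> * C \<alpha> g e x)))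
        \<longlongrightarrow> 0) ?flt"
      by (simp add: D_def mon_def)
  qed
qed

section \<open>The resolvent near a regular parameter\<close>

lemma param_add_mem:
  assumes "\<A> \<in> param_space G" "H \<in> param_space G"
  shows "param_add G \<A> H \<in> param_space G"
  using assms unfolding param_add_def param_space_def
  by (intro restrict_PiE_iff[THEN iffD2] ballI add_carrier_mat) auto

lemma param_add_entry:
  assumes "H \<in> param_space G" "v \<in> vertices G" "i < deg G v" "j < 2 * deg G v"
  shows "param_add G \<A> H v $$ (i, j) = \<A> v $$ (i, j) + H v $$ (i, j)"
proof -
  have "H v \<in> carrier_mat (deg G v) (2 * deg G v)"
    using assms(1,2) by (auto simp: param_space_def)
  then show ?thesis using assms by (auto simp: param_add_def)
qed

text \<open>The condition matrix at \<A> + H, with the entries of H replaced by a free vector h of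
  coordinates: this is the form on which the scalar power series calculus operates. Its entries are
  affine in h.\<close>

definition perturbed_matrix ::
  "('v \<Rightarrow> complex Matrix.mat) \<Rightarrow> ('v \<times> nat \<times> nat \<Rightarrow> complex) \<Rightarrow> complex Matrix.mat" where
  "perturbed_matrix \<A> h = Matrix.mat n_ends n_ends (\<lambda>(k, l).
     \<Sum>j<2 * deg G (fst (row_enum k)).
       (\<A> (fst (row_enum k)) $$ (snd (row_enum k), j) + h (fst (row_enum k), snd (row_enum k), j)) *
         vertex_trace (fst (row_enum k)) j (basis (end_enum l)))"

lemma perturbed_matrix_carrier: "perturbed_matrix \<A> h \<in> carrier_mat n_ends n_ends"
  by (simp add: perturbed_matrix_def)

lemma perturbed_matrix_0: "perturbed_matrix \<A> (\<lambda>_. 0) = condition_matrix \<A>"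
  by (simp add: perturbed_matrix_def condition_matrix_def vertex_condition_def)

lemma condition_matrix_param_add:
  assumes "H \<in> param_space G"
  shows "condition_matrix (param_add G \<A> H) = perturbed_matrix \<A> (\<lambda>(v, i, j). H v $$ (i, j))"
  unfolding condition_matrix_def perturbed_matrix_def vertex_condition_def
  using param_add_entry[OF assms row_enum_mem] by (intro eq_matI) (auto intro!: sum.cong)

lemma row_enum_coords:
  assumes "k < n_ends" "j < 2 * deg G (fst (row_enum k))"
  shows "(fst (row_enum k), snd (row_enum k), j) \<in> coords G"
  using row_enum_mem[OF assms(1)] assms(2) by (simp add: coords_def)

lemma analytic_perturbed_matrix:
  assumes "k < n_ends" "l < n_ends"
  shows "analytic_at_0 (coords G) (\<lambda>h. perturbed_matrix \<A> h $$ (k, l))"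
proof -
  have "analytic_at_0 (coords G) (\<lambda>h. \<Sum>j<2 * deg G (fst (row_enum k)).
       (\<A> (fst (row_enum k)) $$ (snd (row_enum k), j) + h (fst (row_enum k), snd (row_enum k), j)) *
         vertex_trace (fst (row_enum k)) j (basis (end_enum l)))"
    by (intro analytic_at_0_sum analytic_at_0_mult analytic_at_0_add analytic_at_0_const analytic_at_0_coord
        finite_coords row_enum_coords assms) simp
  then show ?thesis using assms by (simp add: perturbed_matrix_def)
qed

lemma analytic_perturbed_inverse:
  assumes d: "Determinant.det (condition_matrix \<A>) \<noteq> 0"
  shows "analytic_at_0 (coords G) (\<lambda>h. 1 / Determinant.det (perturbed_matrix \<A> h))"
    and "\<exists>r>0. \<forall>h. (\<forall>c\<in>coords G. cmod (h c) < r) \<longrightarrow> Determinant.det (perturbed_matrix \<A> h) \<noteq> 0"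
proof -
  have "analytic_at_0 (coords G) (\<lambda>h. Determinant.det (perturbed_matrix \<A> h))"
    by (intro analytic_at_0_det[OF finite_coords perturbed_matrix_carrier] analytic_perturbed_matrix)
  from analytic_at_0_inverse[OF finite_coords this] d
  show "analytic_at_0 (coords G) (\<lambda>h. 1 / Determinant.det (perturbed_matrix \<A> h))"
    "\<exists>r>0. \<forall>h. (\<forall>c\<in>coords G. cmod (h c) < r) \<longrightarrow> Determinant.det (perturbed_matrix \<A> h) \<noteq> 0"
    by (simp_all add: perturbed_matrix_0)
qed

text \<open>\<open>None\<close> stands for the unperturbed resolvent. \<open>Some (l, k, j)\<close>
  stands for the contribution to exponential l of the part of the k-th defect that stems from the
  j-th trace.\<close>

definition perturbation_terms :: "(nat \<times> nat \<times> nat) option set" where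
  "perturbation_terms = insert None (Some `
     ({..<n_ends} \<times> Sigma {..<n_ends} (\<lambda>k. {..<2 * deg G (fst (row_enum k))})))"

definition term_coeff ::
  "('v \<Rightarrow> complex Matrix.mat) \<Rightarrow> (nat \<times> nat \<times> nat) option \<Rightarrow> ('v \<times> nat \<times> nat \<Rightarrow> complex) \<Rightarrow> complex" where
  "term_coeff \<A> m h = (case m of None \<Rightarrow> 1 | Some (l, k, j) \<Rightarrow>
     (-1) * adj_mat (perturbed_matrix \<A> h) $$ (l, k) * (1 / Determinant.det (perturbed_matrix \<A> h)) *
       h (fst (row_enum k), snd (row_enum k), j))"

text \<open>Apart from the resolvent itself these are operators of rank at most one, a trace
  functional times a fixed exponential. They do not involve h, which enters through
  \<open>term_coeff\<close> only.\<close>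

definition term_operator ::
  "('v \<Rightarrow> complex Matrix.mat) \<Rightarrow> (nat \<times> nat \<times> nat) option \<Rightarrow> ('e \<Rightarrow> real \<Rightarrow> complex) \<Rightarrow> 'e \<Rightarrow> real \<Rightarrow> complex" where
  "term_operator \<A> m g = (case m of None \<Rightarrow> resolvent G \<i> \<A> g | Some (l, k, j) \<Rightarrow>
     (\<lambda>e x. vertex_trace (fst (row_enum k)) j (resolvent G \<i> \<A> g) * basis (end_enum l) e x))"

lemma finite_perturbation_terms: "finite perturbation_terms"
  by (simp add: perturbation_terms_def)

lemma analytic_term_coeff:
  assumes d: "Determinant.det (condition_matrix \<A>) \<noteq> 0" and m: "m \<in> perturbation_terms"
  shows "analytic_at_0 (coords G) (term_coeff \<A> m)"
proof (cases m)
  case None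
  then have "term_coeff \<A> m = (\<lambda>h. 1)" by (simp add: term_coeff_def fun_eq_iff)
  then show ?thesis using analytic_at_0_const[OF finite_coords] by simp
next
  case (Some p)
  obtain l k j where p: "p = (l, k, j)" by (cases p)
  have lkj: "l < n_ends" "k < n_ends" "j < 2 * deg G (fst (row_enum k))"
    using m Some p by (auto simp: perturbation_terms_def)
  have "analytic_at_0 (coords G) (\<lambda>h. (-1) * adj_mat (perturbed_matrix \<A> h) $$ (l, k) *
      (1 / Determinant.det (perturbed_matrix \<A> h)) * h (fst (row_enum k), snd (row_enum k), j))"
    by (intro analytic_at_0_mult analytic_at_0_const analytic_at_0_coord analytic_perturbed_inverse(1) d
        analytic_at_0_adj_mat[OF finite_coords perturbed_matrix_carrier] analytic_perturbed_matrix
        finite_coords row_enum_coords lkj)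
  then show ?thesis
    using Some p by (simp add: term_coeff_def[abs_def])
qed

text \<open>Traces are bounded on H^2 and the resolvent is bounded into H^2. Linearity of the trace
  factor is exact, because traces do not distinguish a.e. equal functions.\<close>

lemma bounded_term_operator:
  assumes wp: "well_posed \<A> K" and m: "m \<in> perturbation_terms"
  shows "bounded_operator G (term_operator \<A> m)"
proof (cases m)
  case None
  then have "term_operator \<A> m = resolvent G \<i> \<A>" by (simp add: term_operator_def fun_eq_iff)
  then show ?thesis using bounded_operator_resolvent[OF wp] by simp
next
  case (Some p)
  obtain l k j where p: "p = (l, k, j)" by (cases p)
  let ?v = "fst (row_enum k)" and ?R = "resolvent G \<i> \<A>"
  have k: "k < n_ends" and j: "j < 2 * deg G ?v"
    using m Some p by (auto simp: perturbation_terms_def)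
  have T: "term_operator \<A> m g = (\<lambda>e x. vertex_trace ?v j (?R g) * basis (end_enum l) e x)" for g
    using Some p by (simp add: term_operator_def)
  note v = row_enum_mem(1)[OF k] and R = well_posed_resolvent[OF wp]
  have b: "basis (end_enum l) \<in> L2 G" by (rule H2_subset_L2[OF basis_H2])
  show ?thesis
    unfolding bounded_operator_def T
  proof (intro conjI allI ballI exI)
    show "(\<lambda>e x. vertex_trace ?v j (?R g) * basis (end_enum l) e x) \<in> L2 G" for g
      using L2_linear[OF b b, of "vertex_trace ?v j (?R g)" 0] by simp
    show "L2_eq G (\<lambda>e x. vertex_trace ?v j (?R (\<lambda>e x. a * f e x + b * g e x)) * basis (end_enum l) e x)
        (\<lambda>e x. a * (vertex_trace ?v j (?R f) * basis (end_enum l) e x) + b * (vertex_trace ?v j (?R g) * basis (end_enum l) e x))"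
      if fg: "f \<in> L2 G" "g \<in> L2 G" for f g a b
    proof -
      define F where "F = (\<lambda>m::bool. if m then ?R g else ?R f)"
      have F: "F m \<in> H2 G" for m
        using solution_H2[OF R(1)[OF fg(1)]] solution_H2[OF R(1)[OF fg(2)]] by (simp add: F_def)
      have eq: "(\<lambda>e x. \<Sum>m\<in>UNIV. (if m then b else a) * F m e x) = (\<lambda>e x. a * ?R f e x + b * ?R g e x)"
        by (simp add: F_def UNIV_bool)
      have s: "solution \<A> (\<lambda>e x. a * ?R f e x + b * ?R g e x) (\<lambda>e x. a * f e x + b * g e x)"
        by (rule solution_linear[OF R(1)[OF fg(1)] R(1)[OF fg(2)]])
      note s' = R(1)[OF L2_linear[OF fg]]
      have "L2_eq G (?R (\<lambda>e x. a * f e x + b * g e x)) (\<lambda>e x. a * ?R f e x + b * ?R g e x)"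
        by (rule solution_unique[OF _ s' s]) (use wp in \<open>simp add: well_posed_def\<close>)
      then have "vertex_trace ?v j (?R (\<lambda>e x. a * f e x + b * g e x)) =
          vertex_trace ?v j (\<lambda>e x. a * ?R f e x + b * ?R g e x)"
        by (intro vertex_trace_cong solution_H2[OF s'] solution_H2[OF s] v j)
      also have "\<dots> = vertex_trace ?v j (\<lambda>e x. \<Sum>m\<in>UNIV. (if m then b else a) * F m e x)"
        by (simp only: eq)
      also have "\<dots> = (\<Sum>m\<in>UNIV. (if m then b else a) * vertex_trace ?v j (F m))"
        by (intro vertex_trace_sum F v j) simp
      also have "\<dots> = a * vertex_trace ?v j (?R f) + b * vertex_trace ?v j (?R g)"
        by (simp add: F_def UNIV_bool)
      finally show ?thesis by (simp add: distrib_right mult.assoc)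
    qed
    show "L2_norm G (\<lambda>e x. vertex_trace ?v j (?R g) * basis (end_enum l) e x) \<le>
        (trace_const * K * L2_norm G (basis (end_enum l))) * L2_norm G g" if g: "g \<in> L2 G" for g
    proof -
      have "cmod (vertex_trace ?v j (?R g)) \<le> trace_const * H2_norm G (?R g)"
        by (rule vertex_trace_bound[OF solution_H2[OF R(1)[OF g]] v j])
      also have "\<dots> \<le> trace_const * (K * L2_norm G g)"
        by (rule mult_left_mono[OF R(2)[OF g] trace_const_nonneg])
      finally have "cmod (vertex_trace ?v j (?R g)) * L2_norm G (basis (end_enum l)) \<le>
          trace_const * (K * L2_norm G g) * L2_norm G (basis (end_enum l))"
        by (rule mult_right_mono) simp
      then show ?thesis unfolding L2_norm_scale by (simp only: mult_ac)
    qed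
  qed
qed

text \<open>The resolvent at \<A> satisfies the conditions of \<A>, so its defect for \<A> + H is
  due to H alone and is linear in h. Inserting this in the correction and expanding yields the
  finite sum.\<close>

lemma resolvent_perturbation:
  assumes wp: "well_posed \<A> K" and H: "H \<in> param_space G"
    and d: "Determinant.det (condition_matrix (param_add G \<A> H)) \<noteq> 0"
    and g: "g \<in> L2 G"
  defines "h \<equiv> \<lambda>(v, i, j). H v $$ (i, j)"
  shows "resolvent G \<i> (param_add G \<A> H) g \<in> L2 G"
    "L2_eq G (resolvent G \<i> (param_add G \<A> H) g)
       (\<lambda>e x. \<Sum>m\<in>perturbation_terms. term_coeff \<A> m h * term_operator \<A> m g e x)"
proof -
  let ?B = "param_add G \<A> H" and ?f = "resolvent G \<i> \<A> g"
  let ?v = "\<lambda>k. fst (row_enum k)" and ?i = "\<lambda>k. snd (row_enum k)"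
  obtain K' where wp': "well_posed ?B K'" by (rule well_posed_perturb[OF wp d])
  note RB = well_posed_resolvent(1)[OF wp' g] and RA = well_posed_resolvent(1)[OF wp g]
  show "resolvent G \<i> ?B g \<in> L2 G" by (rule H2_subset_L2[OF solution_H2[OF RB]])
  have M: "condition_matrix ?B = perturbed_matrix \<A> h"
    unfolding h_def by (rule condition_matrix_param_add[OF H])
  have cond: "vertex_condition ?B (row_enum k) ?f =
      (\<Sum>j<2 * deg G (?v k). h (?v k, ?i k, j) * vertex_trace (?v k) j ?f)" if k: "k < n_ends" for k
  proof -
    have "row_enum k \<in> vertex_rows" using bij_betw_apply[OF row_enum] k by simp
    moreover have "\<forall>p\<in>vertex_rows. vertex_condition \<A> p ?f = 0"
      using RA unfolding solution_def op_domain_iff by (elim conjE)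
    ultimately have "vertex_condition \<A> (row_enum k) ?f = 0" by (rule bspec[rotated])
    moreover have "vertex_condition ?B (row_enum k) ?f = vertex_condition \<A> (row_enum k) ?f +
        (\<Sum>j<2 * deg G (?v k). h (?v k, ?i k, j) * vertex_trace (?v k) j ?f)"
      unfolding vertex_condition_def sum.distrib[symmetric]
      using param_add_entry[OF H row_enum_mem[OF k]] by (intro sum.cong) (auto simp: h_def distrib_right)
    ultimately show ?thesis by simp
  qed
  define t where "t p = (case p of (l, k, j) \<Rightarrow> \<lambda>e x. term_coeff \<A> (Some (l, k, j)) h * term_operator \<A> (Some (l, k, j)) g e x)"
    for p :: "nat \<times> nat \<times> nat"
  have "solution ?B (\<lambda>e x. ?f e x + homogeneous (\<lambda>l. \<Sum>k<n_ends. correction ?B l k * vertex_condition ?B (row_enum k) ?f) e x) g"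
    by (rule solution_perturb[OF RA d])
  then have "L2_eq G (resolvent G \<i> ?B g)
      (\<lambda>e x. ?f e x + homogeneous (\<lambda>l. \<Sum>k<n_ends. correction ?B l k * vertex_condition ?B (row_enum k) ?f) e x)"
    by (rule solution_unique[OF wp'[unfolded well_posed_def, THEN conjunct1] RB])
  moreover have "?f e x + homogeneous (\<lambda>l. \<Sum>k<n_ends. correction ?B l k * vertex_condition ?B (row_enum k) ?f) e x =
      (\<Sum>m\<in>perturbation_terms. term_coeff \<A> m h * term_operator \<A> m g e x)" for e x
  proof -
    have "homogeneous (\<lambda>l. \<Sum>k<n_ends. correction ?B l k * vertex_condition ?B (row_enum k) ?f) e x =
        (\<Sum>l<n_ends. \<Sum>k<n_ends. \<Sum>j<2 * deg G (?v k). t (l, k, j) e x)"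
      unfolding homogeneous_def sum_distrib_right
    proof (intro sum.cong refl)
      fix l k assume "k \<in> {..<n_ends}"
      then have "correction ?B l k * vertex_condition ?B (row_enum k) ?f * basis (end_enum l) e x =
          correction ?B l k * (\<Sum>j<2 * deg G (?v k). h (?v k, ?i k, j) * vertex_trace (?v k) j ?f) * basis (end_enum l) e x"
        using cond by simp
      also have "\<dots> = (\<Sum>j<2 * deg G (?v k). t (l, k, j) e x)"
        by (simp add: sum_distrib_left sum_distrib_right t_def term_coeff_def term_operator_def correction_def M mult_ac)
      finally show "correction ?B l k * vertex_condition ?B (row_enum k) ?f * basis (end_enum l) e x =
          (\<Sum>j<2 * deg G (?v k). t (l, k, j) e x)" .
    qed
    also have "\<dots> = (\<Sum>p\<in>{..<n_ends} \<times> Sigma {..<n_ends} (\<lambda>k. {..<2 * deg G (?v k)}). t p e x)"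
      by (simp add: sum.Sigma sum.cartesian_product case_prod_unfold)
    also have "\<dots> = (\<Sum>m\<in>Some ` ({..<n_ends} \<times> Sigma {..<n_ends} (\<lambda>k. {..<2 * deg G (?v k)})).
        term_coeff \<A> m h * term_operator \<A> m g e x)"
      by (subst sum.reindex) (auto simp: t_def intro!: sum.cong)
    finally show ?thesis
      unfolding perturbation_terms_def by (subst sum.insert) (auto simp: term_coeff_def term_operator_def)
  qed
  ultimately show "L2_eq G (resolvent G \<i> ?B g) (\<lambda>e x. \<Sum>m\<in>perturbation_terms. term_coeff \<A> m h * term_operator \<A> m g e x)"
    by simp
qed

text \<open>The rank condition is recovered from well-posedness through the nonzero determinant, so
  regularity of a nearby parameter can be checked by the determinant alone.\<close>

lemma regular_set_iff: "\<A> \<in> U G - singular_set G \<longleftrightarrow> \<A> \<in> param_space G \<and> (\<exists>K. well_posed \<A> K)"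
proof
  assume "\<A> \<in> U G - singular_set G"
  then have "\<A> \<in> U G" "continuously_invertible G \<i> \<A>" by (auto simp: singular_set_def)
  moreover from this(2) obtain K where "well_posed \<A> K" by (rule continuously_invertible_imp_well_posed)
  ultimately show "\<A> \<in> param_space G \<and> (\<exists>K. well_posed \<A> K)"
    by (auto simp: U_def)
next
  assume *: "\<A> \<in> param_space G \<and> (\<exists>K. well_posed \<A> K)"
  then obtain K where K: "well_posed \<A> K" by blast
  then have "Determinant.det (condition_matrix \<A>) \<noteq> 0"
    using unique_solvable_iff_det by (simp add: well_posed_def)
  then show "\<A> \<in> U G - singular_set G"
    using * det_nonzero_imp_U well_posed_imp_continuously_invertible[OF K] by (auto simp: singular_set_def)
qed

lemma analytic_operator_family_resolvent:
  "analytic_operator_family G (U G - singular_set G) (resolvent G \<i>)"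
  unfolding analytic_operator_family_def
proof (intro conjI ballI)
  show "U G - singular_set G \<subseteq> param_space G" by (auto simp: U_def)
  fix \<A> assume "\<A> \<in> U G - singular_set G"
  then obtain K where \<A>: "\<A> \<in> param_space G" and wp: "well_posed \<A> K"
    using regular_set_iff by blast
  show "bounded_operator G (resolvent G \<i> \<A>)" by (rule bounded_operator_resolvent[OF wp])
  have d: "Determinant.det (condition_matrix \<A>) \<noteq> 0"
    using wp unique_solvable_iff_det by (simp add: well_posed_def)
  obtain r where r: "r > 0"
    "\<And>h. \<forall>c\<in>coords G. cmod (h c) < r \<Longrightarrow> Determinant.det (perturbed_matrix \<A> h) \<noteq> 0"
    using analytic_perturbed_inverse(2)[OF d] by blast
  note ex = analytic_combination_of_operators[of perturbation_terms "term_operator \<A>" "term_coeff \<A>",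
      OF finite_perturbation_terms]
  have "\<forall>m\<in>perturbation_terms. bounded_operator G (term_operator \<A> m)"
    "\<forall>m\<in>perturbation_terms. analytic_at_0 (coords G) (term_coeff \<A> m)"
    using bounded_term_operator[OF wp] analytic_term_coeff[OF d] by blast+
  from ex[OF this] obtain s C where s: "s > 0" and C: "\<forall>\<alpha>. bounded_operator G (C \<alpha>)"
    and lim: "\<forall>h R. (\<forall>c\<in>coords G. cmod (h c) < s) \<longrightarrow>
      (\<forall>g\<in>L2 G. R g \<in> L2 G \<and>
        L2_eq G (R g) (\<lambda>e x. \<Sum>m\<in>perturbation_terms. term_coeff \<A> m h * term_operator \<A> m g e x)) \<longrightarrow>
      ((\<lambda>F. operator_norm G (\<lambda>g e x. R g e x - (\<Sum>\<alpha>\<in>F. monom_at (coords G) h \<alpha> * C \<alpha> g e x)))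
        \<longlongrightarrow> 0) (finite_subsets_at_top (multi_indices G))"
    by (elim exE conjE)
  show "\<exists>r>0. \<exists>C. (\<forall>\<alpha>\<in>multi_indices G. bounded_operator G (C \<alpha>)) \<and>
      (\<forall>H\<in>param_space G. (\<forall>(v, i, j)\<in>coords G. cmod (H v $$ (i, j)) < r) \<longrightarrow>
         param_add G \<A> H \<in> U G - singular_set G \<and>
         ((\<lambda>F. operator_norm G (\<lambda>g e x.
              resolvent G \<i> (param_add G \<A> H) g e x - (\<Sum>\<alpha>\<in>F. monomial G H \<alpha> * C \<alpha> g e x)))
            \<longlongrightarrow> 0) (finite_subsets_at_top (multi_indices G)))"
  \<comment> \<open>Within r the determinant stays nonzero, so the parameters remain regular; within
    s the power series converge.\<close>
  proof (intro exI[of _ "min r s"] exI[of _ C] conjI ballI impI C[rule_format])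
    show "min r s > 0" using r(1) s by simp
    fix H assume H: "H \<in> param_space G" and small: "\<forall>(v, i, j)\<in>coords G. cmod (H v $$ (i, j)) < min r s"
    define h where "h = (\<lambda>(v, i, j). H v $$ (i, j))"
    have hr: "\<forall>c\<in>coords G. cmod (h c) < r" and hs: "\<forall>c\<in>coords G. cmod (h c) < s"
      using small by (auto simp: h_def)
    have d': "Determinant.det (condition_matrix (param_add G \<A> H)) \<noteq> 0"
      using r(2)[OF hr] condition_matrix_param_add[OF H, of \<A>] by (simp add: h_def)
    obtain K' where "well_posed (param_add G \<A> H) K'" by (rule well_posed_perturb[OF wp d'])
    then show "param_add G \<A> H \<in> U G - singular_set G"
      using regular_set_iff param_add_mem[OF \<A> H] by blast
    have mon: "monomial G H \<alpha> = monom_at (coords G) h \<alpha>" for \<alpha>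
      unfolding monomial_def h_def by (intro prod.cong) auto
    show "((\<lambda>F. operator_norm G (\<lambda>g e x.
              resolvent G \<i> (param_add G \<A> H) g e x - (\<Sum>\<alpha>\<in>F. monomial G H \<alpha> * C \<alpha> g e x)))
            \<longlongrightarrow> 0) (finite_subsets_at_top (multi_indices G))"
      unfolding mon
      using resolvent_perturbation[OF wp H d', folded h_def] by (intro lim[rule_format, OF hs[rule_format]] conjI)
  qed
qed

end

theorem theorem3p5:
  fixes \<Gamma> :: "('v, 'e) metric_graph"
  assumes "compact_metric_graph \<Gamma>"
  shows "analytic_operator_family \<Gamma> (U \<Gamma> - singular_set \<Gamma>) (resolvent \<Gamma> \<i>) \<and>
         (\<forall>\<A> \<in> U \<Gamma> - singular_set \<Gamma>. compact_operator \<Gamma> (resolvent \<Gamma> \<i> \<A>))"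
proof -
  interpret metric_graph_context \<Gamma> by standard (rule assms)
  show ?thesis
    using analytic_operator_family_resolvent regular_set_iff compact_operator_resolvent by blast
qed

end
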